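(* Let $(T(t))_{t\ge0}$ be a bounded $C_0$-semigroup on a complex Hilbert space $X$, with generator $A$. For $\beta>0$ consider the following condition $(\mathrm{L}_\beta)$: there exists a bounded linear operator $P$ from $D((-A)^\beta)$ into its antidual such that $\langle Px,x\rangle_\beta\ge0$ for all $x\in D((-A)^\beta)$ and $$\langle PAx, y \rangle_\beta + \langle Px, Ay \rangle_\beta = - \langle x, y \rangle, \qquad x,y \in D((-A)^{\beta+1}).$$ If $(\mathrm{L}_\beta)$ holds for some $\beta>0$, then $$\|T(t)x\|=o(t^{-\alpha}),\qquad t\to\infty,$$ for all $x\in D(A)$, where $\alpha=(2\beta)^{-1}$. Conversely, if for some $\alpha>0$ we have $\|T(t)x\|=o(t^{-\alpha})$ as $t\to\infty$ for all $x\in D(A)$, then $(\mathrm{L}_\beta)$ holds for every $\beta>2\alpha^{-1}$.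
   Context: A $C_0$-semigroup $(T(t))_{t\ge0}$ is bounded if $\sup_{t\ge0}\|T(t)\|<\infty$. For $\gamma>0$, $(-A)^\gamma$ is the usual fractional power of the sectorial operator $-A$; its domain $D((-A)^\gamma)$ coincides with the range of the bounded injective operator $(I-A)^{-\gamma}=\frac{1}{\Gamma(\gamma)}\int_0^\infty t^{\gamma-1}e^{-t}T(t)\,\mathrm{d}t$ (strong integral). The domain of an operator is regarded as a normed space with respect to the graph norm. The antidual of a normed space is the space of bounded conjugate-linear functionals on it. $\langle\cdot,\cdot\rangle$ is the inner product of $X$ (linear in the first argument), and $\langle\cdot,\cdot\rangle_\beta$ denotes the antiduality pairing for $D((-A)^\beta)$, i.e. $\langle \phi,y\rangle_\beta=\phi(y)$ for $\phi$ in the antidual of $D((-A)^\beta)$ and $y\in D((-A)^\beta)$. *)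

theory Defs
  imports "HOL-Analysis.Analysis" "HOL-Library.Landau_Symbols"
begin

text \<open>
  Complex Hilbert spaces. The inner product is linear in its first argument. Completeness and
  the real vector space structure come from \<^class>\<open>banach\<close>.
\<close>

class chilbert_space = banach +
  fixes scaleC :: "complex \<Rightarrow> 'a \<Rightarrow> 'a" (infixr "*\<^sub>C" 75)
    and cinner :: "'a \<Rightarrow> 'a \<Rightarrow> complex"
  assumes scaleC_add_right: "a *\<^sub>C (x + y) = a *\<^sub>C x + a *\<^sub>C y"
    and scaleC_add_left: "(a + b) *\<^sub>C x = a *\<^sub>C x + b *\<^sub>C x"
    and scaleC_scaleC: "a *\<^sub>C b *\<^sub>C x = (a * b) *\<^sub>C x"
    and scaleC_of_real: "complex_of_real r *\<^sub>C x = r *\<^sub>R x"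
    and cinner_commute: "cinner x y = cnj (cinner y x)"
    and cinner_add_left: "cinner (x + y) z = cinner x z + cinner y z"
    and cinner_scaleC_left: "cinner (a *\<^sub>C x) y = a * cinner x y"
    and cinner_self: "cinner x x = complex_of_real ((norm x)\<^sup>2)"

instantiation complex :: chilbert_space
begin

definition scaleC_complex :: "complex \<Rightarrow> complex \<Rightarrow> complex"
  where "scaleC_complex a x = a * x"

definition cinner_complex :: "complex \<Rightarrow> complex \<Rightarrow> complex"
  where "cinner_complex x y = x * cnj y"

instance
  by standard
    (simp_all add: scaleC_complex_def cinner_complex_def algebra_simps scaleR_conv_of_real
      complex_norm_square del: of_real_power)

end

definition bounded_clinear_op :: "('a::chilbert_space \<Rightarrow> 'a) \<Rightarrow> bool"
  where "bounded_clinear_op S \<longleftrightarrow> bounded_linear S \<and> (\<forall>c x. S (c *\<^sub>C x) = c *\<^sub>C S x)"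

text \<open>A semigroup is a function on the reals, of which only the values at \<open>t \<ge> 0\<close> matter.\<close>

definition C0_semigroup :: "(real \<Rightarrow> 'a::chilbert_space \<Rightarrow> 'a) \<Rightarrow> bool"
  where "C0_semigroup T \<longleftrightarrow>
    (\<forall>t\<ge>0. bounded_clinear_op (T t)) \<and>
    T 0 = id \<and>
    (\<forall>s\<ge>0. \<forall>t\<ge>0. T (s + t) = T s \<circ> T t) \<and>
    (\<forall>x. ((\<lambda>t. T t x) \<longlongrightarrow> x) (at_right 0))"

definition bounded_C0_semigroup :: "(real \<Rightarrow> 'a::chilbert_space \<Rightarrow> 'a) \<Rightarrow> bool"
  where "bounded_C0_semigroup T \<longleftrightarrow>
    C0_semigroup T \<and> bdd_above ((\<lambda>t. onorm (T t)) ` {0..})"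

definition generator_dom :: "(real \<Rightarrow> 'a::chilbert_space \<Rightarrow> 'a) \<Rightarrow> 'a set"
  where "generator_dom T = {x. \<exists>y. ((\<lambda>h. (T h x - x) /\<^sub>R h) \<longlongrightarrow> y) (at_right 0)}"

definition generator :: "(real \<Rightarrow> 'a::chilbert_space \<Rightarrow> 'a) \<Rightarrow> 'a \<Rightarrow> 'a"
  where "generator T x = Lim (at_right 0) (\<lambda>h. (T h x - x) /\<^sub>R h)"

text \<open>
  For a bounded semigroup with generator \<open>A\<close> and \<open>\<mu>, \<gamma> > 0\<close>, the following is the bounded
  injective operator \<open>(\<mu> - A)\<close> to the power \<open>-\<gamma>\<close>. The integral is a Henstock-Kurzweil integral
  because the Bochner integral of the library needs a separable space; the integrand is continuous
  on \<open>t > 0\<close> and dominated by a multiple of \<open>t powr (\<gamma> - 1) * exp (- \<mu> * t)\<close>.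
\<close>

definition neg_power :: "(real \<Rightarrow> 'a::chilbert_space \<Rightarrow> 'a) \<Rightarrow> real \<Rightarrow> real \<Rightarrow> 'a \<Rightarrow> 'a"
  where "neg_power T \<mu> \<gamma> x =
    (1 / Gamma \<gamma>) *\<^sub>R integral {0..} (\<lambda>t. (t powr (\<gamma> - 1) * exp (- \<mu> * t)) *\<^sub>R T t x)"

text \<open>
  \<open>(\<mu> - A)\<close> to the power \<open>\<gamma>\<close> is the inverse of \<^term>\<open>neg_power T \<mu> \<gamma>\<close>, with domain
  \<^term>\<open>range (neg_power T \<mu> \<gamma>)\<close>. As \<open>- A\<close> is in general not invertible, its fractional power is
  defined, as in Martinez and Sanz, The Theory of Fractional Powers of Operators, Section 5.1,
  as the strong limit of these operators for \<open>\<mu>\<close> tending to 0 from the right, with its natural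
  domain.
\<close>

definition frac_power_dom :: "(real \<Rightarrow> 'a::chilbert_space \<Rightarrow> 'a) \<Rightarrow> real \<Rightarrow> 'a set"
  where "frac_power_dom T \<gamma> =
    {x. (\<forall>\<^sub>F \<mu> in at_right 0. x \<in> range (neg_power T \<mu> \<gamma>)) \<and>
        (\<exists>y. ((\<lambda>\<mu>. inv (neg_power T \<mu> \<gamma>) x) \<longlongrightarrow> y) (at_right 0))}"

definition frac_power :: "(real \<Rightarrow> 'a::chilbert_space \<Rightarrow> 'a) \<Rightarrow> real \<Rightarrow> 'a \<Rightarrow> 'a"
  where "frac_power T \<gamma> x = Lim (at_right 0) (\<lambda>\<mu>. inv (neg_power T \<mu> \<gamma>) x)"

definition graph_norm :: "(real \<Rightarrow> 'a::chilbert_space \<Rightarrow> 'a) \<Rightarrow> real \<Rightarrow> 'a \<Rightarrow> real"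
  where "graph_norm T \<gamma> x = norm x + norm (frac_power T \<gamma> x)"

text \<open>
  The antidual of a subspace \<open>D\<close> normed by \<open>N\<close>. Functionals are represented by functions on the
  whole type, of which only the values on \<open>D\<close> matter.
\<close>

definition antidual :: "'a::chilbert_space set \<Rightarrow> ('a \<Rightarrow> real) \<Rightarrow> ('a \<Rightarrow> complex) set"
  where "antidual D N =
    {\<phi>. (\<forall>x\<in>D. \<forall>y\<in>D. \<phi> (x + y) = \<phi> x + \<phi> y) \<and>
        (\<forall>c. \<forall>x\<in>D. \<phi> (c *\<^sub>C x) = cnj c * \<phi> x) \<and>
        (\<exists>C. \<forall>x\<in>D. cmod (\<phi> x) \<le> C * N x)}"

definition antidual_norm ::
    "'a::chilbert_space set \<Rightarrow> ('a \<Rightarrow> real) \<Rightarrow> ('a \<Rightarrow> complex) \<Rightarrow> real"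
  where "antidual_norm D N \<phi> = (SUP y\<in>{y\<in>D. N y \<le> 1}. cmod (\<phi> y))"

definition bounded_clinear_to_antidual ::
    "'a::chilbert_space set \<Rightarrow> ('a \<Rightarrow> real) \<Rightarrow> ('a \<Rightarrow> 'a \<Rightarrow> complex) \<Rightarrow> bool"
  where "bounded_clinear_to_antidual D N P \<longleftrightarrow>
    (\<forall>x\<in>D. P x \<in> antidual D N) \<and>
    (\<forall>x\<in>D. \<forall>x'\<in>D. \<forall>y\<in>D. P (x + x') y = P x y + P x' y) \<and>
    (\<forall>c. \<forall>x\<in>D. \<forall>y\<in>D. P (c *\<^sub>C x) y = c * P x y) \<and>
    (\<exists>C. \<forall>x\<in>D. antidual_norm D N (P x) \<le> C * N x)"

definition lyapunov_condition :: "(real \<Rightarrow> 'a::chilbert_space \<Rightarrow> 'a) \<Rightarrow> real \<Rightarrow> bool"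
  where "lyapunov_condition T \<beta> \<longleftrightarrow>
    (\<exists>P. bounded_clinear_to_antidual (frac_power_dom T \<beta>) (graph_norm T \<beta>) P \<and>
      (\<forall>x\<in>frac_power_dom T \<beta>. P x x \<in> \<real>\<^sub>\<ge>\<^sub>0) \<and>
      (\<forall>x\<in>frac_power_dom T (\<beta> + 1). \<forall>y\<in>frac_power_dom T (\<beta> + 1).
        P (generator T x) y + P x (generator T y) = - cinner x y))"

end

theory Submission
  imports Defs
begin

text \<open>
  Write \<open>R \<gamma>\<close> for \<open>1 - A\<close> to the power \<open>- \<gamma>\<close> and \<open>R = R 1\<close>. As \<open>R\<close> is power bounded and the
  coefficients of \<open>(1 - r) powr \<gamma>\<close> are absolutely summable, \<open>(- A) powr \<gamma> * R \<gamma>\<close> is the bounded operator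
  \<open>(1 - R) powr \<gamma>\<close>; hence the domain of \<open>(- A) powr \<gamma>\<close> is the range of \<open>R \<gamma>\<close> and its graph norm at
  \<open>R \<gamma> w\<close> is equivalent to the norm of \<open>w\<close>.

  Given \<open>P\<close>, the derivative of \<open>t \<mapsto> P (T t x) (T t x)\<close> is \<open>- (norm (T t x))\<^sup>2\<close>. So orbits in the domain of
  \<open>(- A) powr \<beta>\<close> are square integrable and, by boundedness of \<open>T\<close>, \<open>norm (T t (R \<beta> w))\<close> is \<open>o(t powr (- 1/2))\<close>. Iterating gives
  \<open>o(t powr (- n/2))\<close> for \<open>R (n * \<beta>)\<close>, and if \<open>n * \<beta> \<ge> 1\<close> the moment inequality bounds \<open>R\<close> by
  \<open>R (n * \<beta>)\<close> to the power \<open>1 / (n * \<beta>)\<close>.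

  Conversely, decay of \<open>T t R\<close> is uniform by the Banach-Steinhaus theorem. Products of \<open>T t R\<close>, or for
  \<open>\<beta> < 1\<close> interpolation, make \<open>norm (T t (R \<beta> w))\<close> decay at least like \<open>1 / t\<close>, and \<open>P x y\<close> is the integral
  of \<open>cinner (T t x) (T t y)\<close>.
\<close>

subsection \<open>Integrability of dominated Banach-valued functions\<close>

text \<open>\<open>- A\<close> need not be invertible, so everything is written in the coordinate w
  of x = \<open>R \<beta> w\<close>. There \<open>P\<close> becomes a bounded form on the whole
  space, and the limit \<mu> -> 0 defining the fractional power becomes convergence of the
  coefficients of (1 - (1 - \<mu>) r) powr \<beta>. The moment inequality by itself only carries
  O-bounds to O-bounds. The little o survives because n factors \<open>R \<beta>\<close> supply the
  power of t and one further factor supplies a quantity tending to 0. In the converse, the factor 2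
  in \<open>2 * inverse \<alpha>\<close> pays for replacing \<beta> \<ge> 1 by its integer part,
  which is at least \<beta> / 2. The law \<open>R a (R b x) = R (a + b) x\<close> is tested against
  a vector z, which reduces it to Tonelli for nonnegative scalar functions.\<close>

lemma integrable_approx_cbox:
  fixes f :: "'n::euclidean_space \<Rightarrow> 'b::banach"
  assumes "\<And>e. e > 0 \<Longrightarrow> \<exists>g h. g integrable_on cbox a b \<and> h integrable_on cbox a b \<and>
      (\<forall>x\<in>cbox a b. norm (f x - g x) \<le> h x) \<and> integral (cbox a b) h < e"
  shows "f integrable_on cbox a b"
  unfolding integrable_Cauchy
proof (intro allI impI)
  fix e :: real assume "e > 0"
  then obtain g h where g: "g integrable_on cbox a b" and h: "h integrable_on cbox a b"
    and fg: "\<And>x. x \<in> cbox a b \<Longrightarrow> norm (f x - g x) \<le> h x" and he: "integral (cbox a b) h < e/6"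
    using assms[of "e/6"] by auto
  have e6: "e/6 > 0" using \<open>e > 0\<close> by simp
  obtain d1 where d1: "gauge d1" "\<And>p. \<lbrakk>p tagged_division_of cbox a b; d1 fine p\<rbrakk> \<Longrightarrow>
      norm ((\<Sum>(x,K)\<in>p. measure lborel K *\<^sub>R g x) - integral (cbox a b) g) < e/6"
    using integrable_integral[OF g, unfolded has_integral] e6 by meson
  obtain d2 where d2: "gauge d2" "\<And>p. \<lbrakk>p tagged_division_of cbox a b; d2 fine p\<rbrakk> \<Longrightarrow>
      norm ((\<Sum>(x,K)\<in>p. measure lborel K *\<^sub>R h x) - integral (cbox a b) h) < e/6"
    using integrable_integral[OF h, unfolded has_integral] e6 by meson
  \<comment> \<open>The sum of \<open>h\<close> exceeds its integral by less than e/6, so it stays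
    below e/3, and the sum of \<open>g\<close> is within e/6 of its integral. All fine sums of
    \<open>f\<close> thus lie within e/2 of one fixed vector, which gives the Cauchy condition
    without a candidate for the integral of \<open>f\<close>.\<close>
  have key: "norm ((\<Sum>(x,K)\<in>p. measure lborel K *\<^sub>R f x) - integral (cbox a b) g) < e/2"
    if p: "p tagged_division_of cbox a b" and "d1 fine p" "d2 fine p" for p
  proof -
    have "norm ((\<Sum>(x,K)\<in>p. measure lborel K *\<^sub>R f x) - (\<Sum>(x,K)\<in>p. measure lborel K *\<^sub>R g x))
        = norm (\<Sum>(x,K)\<in>p. measure lborel K *\<^sub>R (f x - g x))"
      by (simp add: sum_subtractf[symmetric] case_prod_unfold scaleR_diff_right)
    also have "\<dots> \<le> (\<Sum>(x,K)\<in>p. measure lborel K *\<^sub>R h x)"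
      using tag_in_interval[OF p] fg
      by (intro sum_norm_le) (auto intro!: mult_left_mono)
    finally have 1: "norm ((\<Sum>(x,K)\<in>p. measure lborel K *\<^sub>R f x) - (\<Sum>(x,K)\<in>p. measure lborel K *\<^sub>R g x))
       \<le> (\<Sum>(x,K)\<in>p. measure lborel K *\<^sub>R h x)" .
    have 2: "(\<Sum>(x,K)\<in>p. measure lborel K *\<^sub>R h x) < e/3"
      using d2(2)[OF p] that he unfolding real_norm_def by linarith
    have "norm ((\<Sum>(x,K)\<in>p. measure lborel K *\<^sub>R f x) - integral (cbox a b) g)
       \<le> norm ((\<Sum>(x,K)\<in>p. measure lborel K *\<^sub>R f x) - (\<Sum>(x,K)\<in>p. measure lborel K *\<^sub>R g x))
        + norm ((\<Sum>(x,K)\<in>p. measure lborel K *\<^sub>R g x) - integral (cbox a b) g)"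
      using norm_triangle_ineq[of "(\<Sum>(x,K)\<in>p. measure lborel K *\<^sub>R f x) - (\<Sum>(x,K)\<in>p. measure lborel K *\<^sub>R g x)"
          "(\<Sum>(x,K)\<in>p. measure lborel K *\<^sub>R g x) - integral (cbox a b) g"] by simp
    then show ?thesis using 1 2 d1(2)[OF p] that by fastforce
  qed
  show "\<exists>d. gauge d \<and> (\<forall>p1 p2. p1 tagged_division_of cbox a b \<and> d fine p1 \<and>
       p2 tagged_division_of cbox a b \<and> d fine p2 \<longrightarrow>
       norm ((\<Sum>(x,K)\<in>p1. measure lborel K *\<^sub>R f x) - (\<Sum>(x,K)\<in>p2. measure lborel K *\<^sub>R f x)) < e)"
  proof (intro exI[of _ "\<lambda>x. d1 x \<inter> d2 x"] conjI allI impI)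
    show "gauge (\<lambda>x. d1 x \<inter> d2 x)" using d1 d2 by (simp add: gauge_Int)
    fix p1 p2 assume "p1 tagged_division_of cbox a b \<and> (\<lambda>x. d1 x \<inter> d2 x) fine p1 \<and>
       p2 tagged_division_of cbox a b \<and> (\<lambda>x. d1 x \<inter> d2 x) fine p2"
    then have "norm ((\<Sum>(x,K)\<in>p1. measure lborel K *\<^sub>R f x) - integral (cbox a b) g) < e/2"
      "norm ((\<Sum>(x,K)\<in>p2. measure lborel K *\<^sub>R f x) - integral (cbox a b) g) < e/2"
      using key by (auto simp: fine_Int)
    then show "norm ((\<Sum>(x,K)\<in>p1. measure lborel K *\<^sub>R f x) - (\<Sum>(x,K)\<in>p2. measure lborel K *\<^sub>R f x)) < e"
      using norm_diff_triangle_less[of _ "integral (cbox a b) g" "e/2" _ "e/2"]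
      by (simp add: norm_minus_commute)
  qed
qed

lemma integrable_on_cbox_of_UNIV:
  fixes f :: "'n::euclidean_space \<Rightarrow> 'b::banach"
  shows "f integrable_on UNIV \<Longrightarrow> f integrable_on cbox a b"
  by (rule integrable_on_subcbox) auto

text \<open>On every box the integrals of \<open>f\<close> and \<open>g\<close> differ by at most
  \<open>integral UNIV h\<close>, whatever the box. So the Cauchy condition for growing boxes passes
  from \<open>g\<close> to \<open>f\<close>.\<close>

lemma integrable_approx:
  fixes f :: "'n::euclidean_space \<Rightarrow> 'b::banach"
  assumes "\<And>e. e > 0 \<Longrightarrow> \<exists>g h. g integrable_on UNIV \<and> h integrable_on UNIV \<and>
      (\<forall>x. norm (f x - g x) \<le> h x) \<and> integral UNIV h < e"
  shows "f integrable_on UNIV"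
proof -
  have fbox: "f integrable_on cbox a b" for a b
  proof (rule integrable_approx_cbox)
    fix e :: real assume "e > 0"
    then obtain g h where gh: "g integrable_on UNIV" "h integrable_on UNIV"
      "\<And>x. norm (f x - g x) \<le> h x" "integral UNIV h < e" using assms by meson
    have "0 \<le> h x" for x using gh(3)[of x] norm_ge_zero order_trans by blast
    then have "integral (cbox a b) h \<le> integral UNIV h"
      using gh by (intro integral_subset_le) (auto intro: integrable_on_cbox_of_UNIV)
    then show "\<exists>g h. g integrable_on cbox a b \<and> h integrable_on cbox a b \<and>
      (\<forall>x\<in>cbox a b. norm (f x - g x) \<le> h x) \<and> integral (cbox a b) h < e"
      using gh by (intro exI[of _ g] exI[of _ h]) (auto intro: integrable_on_cbox_of_UNIV)
  qed
  show ?thesis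
    unfolding integrable_alt[of f UNIV]
  proof (intro conjI allI impI)
    fix e :: real assume "e > 0"
    then obtain g h where gh: "g integrable_on UNIV" "h integrable_on UNIV"
      "\<And>x. norm (f x - g x) \<le> h x" "integral UNIV h < e/4" using assms[of "e/4"] by auto
    have h0: "0 \<le> h x" for x using gh(3)[of x] norm_ge_zero order_trans by blast
    have d: "norm (integral (cbox a b) f - integral (cbox a b) g) < e/4" for a b
    proof -
      have "norm (integral (cbox a b) f - integral (cbox a b) g) = norm (integral (cbox a b) (\<lambda>x. f x - g x))"
        using fbox gh by (subst integral_diff) (auto intro: integrable_on_cbox_of_UNIV)
      also have "\<dots> \<le> integral (cbox a b) h"
        using fbox gh by (intro integral_norm_bound_integral integrable_diff) (auto intro: integrable_on_cbox_of_UNIV)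
      also have "\<dots> \<le> integral UNIV h"
        using gh h0 by (intro integral_subset_le) (auto intro: integrable_on_cbox_of_UNIV)
      finally show ?thesis using gh by simp
    qed
    obtain B where "B > 0" and B: "\<And>a b c d. ball 0 B \<subseteq> cbox a b \<and> ball 0 B \<subseteq> cbox c d \<Longrightarrow>
       norm (integral (cbox a b) g - integral (cbox c d) g) < e/2"
      using gh(1)[unfolded integrable_alt[of g UNIV]] half_gt_zero[OF \<open>e > 0\<close>]
      by (simp only: UNIV_I if_True) meson
    show "\<exists>B>0. \<forall>a b c d. ball 0 B \<subseteq> cbox a b \<and> ball 0 B \<subseteq> cbox c d \<longrightarrow>
       norm (integral (cbox a b) (\<lambda>x. if x \<in> UNIV then f x else 0) -
          integral (cbox c d) (\<lambda>x. if x \<in> UNIV then f x else 0)) < e"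
    proof (intro exI[of _ B] conjI allI impI \<open>B > 0\<close>)
      fix a b c k :: 'n
      assume "ball 0 B \<subseteq> cbox a b \<and> ball 0 B \<subseteq> cbox c k"
      from B[OF this] d[of a b] d[of c k]
      have "norm ((integral (cbox a b) f - integral (cbox a b) g) + (integral (cbox a b) g - integral (cbox c k) g)
          + (integral (cbox c k) g - integral (cbox c k) f)) < e/4 + e/2 + e/4"
        by (intro norm_add_less) (auto simp: norm_minus_commute)
      then show "norm (integral (cbox a b) (\<lambda>x. if x \<in> UNIV then f x else 0) -
          integral (cbox c k) (\<lambda>x. if x \<in> UNIV then f x else 0)) < e"
        by simp
    qed
  qed (use fbox in simp)
qed

text \<open>The function may blow up at 0. It is approximated by its cut-offs to [1/(n+1), n+1],
  where continuity suffices; the error is dominated by the part of \<open>g\<close> left out, whose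
  integral tends to 0.\<close>

lemma integrable_continuous_dominated:
  fixes f :: "real \<Rightarrow> 'b::banach"
  assumes cont: "continuous_on {0<..} f"
    and g: "g integrable_on {0..}" and fg: "\<And>t. t > 0 \<Longrightarrow> norm (f t) \<le> g t"
  shows "f integrable_on {0..}"
proof -
  \<comment> \<open>Nothing is known about \<open>f\<close> and \<open>g\<close> at 0 itself;
    cutting them off there changes a null set and makes the majorant nonnegative everywhere.\<close>
  define f0 where "f0 t = (if t \<in> {0<..} then f t else 0)" for t
  define g0 where "g0 t = (if t \<in> {0<..} then g t else 0)" for t
  have g0: "g0 t \<ge> 0" for t using fg[of t] norm_ge_zero[of "f t"] by (auto simp: g0_def simp del: norm_ge_zero)
  have "(\<lambda>t. if t \<in> {0..} then g t else 0) integrable_on UNIV"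
    using g by (simp only: integrable_restrict_UNIV)
  then have g0i: "g0 integrable_on UNIV"
    by (rule integrable_spike[where S = "{0}"]) (auto simp: g0_def)
  define I where "I n = {inverse (real (Suc n))..real (Suc n)}" for n
  define h where "h n t = (if t \<in> I n then g0 t else 0)" for n t
  have Ipos: "t > 0" if "t \<in> I n" for t n
    using that unfolding I_def by (simp) (smt (verit) inverse_positive_iff_positive of_nat_0_le_iff)
  have hi: "h n integrable_on UNIV" for n
    unfolding h_def integrable_restrict_UNIV I_def
    by (rule integrable_on_subinterval[OF g0i]) simp
  have "(\<lambda>n. integral UNIV (h n)) \<longlonglongrightarrow> integral UNIV g0"
  proof (rule dominated_convergence(2)[where h = g0])
    show "(\<lambda>n. h n t) \<longlonglongrightarrow> g0 t" for t
    proof (cases "t > 0")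
      case True
      have "\<forall>\<^sub>F n in sequentially. inverse (real (Suc n)) < t"
        using LIMSEQ_inverse_real_of_nat True by (rule order_tendstoD)
      moreover have "\<forall>\<^sub>F n in sequentially. t \<le> real (Suc n)"
        by (metis (mono_tags, lifting) eventually_sequentiallyI le_SucI nat_ceiling_le_eq)
      ultimately have "\<forall>\<^sub>F n in sequentially. h n t = g0 t"
        by eventually_elim (auto simp: h_def I_def)
      then show ?thesis by (simp add: tendsto_eventually)
    next
      case False then show ?thesis by (simp add: h_def g0_def cong: if_cong)
    qed
    show "norm (h n t) \<le> g0 t" for n t using g0 by (auto simp: h_def)
  qed (use g0i hi in auto)
  have "f0 integrable_on UNIV"
  proof (rule integrable_approx)
    fix e :: real assume "e > 0"
    then obtain n where "norm (integral UNIV (h n) - integral UNIV g0) < e"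
      using \<open>_ \<longlonglongrightarrow> integral UNIV g0\<close> LIMSEQ_D by blast
    then have n: "integral UNIV (\<lambda>t. g0 t - h n t) < e"
      using integral_diff[OF g0i hi] by (simp add: abs_if split: if_splits)
    have "f integrable_on I n" unfolding I_def
      by (intro integrable_continuous_real continuous_on_subset[OF cont]) (use Ipos in \<open>auto simp: I_def\<close>)
    then have "(\<lambda>t. if t \<in> I n then f t else 0) integrable_on UNIV"
      by (simp only: integrable_restrict_UNIV)
    then show "\<exists>u v. u integrable_on UNIV \<and> v integrable_on UNIV \<and>
      (\<forall>x. norm (f0 x - u x) \<le> v x) \<and> integral UNIV v < e"
      using n integrable_diff[OF g0i hi] Ipos fg
      by (intro exI[of _ "\<lambda>t. if t \<in> I n then f t else 0"] exI[of _ "\<lambda>t. g0 t - h n t"])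
        (auto simp: f0_def h_def g0_def)
  qed
  then have "(\<lambda>t. if t \<in> {0..} then f t else 0) integrable_on UNIV"
    by (rule integrable_spike[where S = "{0}"]) (auto simp: f0_def)
  then show ?thesis by (simp only: integrable_restrict_UNIV)
qed

subsection \<open>Bounded semigroups\<close>

lemma cinner_add_right: "cinner x (y + z) = cinner x y + cinner x z"
  by (metis cinner_add_left cinner_commute complex_cnj_add)

lemma cinner_scaleC_right: "cinner x (a *\<^sub>C y) = cnj a * cinner x y"
  by (metis cinner_commute cinner_scaleC_left complex_cnj_mult)

lemma cinner_scaleR_left: "cinner (r *\<^sub>R x) y = r *\<^sub>R cinner x y"
  by (metis cinner_scaleC_left scaleC_of_real scaleR_conv_of_real)

lemma cinner_scaleR_right: "cinner x (r *\<^sub>R y) = r *\<^sub>R cinner x y"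
  by (metis cinner_scaleC_right complex_cnj_complex_of_real scaleC_of_real scaleR_conv_of_real)

lemma cinner_diff_left: "cinner (x - y) z = cinner x z - cinner y z"
  using cinner_add_left[of "x - y" y z] by simp

lemma cinner_diff_right: "cinner x (y - z) = cinner x y - cinner x z"
  using cinner_add_right[of x "y - z" z] by simp

lemma cinner_zero_right [simp]: "cinner x 0 = 0"
  using cinner_add_right[of x 0 0] by simp

lemma cmod_cinner_le: "cmod (cinner x y) \<le> norm x * norm y"
proof (cases "y = 0")
  case False
  define n where "n = (norm y)\<^sup>2"
  \<comment> \<open>\<open>c *\<^sub>C y\<close> is the orthogonal projection of x to the line
    through y; all cross terms in the squared norm of the remainder coincide.\<close>
  define c where "c = cinner x y / of_real n"
  have n: "n > 0" using False by (simp add: n_def)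
  have eq: "cinner x (c *\<^sub>C y) = of_real ((cmod (cinner x y))\<^sup>2 / n)"
    using n by (simp add: cinner_scaleC_right c_def mult.commute complex_norm_square
        del: of_real_power)
  have eq': "cinner (c *\<^sub>C y) x = of_real ((cmod (cinner x y))\<^sup>2 / n)"
    using cinner_commute[of "c *\<^sub>C y" x] eq by (metis complex_cnj_complex_of_real)
  have eq'': "cinner (c *\<^sub>C y) (c *\<^sub>C y) = of_real ((cmod (cinner x y))\<^sup>2 / n)"
    unfolding eq[symmetric] cinner_scaleC_left[of c y] using n
    by (simp add: cinner_scaleC_right cinner_self c_def n_def[symmetric] del: of_real_power)
  have "of_real ((norm (x - c *\<^sub>C y))\<^sup>2) = cinner (x - c *\<^sub>C y) (x - c *\<^sub>C y)"
    by (simp only: cinner_self)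
  also have "\<dots> = cinner x x - of_real ((cmod (cinner x y))\<^sup>2 / n)"
    unfolding cinner_diff_left cinner_diff_right eq eq' eq'' by simp
  finally have "complex_of_real ((norm (x - c *\<^sub>C y))\<^sup>2)
      = of_real ((norm x)\<^sup>2 - (cmod (cinner x y))\<^sup>2 / n)"
    unfolding cinner_self by simp
  then have "(norm (x - c *\<^sub>C y))\<^sup>2 = (norm x)\<^sup>2 - (cmod (cinner x y))\<^sup>2 / n"
    using of_real_eq_iff by blast
  then have "(cmod (cinner x y))\<^sup>2 / n \<le> (norm x)\<^sup>2"
    by (metis diff_ge_0_iff_ge zero_le_power2)
  then have "(cmod (cinner x y))\<^sup>2 \<le> (norm x * norm y)\<^sup>2"
    using n by (simp add: n_def field_simps)
  then show ?thesis by (meson mult_nonneg_nonneg norm_ge_zero power2_le_imp_le)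
qed simp

lemma bounded_bilinear_cinner: "bounded_bilinear cinner"
  by standard (auto simp: cinner_add_left cinner_add_right cinner_scaleR_left cinner_scaleR_right
      intro!: exI[of _ 1] cmod_cinner_le)

lemma eq_zero_if_Re_cinner_zero: "(\<And>z. Re (cinner x z) = 0) \<Longrightarrow> x = 0"
  by (metis Re_complex_of_real cinner_self norm_eq_zero zero_eq_power2)

text \<open>On t > 0 the complex power is real, so the kernel is the real part of the integrand of
  the complex Gamma integral with scale \<mu>.\<close>

lemma gamma_kernel_integrable:
  assumes "\<mu> > (0::real)" "\<gamma> > 0"
  shows "(\<lambda>t. t powr (\<gamma> - 1) * exp (- \<mu> * t)) integrable_on {0..}"
proof -
  have "(\<lambda>t. complex_of_real t powr (of_real \<gamma> - 1) / of_real (exp (\<mu> * t))) integrable_on {0<..}"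
    using absolutely_integrable_Gamma_integral[of "of_real \<gamma>" \<mu>] assms
    by (simp add: absolutely_integrable_on_def)
  then have "(Re \<circ> (\<lambda>t. complex_of_real t powr (of_real \<gamma> - 1) / of_real (exp (\<mu> * t)))) integrable_on {0<..}"
    by (rule integrable_linear[OF _ bounded_linear_Re])
  then have "(\<lambda>t. t powr (\<gamma> - 1) * exp (- \<mu> * t)) integrable_on {0<..}"
  proof (rule integrable_eq)
    fix t :: real assume "t \<in> {0<..}"
    then have "complex_of_real t powr (of_real \<gamma> - 1) / of_real (exp (\<mu> * t))
        = of_real (t powr (\<gamma> - 1) * exp (- \<mu> * t))"
      using powr_of_real[of t "\<gamma> - 1"] by (simp add: exp_minus divide_inverse flip: of_real_exp)
    then show "(Re \<circ> (\<lambda>t. complex_of_real t powr (of_real \<gamma> - 1) / of_real (exp (\<mu> * t)))) t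
        = t powr (\<gamma> - 1) * exp (- \<mu> * t)" unfolding o_def by (simp only: Re_complex_of_real)
  qed
  then have "(\<lambda>t. if t \<in> {0<..} then t powr (\<gamma> - 1) * exp (- \<mu> * t) else 0) integrable_on UNIV"
    by (simp only: integrable_restrict_UNIV)
  then have "(\<lambda>t. if t \<in> {0..} then t powr (\<gamma> - 1) * exp (- \<mu> * t) else 0) integrable_on UNIV"
    by (rule integrable_eq) auto
  then show ?thesis by (simp only: integrable_restrict_UNIV)
qed

lemma gamma_kernel_has_integral:
  "(\<gamma>::real) > 0 \<Longrightarrow> ((\<lambda>t. t powr (\<gamma> - 1) * exp (- t)) has_integral Gamma \<gamma>) {0..}"
  by (rule has_integral_eq[OF _ Gamma_integral_real[of \<gamma>]]) (auto simp: exp_minus field_simps)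

text \<open>Taking \<open>M \<ge> 1\<close> lets the same constant also bound the identity, the
  zeroth power of \<open>R 1\<close>.\<close>

locale bounded_semigroup =
  fixes T :: "real \<Rightarrow> 'a::chilbert_space \<Rightarrow> 'a" and M :: real
  assumes linear_T: "t \<ge> 0 \<Longrightarrow> bounded_linear (T t)"
    and T_scaleC: "t \<ge> 0 \<Longrightarrow> T t (c *\<^sub>C x) = c *\<^sub>C T t x"
    and T_0 [simp]: "T 0 x = x"
    and T_add: "s \<ge> 0 \<Longrightarrow> t \<ge> 0 \<Longrightarrow> T (s + t) x = T s (T t x)"
    and right_cont: "((\<lambda>t. T t x) \<longlongrightarrow> x) (at_right 0)"
    and norm_T: "t \<ge> 0 \<Longrightarrow> norm (T t x) \<le> M * norm x"
    and M_ge_1: "M \<ge> 1"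

lemma bounded_semigroup_if_bounded_C0_semigroup:
  assumes "bounded_C0_semigroup T"
  shows "\<exists>M. bounded_semigroup T M"
proof -
  from assms have T: "\<And>t. t \<ge> 0 \<Longrightarrow> bounded_linear (T t)"
    and r: "\<And>t c x. t \<ge> 0 \<Longrightarrow> T t (c *\<^sub>C x) = c *\<^sub>C T t x" "T 0 = id"
    "\<And>s t. s \<ge> 0 \<Longrightarrow> t \<ge> 0 \<Longrightarrow> T (s + t) = T s \<circ> T t"
    "\<And>x. ((\<lambda>t. T t x) \<longlongrightarrow> x) (at_right 0)"
    "bdd_above ((\<lambda>t. onorm (T t)) ` {0..})"
    by (auto simp: bounded_C0_semigroup_def C0_semigroup_def bounded_clinear_op_def)
  then obtain K where K: "\<And>t. t \<ge> 0 \<Longrightarrow> onorm (T t) \<le> K"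
    unfolding bdd_above_def by (metis atLeast_iff imageI)
  have "norm (T t x) \<le> max 1 K * norm x" if "t \<ge> 0" for t x
  proof -
    have "norm (T t x) \<le> onorm (T t) * norm x" by (rule onorm[OF T[OF that]])
    also have "\<dots> \<le> max 1 K * norm x" using K[OF that] by (intro mult_right_mono) auto
    finally show ?thesis .
  qed
  then have "bounded_semigroup T (max 1 K)"
    using T r by (intro bounded_semigroup.intro) auto
  then show ?thesis by blast
qed

context bounded_semigroup
begin

lemmas T_add_right = linear_T[THEN bounded_linear.linear, THEN linear_add]
  and T_diff_right = linear_T[THEN bounded_linear.linear, THEN linear_diff]
  and T_scaleR = linear_T[THEN bounded_linear.linear, THEN linear_scale]
  and T_zero = linear_T[THEN bounded_linear.linear, THEN linear_0]

lemma M_pos: "M > 0" using M_ge_1 by linarith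

lemma T_commute: "s \<ge> 0 \<Longrightarrow> t \<ge> 0 \<Longrightarrow> T s (T t x) = T t (T s x)"
  by (metis T_add add.commute)

text \<open>For s \<le> u one has T s x - T u x = T s (x - T (u - s) x). By the uniform bound on
  \<open>T s\<close>, both one-sided limits at t reduce to right continuity at 0.\<close>

lemma continuous_T: "continuous_on {0..} (\<lambda>t. T t x)"
  unfolding continuous_on_iff
proof (intro ballI allI impI)
  fix t e :: real assume t: "t \<in> {0..}" and e: "e > 0"
  have *: "norm (T s x - T u x) \<le> M * norm (T (u - s) x - x)" if "0 \<le> s" "s \<le> u" for s u
  proof -
    have "T u x = T s (T (u - s) x)" using T_add[of s "u - s" x] that by simp
    then have "T s x - T u x = T s (x - T (u - s) x)" using that by (simp add: T_diff_right)
    then show ?thesis using norm_T[OF that(1)] by (metis norm_minus_commute)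
  qed
  have "\<forall>\<^sub>F h in at_right 0. dist (T h x) x < e / M"
    using right_cont e M_pos by (intro tendstoD) auto
  then obtain d where d: "d > 0" "\<And>h. 0 < h \<Longrightarrow> h < d \<Longrightarrow> norm (T h x - x) < e / M"
    by (auto simp: eventually_at_right_field dist_norm)
  have "dist (T s x) (T t x) < e" if "s \<in> {0..}" "dist s t < d" for s
  proof (cases "s = t")
    case False
    have "norm (T \<bar>s - t\<bar> x - x) < e / M" using False that d by (intro d) (auto simp: dist_norm)
    then have "M * norm (T \<bar>s - t\<bar> x - x) < e" using M_pos by (simp add: field_simps)
    moreover have "norm (T s x - T t x) \<le> M * norm (T \<bar>s - t\<bar> x - x)"
      using *[of s t] *[of t s] that t by (cases "s \<le> t") (auto simp: norm_minus_commute)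
    ultimately show ?thesis by (simp add: dist_norm)
  qed (use e in simp)
  then show "\<exists>d>0. \<forall>s\<in>{0..}. dist s t < d \<longrightarrow> dist (T s x) (T t x) < e" using d(1) by blast
qed

lemma kernel_integrable:
  assumes "\<mu> > 0" "\<gamma> > 0"
  shows "(\<lambda>t. (t powr (\<gamma> - 1) * exp (- \<mu> * t)) *\<^sub>R T t x) integrable_on {0..}"
proof (rule integrable_continuous_dominated)
  show "continuous_on {0<..} (\<lambda>t. (t powr (\<gamma> - 1) * exp (- \<mu> * t)) *\<^sub>R T t x)"
    by (intro continuous_intros continuous_on_subset[OF continuous_T]) auto
  show "(\<lambda>t. (t powr (\<gamma> - 1) * exp (- \<mu> * t)) * (M * norm x)) integrable_on {0..}"
    using gamma_kernel_integrable[OF assms] by (rule integrable_on_mult_left)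
qed (auto intro!: mult_left_mono norm_T)

abbreviation R :: "real \<Rightarrow> 'a \<Rightarrow> 'a" where "R \<equiv> neg_power T 1"

lemma R_has_integral:
  assumes "\<gamma> > 0"
  shows "((\<lambda>t. (t powr (\<gamma> - 1) * exp (- t)) *\<^sub>R T t x) has_integral Gamma \<gamma> *\<^sub>R R \<gamma> x) {0..}"
proof -
  have "Gamma \<gamma> *\<^sub>R R \<gamma> x = integral {0..} (\<lambda>t. (t powr (\<gamma> - 1) * exp (- 1 * t)) *\<^sub>R T t x)"
    using Gamma_real_pos[OF assms] by (simp add: neg_power_def)
  then show ?thesis using integrable_integral[OF kernel_integrable[OF zero_less_one assms, of x]]
    by simp
qed

lemma R_eqI:
  assumes "\<gamma> > 0"
    and "((\<lambda>t. (t powr (\<gamma> - 1) * exp (- t)) *\<^sub>R T t x) has_integral Gamma \<gamma> *\<^sub>R y) {0..}"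
  shows "R \<gamma> x = y"
  using has_integral_unique[OF R_has_integral[OF assms(1), of x] assms(2)] Gamma_real_pos[OF assms(1)]
  by simp

text \<open>Divided by \<open>Gamma \<gamma>\<close> the kernel is a probability density, so the
  bound does not depend on \<gamma>. In particular all powers of \<open>R 1\<close> are uniformly
  bounded.\<close>

lemma norm_R:
  assumes \<gamma>: "\<gamma> > 0" shows "norm (R \<gamma> x) \<le> M * norm x"
proof -
  note 1 = R_has_integral[OF \<gamma>, of x]
    and 2 = has_integral_mult_left[OF gamma_kernel_has_integral[OF \<gamma>], of "M * norm x"]
  have "norm (integral {0..} (\<lambda>t. (t powr (\<gamma> - 1) * exp (- t)) *\<^sub>R T t x))
      \<le> integral {0..} (\<lambda>t. (t powr (\<gamma> - 1) * exp (- t)) * (M * norm x))"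
    using 1[THEN has_integral_integrable] 2[THEN has_integral_integrable]
    by (rule integral_norm_bound_integral) (auto intro!: mult_left_mono norm_T)
  then have "norm (Gamma \<gamma> *\<^sub>R R \<gamma> x) \<le> Gamma \<gamma> * (M * norm x)"
    by (simp only: integral_unique[OF 1] integral_unique[OF 2])
  then show ?thesis using Gamma_real_pos[OF \<gamma>] by simp
qed

lemma linear_R:
  assumes \<gamma>: "\<gamma> > 0" shows "bounded_linear (R \<gamma>)"
proof (rule bounded_linear_intro[where K = M])
  show "R \<gamma> (x + y) = R \<gamma> x + R \<gamma> y" for x y
  proof (rule R_eqI[OF \<gamma>])
    show "((\<lambda>t. (t powr (\<gamma> - 1) * exp (- t)) *\<^sub>R T t (x + y)) has_integral Gamma \<gamma> *\<^sub>R (R \<gamma> x + R \<gamma> y)) {0..}"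
      using has_integral_add[OF R_has_integral[OF \<gamma>, of x] R_has_integral[OF \<gamma>, of y]]
      unfolding scaleR_add_right[symmetric] by (rule has_integral_eq[rotated]) (simp add: T_add_right)
  qed
  show "R \<gamma> (r *\<^sub>R x) = r *\<^sub>R R \<gamma> x" for r x
  proof (rule R_eqI[OF \<gamma>])
    show "((\<lambda>t. (t powr (\<gamma> - 1) * exp (- t)) *\<^sub>R T t (r *\<^sub>R x)) has_integral Gamma \<gamma> *\<^sub>R r *\<^sub>R R \<gamma> x) {0..}"
      using has_integral_cmul[OF R_has_integral[OF \<gamma>, of x], of r]
      unfolding scaleR_left_commute[of r] by (rule has_integral_eq[rotated]) (simp add: T_scaleR)
  qed
  show "norm (R \<gamma> x) \<le> norm x * M" for x using norm_R[OF \<gamma>, of x] by (simp add: mult.commute)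
qed

lemmas R_add_right = linear_R[THEN bounded_linear.linear, THEN linear_add]
  and R_diff_right = linear_R[THEN bounded_linear.linear, THEN linear_diff]
  and R_scaleR = linear_R[THEN bounded_linear.linear, THEN linear_scale]
  and R_zero = linear_R[THEN bounded_linear.linear, THEN linear_0]

lemma T_R:
  assumes "\<gamma> > 0" "s \<ge> 0" shows "T s (R \<gamma> x) = R \<gamma> (T s x)"
proof (rule R_eqI[OF assms(1), symmetric])
  show "((\<lambda>t. (t powr (\<gamma> - 1) * exp (- t)) *\<^sub>R T t (T s x)) has_integral Gamma \<gamma> *\<^sub>R T s (R \<gamma> x)) {0..}"
    using has_integral_linear[OF R_has_integral[OF assms(1), of x] linear_T[OF assms(2)]]
    unfolding T_scaleR[OF assms(2)] o_def
    by (rule has_integral_eq[rotated]) (use assms(2) in \<open>auto simp: T_scaleR T_commute\<close>)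
qed

end

subsection \<open>The semigroup law of the negative powers\<close>

lemma Beta_real_pos: "(a::real) > 0 \<Longrightarrow> b > 0 \<Longrightarrow> Beta a b > 0"
  by (simp add: Beta_def Gamma_real_pos)

text \<open>The substitution s = u x carries [0, u] to [0, 1] and leaves the Beta integral.\<close>

lemma Beta_conv_nn_integral:
  assumes a: "a > (0::real)" and b: "b > 0" and u: "u > 0"
  shows "(\<integral>\<^sup>+s. ennreal (indicator {0..u} s * s powr (a - 1) * (u - s) powr (b - 1)) \<partial>lborel)
    = ennreal (Beta a b * u powr (a + b - 1))"
proof -
  have "(\<integral>\<^sup>+s. ennreal (indicator {0..u} s * s powr (a - 1) * (u - s) powr (b - 1)) \<partial>lborel)
    = (\<integral>\<^sup>+s. ennreal (indicator {0..1} s * (u * s) powr (a - 1) * (u - u * s) powr (b - 1))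
          \<partial>distr lborel borel ((*) (1 / u)))" (is "_ = nn_integral _ ?f")
    using u by (subst nn_integral_distr) (auto simp: indicator_def field_simps intro!: nn_integral_cong)
  also have "distr lborel borel ((*) (1 / u)) = density lborel (\<lambda>_. u)"
    using u by (subst lborel_distr_mult) auto
  also have "nn_integral \<dots> ?f = (\<integral>\<^sup>+x. ennreal (indicator {0..1} x * (u * (u * x) powr (a - 1) *
      (u * (1 - x)) powr (b - 1))) \<partial>lborel)" using u
    by (subst nn_integral_density) (auto simp: ennreal_mult' [symmetric] algebra_simps)
  also have "\<dots> = (\<integral>\<^sup>+x. ennreal (u powr (a + b - 1)) *
      ennreal (indicator {0..1} x * (x powr (a - 1) * (1 - x) powr (b - 1))) \<partial>lborel)" using u a b
    by (intro nn_integral_cong)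
      (auto simp: indicator_def powr_mult powr_add powr_diff mult_ac ennreal_mult' [symmetric])
  also have "\<dots> = ennreal (u powr (a + b - 1)) *
      (\<integral>\<^sup>+x. ennreal (indicator {0..1} x * (x powr (a - 1) * (1 - x) powr (b - 1))) \<partial>lborel)"
    by (subst nn_integral_cmult) auto
  also have "(\<integral>\<^sup>+x. ennreal (indicator {0..1} x * (x powr (a - 1) * (1 - x) powr (b - 1))) \<partial>lborel)
      = ennreal (Beta a b)"
    by (rule nn_integral_has_integral_lebesgue[OF _ has_integral_Beta_real[OF a b]]) auto
  finally show ?thesis using u Beta_real_pos[OF a b] by (simp add: ennreal_mult' [symmetric] mult_ac)
qed

text \<open>Up to normalisation: the sum of independent Gamma variables with parameters a and b is a
  Gamma variable with parameter a + b. As \<open>\<psi>\<close> is nonnegative, the integrals may be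
  exchanged without any integrability check.\<close>

lemma gamma_kernel_convolution:
  fixes \<psi> :: "real \<Rightarrow> real"
  assumes a: "a > 0" and b: "b > 0" and [measurable]: "\<psi> \<in> borel_measurable borel"
    and pos: "\<And>u. \<psi> u \<ge> 0"
  shows "(\<integral>\<^sup>+s. \<integral>\<^sup>+t. ennreal (indicator {0..} s * (s powr (a - 1) * exp (- s))) *
      ennreal (indicator {0..} t * (t powr (b - 1) * exp (- t) * \<psi> (s + t))) \<partial>lborel \<partial>lborel)
    = ennreal (Beta a b) *
      (\<integral>\<^sup>+u. ennreal (indicator {0..} u * (u powr (a + b - 1) * exp (- u) * \<psi> u)) \<partial>lborel)"
    (is "?L = ?R")
proof -
  have "?L = (\<integral>\<^sup>+s. \<integral>\<^sup>+t. ennreal (indicator ({0..}\<times>{0..}) (s, t) * (s powr (a - 1) * t powr (b - 1)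
      * (exp (- (s + t)) * \<psi> (s + t)))) \<partial>lborel \<partial>lborel)"
    by (intro nn_integral_cong) (auto simp: indicator_def ennreal_mult' [symmetric] exp_add mult_ac exp_diff exp_minus divide_inverse)
  also have "\<dots> = (\<integral>\<^sup>+s. \<integral>\<^sup>+u. ennreal (indicator ({0..}\<times>{s..}) (s, u) * (s powr (a - 1) *
      (u - s) powr (b - 1) * (exp (- u) * \<psi> u))) \<partial>lborel \<partial>lborel)"
  \<comment> \<open>For fixed s, translation invariance of Lebesgue measure permits the new variable
    u = s + t.\<close>
  proof (rule nn_integral_cong, goal_cases)
    case (1 s)
    have "(\<integral>\<^sup>+t. ennreal (indicator ({0..}\<times>{0..}) (s, t) * (s powr (a - 1) * t powr (b - 1)
        * (exp (- (s + t)) * \<psi> (s + t)))) \<partial>distr lborel borel ((+) (- s)))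
      = (\<integral>\<^sup>+u. ennreal (indicator ({0..}\<times>{s..}) (s, u) * (s powr (a - 1) *
      (u - s) powr (b - 1) * (exp (- u) * \<psi> u))) \<partial>lborel)"
      by (subst nn_integral_distr) (auto intro!: nn_integral_cong simp: indicator_def)
    then show ?case by (subst (asm) lborel_distr_plus)
  qed
  also have "\<dots> = (\<integral>\<^sup>+u. \<integral>\<^sup>+s. ennreal (indicator ({0..}\<times>{s..}) (s, u) * (s powr (a - 1) *
      (u - s) powr (b - 1) * (exp (- u) * \<psi> u))) \<partial>lborel \<partial>lborel)"
    by (subst lborel_pair.Fubini')
      (auto simp: case_prod_unfold indicator_def cong: measurable_cong_sets)
  also have "\<dots> = (\<integral>\<^sup>+u. \<integral>\<^sup>+s. ennreal (indicator {0..u} s * s powr (a - 1) * (u - s) powr (b - 1)) *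
      ennreal (indicator {0..} u * (exp (- u) * \<psi> u)) \<partial>lborel \<partial>lborel)"
    by (intro nn_integral_cong) (auto simp: indicator_def ennreal_mult' [symmetric] pos)
  also have "\<dots> = (\<integral>\<^sup>+u. (\<integral>\<^sup>+s. ennreal (indicator {0..u} s * s powr (a - 1) * (u - s) powr (b - 1)) \<partial>lborel) *
      ennreal (indicator {0..} u * (exp (- u) * \<psi> u)) \<partial>lborel)"
    by (subst nn_integral_multc [symmetric]) auto
  also have "\<dots> = (\<integral>\<^sup>+u. ennreal (Beta a b) *
      ennreal (indicator {0..} u * (u powr (a + b - 1) * exp (- u) * \<psi> u)) \<partial>lborel)"
  \<comment> \<open>The Beta integral was evaluated for u > 0 only; the point u = 0 is a null
    set.\<close>
  proof (intro nn_integral_cong_AE eventually_mono[OF AE_lborel_singleton[of 0]])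
    fix u :: real assume "u \<noteq> 0"
    show "(\<integral>\<^sup>+s. ennreal (indicator {0..u} s * s powr (a - 1) * (u - s) powr (b - 1)) \<partial>lborel) *
      ennreal (indicator {0..} u * (exp (- u) * \<psi> u)) = ennreal (Beta a b) *
      ennreal (indicator {0..} u * (u powr (a + b - 1) * exp (- u) * \<psi> u))"
    proof (cases "u > 0")
      case True
      have "Beta a b > 0" using a b by (simp add: Beta_real_pos)
      then show ?thesis using True pos[of u] unfolding Beta_conv_nn_integral[OF a b True]
        by (simp add: ennreal_mult' [symmetric] mult_ac)
    qed (use \<open>u \<noteq> 0\<close> in auto)
  qed
  also have "\<dots> = ?R"
    by (subst nn_integral_cmult) auto
  finally show ?thesis .
qed

context bounded_semigroup
begin

text \<open>Adding K makes the integrand nonnegative and contributes exactly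
  \<open>Gamma \<gamma> * K\<close>. The shift by s is present so that the inner integral of the
  convolution can be evaluated.\<close>

lemma Re_cinner_R_nn_integral:
  assumes \<gamma>: "\<gamma> > 0" and K: "norm x * norm z * M \<le> K" and s: "s \<ge> 0"
  shows "(\<integral>\<^sup>+t. ennreal (indicator {0..} t * (t powr (\<gamma> - 1) * exp (- t) *
      (Re (cinner (T (s + t) x) z) + K))) \<partial>lborel)
    = ennreal (Gamma \<gamma> * (Re (cinner (T s (R \<gamma> x)) z) + K))"
proof (rule nn_integral_has_integral_lebesgue)
  have lin: "bounded_linear (\<lambda>y. Re (cinner (T s y) z))"
    by (intro bounded_linear_compose[OF bounded_linear_Re]
        bounded_linear_compose[OF bounded_bilinear.bounded_linear_left[OF bounded_bilinear_cinner]]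
        linear_T s)
  have "((\<lambda>t. Re (cinner (T s ((t powr (\<gamma> - 1) * exp (- t)) *\<^sub>R T t x)) z) + t powr (\<gamma> - 1) * exp (- t) * K)
      has_integral (Re (cinner (T s (Gamma \<gamma> *\<^sub>R R \<gamma> x)) z) + Gamma \<gamma> * K)) {0..}"
    using has_integral_linear[OF R_has_integral[OF \<gamma>, of x] lin]
    unfolding o_def by (intro has_integral_add has_integral_mult_left gamma_kernel_has_integral \<gamma>)
  then show "((\<lambda>t. t powr (\<gamma> - 1) * exp (- t) * (Re (cinner (T (s + t) x) z) + K)) has_integral
      Gamma \<gamma> * (Re (cinner (T s (R \<gamma> x)) z) + K)) {0..}"
    unfolding T_scaleR[OF s] cinner_scaleR_left
    by (simp add: distrib_left) (rule has_integral_eq[rotated], simp, simp add: T_add s distrib_left)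
  fix t :: real assume "t \<in> {0..}"
  then have "\<bar>Re (cinner (T (s + t) x) z)\<bar> \<le> M * norm x * norm z"
    using abs_Re_le_cmod[of "cinner (T (s + t) x) z"] cmod_cinner_le[of "T (s + t) x" z]
      mult_right_mono[OF norm_T[of "s + t" x], of "norm z"] s by fastforce
  then show "0 \<le> t powr (\<gamma> - 1) * exp (- t) * (Re (cinner (T (s + t) x) z) + K)"
    using K by (intro mult_nonneg_nonneg) (auto simp: mult_ac)
qed

text \<open>The convolution of the kernels for a and b, integrated against the shifted scalar orbit
  of x, is evaluated once as a double integral and once along u = s + t. As z is arbitrary, the real
  parts determine the vectors.\<close>

lemma R_R:
  assumes a: "a > 0" and b: "b > 0"
  shows "R a (R b x) = R (a + b) x"
proof -
  have "Re (cinner (R a (R b x) - R (a + b) x) z) = 0" for z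
  proof -
    \<comment> \<open>The second factor M makes the same K large enough for the vector
      \<open>R b x\<close>, whose norm is at most \<open>M * norm x\<close>.\<close>
    define K where "K = M * (M * norm x) * norm z"
    have "norm (R b x) \<le> M * norm x" by (rule norm_R[OF b])
    then have K1: "norm (R b x) * norm z * M \<le> K"
      using M_pos mult_right_mono[of "norm (R b x)" "M * norm x" "norm z * M"] by (simp add: K_def mult_ac)
    have "norm x * norm z * M * 1 \<le> norm x * norm z * M * M"
      using M_ge_1 by (intro mult_left_mono) auto
    then have K2: "norm x * norm z * M \<le> K" by (simp add: K_def mult_ac)
    \<comment> \<open>Freezing the orbit at time 0 for u < 0 makes \<open>\<psi>\<close> continuous
      on the whole line, hence Borel measurable.\<close>
    define \<psi> where "\<psi> u = Re (cinner (T (max 0 u) x) z) + K" for u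
    have "continuous_on UNIV (\<lambda>u. T (max 0 u) x)"
      by (rule continuous_on_compose2[OF continuous_T]) (auto intro!: continuous_intros)
    then have "continuous_on UNIV \<psi>" unfolding \<psi>_def
      by (intro continuous_intros bounded_bilinear.continuous_on[OF bounded_bilinear_cinner])
    then have [measurable]: "\<psi> \<in> borel_measurable borel"
      by (rule borel_measurable_continuous_onI)
    have pos: "\<psi> u \<ge> 0" for u
    proof -
      have "\<bar>Re (cinner (T (max 0 u) x) z)\<bar> \<le> M * norm x * norm z"
        using abs_Re_le_cmod[of "cinner (T (max 0 u) x) z"] cmod_cinner_le[of "T (max 0 u) x" z]
          mult_right_mono[OF norm_T[of "max 0 u" x], of "norm z"] by fastforce
      then show ?thesis using K2 by (simp add: \<psi>_def mult_ac)
    qed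
    have "ennreal (Beta a b) * ennreal (Gamma (a + b) * (Re (cinner (R (a + b) x) z) + K))
      = ennreal (Beta a b) *
        (\<integral>\<^sup>+u. ennreal (indicator {0..} u * (u powr (a + b - 1) * exp (- u) * \<psi> u)) \<partial>lborel)"
    proof -
      have "(\<integral>\<^sup>+u. ennreal (indicator {0..} u * (u powr (a + b - 1) * exp (- u) * \<psi> u)) \<partial>lborel)
        = (\<integral>\<^sup>+u. ennreal (indicator {0..} u * (u powr (a + b - 1) * exp (- u) *
            (Re (cinner (T (0 + u) x) z) + K))) \<partial>lborel)"
        by (intro nn_integral_cong) (auto simp: \<psi>_def indicator_def)
      then show ?thesis
        by (simp only: Re_cinner_R_nn_integral[OF add_pos_pos[OF a b] K2 order_refl] T_0)
    qed
    also have "\<dots> = (\<integral>\<^sup>+s. \<integral>\<^sup>+t. ennreal (indicator {0..} s * (s powr (a - 1) * exp (- s))) *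
      ennreal (indicator {0..} t * (t powr (b - 1) * exp (- t) * \<psi> (s + t))) \<partial>lborel \<partial>lborel)"
      by (rule gamma_kernel_convolution[OF a b _ pos, symmetric]) measurable
    also have "\<dots> = (\<integral>\<^sup>+s. ennreal (indicator {0..} s * (s powr (a - 1) * exp (- s) *
       (Gamma b * (Re (cinner (T s (R b x)) z) + K)))) \<partial>lborel)"
    proof (intro nn_integral_cong)
      fix s :: real
      show "(\<integral>\<^sup>+t. ennreal (indicator {0..} s * (s powr (a - 1) * exp (- s))) *
        ennreal (indicator {0..} t * (t powr (b - 1) * exp (- t) * \<psi> (s + t))) \<partial>lborel)
        = ennreal (indicator {0..} s * (s powr (a - 1) * exp (- s) *
       (Gamma b * (Re (cinner (T s (R b x)) z) + K))))"
      proof (cases "s \<ge> 0")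
        case True
        have "(\<integral>\<^sup>+t. ennreal (indicator {0..} t * (t powr (b - 1) * exp (- t) * \<psi> (s + t))) \<partial>lborel)
          = ennreal (Gamma b * (Re (cinner (T s (R b x)) z) + K))"
          unfolding Re_cinner_R_nn_integral[OF b K2 True, symmetric]
          using True by (intro nn_integral_cong) (auto simp: \<psi>_def indicator_def)
        then show ?thesis using True by (subst nn_integral_cmult) (auto simp: ennreal_mult'[symmetric] mult_ac)
      qed simp
    qed
    also have "\<dots> = (\<integral>\<^sup>+s. ennreal (Gamma b) * ennreal (indicator {0..} s * (s powr (a - 1) * exp (- s) *
       (Re (cinner (T (0 + s) (R b x)) z) + K))) \<partial>lborel)"
      using Gamma_real_pos[OF b] by (intro nn_integral_cong) (auto simp: indicator_def ennreal_mult'[symmetric] mult_ac)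
    also have "\<dots> = ennreal (Gamma b) * ennreal (Gamma a * (Re (cinner (R a (R b x)) z) + K))"
    proof (subst nn_integral_cmult)
      have "continuous_on UNIV (\<lambda>u. T (max 0 u) (R b x))"
        by (rule continuous_on_compose2[OF continuous_T]) (auto intro!: continuous_intros)
      then have "continuous_on UNIV (\<lambda>u. Re (cinner (T (max 0 u) (R b x)) z))"
        by (intro continuous_intros bounded_bilinear.continuous_on[OF bounded_bilinear_cinner])
      then have [measurable]: "(\<lambda>u. Re (cinner (T (max 0 u) (R b x)) z)) \<in> borel_measurable borel"
        by (rule borel_measurable_continuous_onI)
      have "(\<lambda>s. ennreal (indicator {0..} s * (s powr (a - 1) * exp (- s) *
          (Re (cinner (T (max 0 s) (R b x)) z) + K)))) \<in> borel_measurable lborel" by measurable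
      then show "(\<lambda>s. ennreal (indicator {0..} s * (s powr (a - 1) * exp (- s) *
          (Re (cinner (T (0 + s) (R b x)) z) + K)))) \<in> borel_measurable lborel"
        by (rule measurable_cong[THEN iffD1, rotated]) (auto simp: indicator_def)
    qed (simp only: Re_cinner_R_nn_integral[OF a K1 order_refl] T_0)
    finally have *: "ennreal (Beta a b) * ennreal (Gamma (a + b) * (Re (cinner (R (a + b) x) z) + K))
      = ennreal (Gamma b) * ennreal (Gamma a * (Re (cinner (R a (R b x)) z) + K))" .
    have nonneg: "Re (cinner (R c y) z) + K \<ge> 0" if "c > 0" "norm y * norm z * M \<le> K" for c y
    proof -
      have "\<bar>Re (cinner (R c y) z)\<bar> \<le> norm (R c y) * norm z"
        using abs_Re_le_cmod cmod_cinner_le order_trans by blast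
      also have "\<dots> \<le> M * norm y * norm z" by (intro mult_right_mono norm_R that) auto
      finally show ?thesis using that(2) by (simp add: mult_ac)
    qed
    note G = Gamma_real_pos[OF a] Gamma_real_pos[OF b] Gamma_real_pos[OF add_pos_pos[OF a b]]
    from * have "Beta a b * (Gamma (a + b) * (Re (cinner (R (a + b) x) z) + K))
      = Gamma b * (Gamma a * (Re (cinner (R a (R b x)) z) + K))"
      using nonneg[OF add_pos_pos[OF a b] K2] nonneg[OF a K1] G Beta_real_pos[OF a b]
      by (simp add: ennreal_mult'[symmetric] ennreal_inj)
    moreover have "Beta a b * Gamma (a + b) = Gamma a * Gamma b"
      using G by (simp add: Beta_def)
    ultimately have "Gamma a * Gamma b * (Re (cinner (R (a + b) x) z) + K)
      = Gamma a * Gamma b * (Re (cinner (R a (R b x)) z) + K)"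
      by (metis mult.assoc mult.commute)
    then show ?thesis using G by (simp add: cinner_diff_left)
  qed
  then show ?thesis using eq_zero_if_Re_cinner_zero by fastforce
qed

lemma R_commute: "a > 0 \<Longrightarrow> b > 0 \<Longrightarrow> R a (R b x) = R b (R a x)"
  by (simp add: R_R add.commute)

end

subsection \<open>The generator\<close>

lemma integral_tendsto_at_top:
  fixes f :: "real \<Rightarrow> 'b::banach"
  assumes "(f has_integral I) {0..}"
  shows "((\<lambda>N. integral {0..N} f) \<longlongrightarrow> I) at_top"
proof (rule tendstoI)
  fix e :: real assume "e > 0"
  then obtain B where B: "B > 0" "\<And>a b. ball 0 B \<subseteq> cbox a b \<Longrightarrow>
      norm (integral (cbox a b) (\<lambda>x. if x \<in> {0..} then f x else 0) - I) < e"
    using assms unfolding has_integral_alt'[of f I] by meson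
  show "\<forall>\<^sub>F N in at_top. dist (integral {0..N} f) I < e"
    using eventually_ge_at_top[of B]
  proof eventually_elim
    case (elim N)
    have "integral (cbox (- N) N) (\<lambda>x. if x \<in> {0..} then f x else 0) = integral {0..N} f"
      unfolding integral_restrict_Int using B(1) elim by (intro arg_cong2[of _ _ _ _ integral]) auto
    moreover have "ball 0 B \<subseteq> cbox (- N) N" using elim by (auto simp: dist_real_def)
    ultimately show ?case using B(2)[of "- N" N] by (simp add: dist_norm)
  qed
qed

context bounded_semigroup
begin

lemma exp_T_continuous: "continuous_on {0..t} (\<lambda>s. exp (- s) *\<^sub>R T s w)"
  by (intro continuous_intros continuous_on_subset[OF continuous_T]) auto

lemma R_1_has_integral: "((\<lambda>s. exp (- s) *\<^sub>R T s w) has_integral R 1 w) {0..}"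
  \<comment> \<open>\<open>0 powr 0\<close> is 0, so the kernel for exponent 1 differs from
    \<open>exp (- s)\<close> at s = 0.\<close>
  by (rule has_integral_spike[OF negligible_sing[of 0] _ R_has_integral[of 1 w, simplified]]) auto

text \<open>\<open>T t\<close> shifts the integral defining \<open>R 1 w\<close> to [t,
  \<infinity>), at the price of a factor \<open>exp t\<close>. The shift is made on [0, N] before N
  tends to infinity.\<close>

lemma T_R_1:
  assumes t: "t \<ge> 0"
  shows "T t (R 1 w) = exp t *\<^sub>R (R 1 w - integral {0..t} (\<lambda>s. exp (- s) *\<^sub>R T s w))"
proof (rule tendsto_unique)
  define F where "F N = integral {0..N} (\<lambda>s. exp (- s) *\<^sub>R T s w)" for N
  have F: "(F \<longlongrightarrow> R 1 w) at_top"
    unfolding F_def by (rule integral_tendsto_at_top[OF R_1_has_integral])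
  then show "((\<lambda>N. T t (F N)) \<longlongrightarrow> T t (R 1 w)) at_top"
    by (rule bounded_linear.tendsto[OF linear_T[OF t]])
  have shift: "filterlim (\<lambda>N. N + t) at_top at_top"
    using filterlim_tendsto_add_at_top[OF tendsto_const[of t] filterlim_ident] by (simp add: add.commute)
  have "((\<lambda>N. exp t *\<^sub>R (F (N + t) - F t)) \<longlongrightarrow> exp t *\<^sub>R (R 1 w - F t)) at_top"
    by (intro tendsto_intros filterlim_compose[OF F shift])
  moreover have "\<forall>\<^sub>F N in at_top. exp t *\<^sub>R (F (N + t) - F t) = T t (F N)"
    using eventually_ge_at_top[of 0]
  proof eventually_elim
    case (elim N)
    have "T t (F N) = integral {0..N} (\<lambda>s. T t (exp (- s) *\<^sub>R T s w))"
      unfolding F_def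
      using integral_linear[OF integrable_continuous_real[OF exp_T_continuous] linear_T[OF t], of N w]
      by (simp add: o_def)
    also have "\<dots> = integral {0..N} (\<lambda>s. exp t *\<^sub>R (exp (- (s + t)) *\<^sub>R T (s + t) w))"
      using t by (intro integral_cong) (auto simp: T_scaleR T_add T_commute exp_add[symmetric])
    also have "\<dots> = exp t *\<^sub>R integral {0..N} (\<lambda>s. exp (- (s + t)) *\<^sub>R T (s + t) w)"
      by (rule integral_cmul)
    also have "integral {0..N} (\<lambda>s. exp (- (s + t)) *\<^sub>R T (s + t) w)
        = integral {t..N + t} (\<lambda>s. exp (- s) *\<^sub>R T s w)"
      using integral_shift_real_ivl[of t t "N + t" "\<lambda>s. exp (- s) *\<^sub>R T s w"] by simp
    also have "\<dots> = F (N + t) - F t"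
      using Henstock_Kurzweil_Integration.integral_combine[of 0 t "N + t" "\<lambda>s. exp (- s) *\<^sub>R T s w"]
        integrable_continuous_real[OF exp_T_continuous] t elim
      by (simp add: F_def algebra_simps)
    finally show ?case by simp
  qed
  ultimately show "((\<lambda>N. T t (F N)) \<longlongrightarrow> exp t *\<^sub>R (R 1 w - F t)) at_top"
    by (rule Lim_transform_eventually)
qed simp

text \<open>In the preceding formula t occurs only in \<open>exp t\<close> and as upper limit of the
  integral of a continuous function, so the product rule applies; at t = 0 the derivative is
  one-sided.\<close>

lemma T_R_1_has_vector_derivative:
  assumes t: "t \<ge> 0"
  shows "((\<lambda>s. T s (R 1 w)) has_vector_derivative T t (R 1 w - w)) (at t within {0..})"
proof -
  let ?f = "\<lambda>s. exp (- s) *\<^sub>R T s w"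
  have "((\<lambda>u. integral {0..u} ?f) has_vector_derivative ?f t) (at t within {0..t + 1})"
    using t by (intro integral_has_vector_derivative exp_T_continuous) auto
  moreover have eq: "at t within {0..t + 1} = at t within {0..}"
    by (rule at_within_nhd[where S = "{..<t + 1}"]) auto
  ultimately have d: "((\<lambda>u. integral {0..u} ?f) has_vector_derivative ?f t) (at t within {0..})"
    by simp
  have "((\<lambda>s. exp s *\<^sub>R (R 1 w - integral {0..s} ?f)) has_vector_derivative
      exp t *\<^sub>R (0 - ?f t) + exp t *\<^sub>R (R 1 w - integral {0..t} ?f)) (at t within {0..})"
    by (rule has_vector_derivative_scaleR)
      (auto intro!: has_vector_derivative_diff d derivative_eq_intros)
  moreover have "exp t *\<^sub>R (0 - ?f t) + exp t *\<^sub>R (R 1 w - integral {0..t} ?f) = T t (R 1 w - w)"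
    unfolding T_R_1[OF t, symmetric] using t by (simp add: T_diff_right exp_minus)
  ultimately have "((\<lambda>s. exp s *\<^sub>R (R 1 w - integral {0..s} ?f)) has_vector_derivative T t (R 1 w - w)) (at t within {0..})"
    by simp
  then show ?thesis
    by (rule has_vector_derivative_transform[rotated 2]) (use t T_R_1 in auto)
qed

lemma T_R_1_quotient_tendsto:
  "((\<lambda>h. (T h (R 1 w) - R 1 w) /\<^sub>R h) \<longlongrightarrow> R 1 w - w) (at_right 0)"
proof -
  have "((\<lambda>h. (1 / norm (h - 0)) *\<^sub>R (T h (R 1 w) - (T 0 (R 1 w) + (h - 0) *\<^sub>R (R 1 w - w)))) \<longlongrightarrow> 0)
      (at 0 within {0..})"
    using T_R_1_has_vector_derivative[of 0 w]
    unfolding has_vector_derivative_def has_derivative_within by simp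
  then have "((\<lambda>h. (1 / norm (h - 0)) *\<^sub>R (T h (R 1 w) - (T 0 (R 1 w) + (h - 0) *\<^sub>R (R 1 w - w)))) \<longlongrightarrow> 0) (at_right 0)"
    by (rule tendsto_within_subset) auto
  then have "((\<lambda>h. (T h (R 1 w) - R 1 w) /\<^sub>R h - (R 1 w - w)) \<longlongrightarrow> 0) (at_right 0)"
    by (rule Lim_transform_eventually)
      (auto simp: eventually_at_filter scaleR_diff_right scaleR_add_right divide_inverse_commute intro!: always_eventually)
  then show ?thesis by (simp add: LIM_zero_iff)
qed

lemma generator_R: "generator T (R 1 w) = R 1 w - w"
  unfolding generator_def by (rule tendsto_Lim[OF _ T_R_1_quotient_tendsto]) simp

text \<open>If the difference quotients of x tend to y, then applying \<open>R 1\<close> to them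
  gives R y = R x - x for R = \<open>R 1\<close>, which exhibits x as R (x - y).\<close>

lemma generator_dom_eq: "generator_dom T = range (R 1)"
proof (intro equalityI subsetI)
  fix x assume "x \<in> generator_dom T"
  then obtain y where y: "((\<lambda>h. (T h x - x) /\<^sub>R h) \<longlongrightarrow> y) (at_right 0)"
    by (auto simp: generator_dom_def)
  have "((\<lambda>h. R 1 ((T h x - x) /\<^sub>R h)) \<longlongrightarrow> R 1 y) (at_right 0)"
    by (rule bounded_linear.tendsto[OF linear_R y]) simp
  then have "((\<lambda>h. (T h (R 1 x) - R 1 x) /\<^sub>R h) \<longlongrightarrow> R 1 y) (at_right 0)"
    by (rule Lim_transform_eventually)
      (auto simp: eventually_at_filter R_scaleR R_diff_right T_R intro!: always_eventually)
  then have "R 1 y = R 1 x - x"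
    using T_R_1_quotient_tendsto by (rule tendsto_unique[rotated]) simp
  then have "x = R 1 (x - y)" by (simp add: R_diff_right)
  then show "x \<in> range (R 1)" by blast
qed (auto simp: generator_dom_def intro: T_R_1_quotient_tendsto)

text \<open>The orbit of \<open>R 1 w = 0\<close> is constant, and its derivative at 0 is
  \<open>R 1 w - w\<close>.\<close>

lemma R_1_eq_0D: "R 1 w = 0 \<Longrightarrow> w = 0"
proof -
  assume "R 1 w = 0"
  moreover from this have "((\<lambda>h. (T h (R 1 w) - R 1 w) /\<^sub>R h) \<longlongrightarrow> 0) (at_right 0)"
    by (intro tendsto_eventually) (auto simp: eventually_at_filter T_zero intro!: always_eventually)
  ultimately show "w = 0"
    using tendsto_unique[OF _ T_R_1_quotient_tendsto[of w], of 0] by simp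
qed

text \<open>Integer powers are injective by iteration, and \<open>R \<gamma>\<close> is a factor of
  an integer power larger than \<gamma>.\<close>

lemma inj_R:
  assumes g: "\<gamma> > 0" shows "inj (R \<gamma>)"
proof -
  have pow: "w = 0" if "R (real (Suc n)) w = 0" for n w
    using that
  proof (induction n arbitrary: w)
    case (Suc n)
    then have "R (real (Suc n)) (R 1 w) = 0" by (simp add: R_R add.commute)
    then show ?case using Suc.IH R_1_eq_0D by blast
  qed (simp add: R_1_eq_0D)
  have "w = 0" if w: "R \<gamma> w = 0" for w
  proof -
    obtain n where n: "real n > \<gamma>" using reals_Archimedean2 by blast
    then have "R (real (Suc n)) w = R (real (Suc n) - \<gamma>) (R \<gamma> w)" using g by (simp add: R_R)
    also have "\<dots> = 0" using w n by (simp add: R_zero)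
    finally show ?thesis by (rule pow)
  qed
  then show ?thesis
    using linear_injective_0[OF bounded_linear.linear[OF linear_R[OF g]]] by blast
qed

lemma R_eq_0_iff: "\<gamma> > 0 \<Longrightarrow> R \<gamma> w = 0 \<longleftrightarrow> w = 0"
  using inj_R R_zero by (metis injD)

text \<open>The averages of the orbit of w over [0, h] tend to w. They lie in the range, because
  integrating the derivative of \<open>T s (R 1 w)\<close> over [0, h] can be solved for the
  integral of \<open>T s w\<close>.\<close>

lemma dense_range_R_1: "closure (range (R 1)) = UNIV"
proof -
  have "w \<in> closure (range (R 1))" for w
  proof -
    let ?I = "\<lambda>h. integral {0..h} (\<lambda>s. T s w)"
    have cont: "continuous_on {0..h} (\<lambda>s. T s v)" for h v
      by (rule continuous_on_subset[OF continuous_T]) auto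
    have "((\<lambda>h. ?I h) has_vector_derivative T 0 w) (at 0 within {0..1})"
      by (intro integral_has_vector_derivative cont) auto
    then have "((\<lambda>h. (1 / norm (h - 0)) *\<^sub>R (?I h - (?I 0 + (h - 0) *\<^sub>R T 0 w))) \<longlongrightarrow> 0) (at 0 within {0..1})"
      unfolding has_vector_derivative_def has_derivative_within by simp
    then have "((\<lambda>h. (1 / norm (h - 0)) *\<^sub>R (?I h - (?I 0 + (h - 0) *\<^sub>R T 0 w))) \<longlongrightarrow> 0) (at 0 within {0<..<1})"
      by (rule tendsto_within_subset) auto
    then have "((\<lambda>h. ?I h /\<^sub>R h - w) \<longlongrightarrow> 0) (at 0 within {0<..<1})"
      by (rule Lim_transform_eventually)
        (auto simp: eventually_at_filter scaleR_diff_right divide_inverse_commute intro!: always_eventually)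
    then have lim: "((\<lambda>h. ?I h /\<^sub>R h) \<longlongrightarrow> w) (at 0 within {0<..<1})" by (simp add: LIM_zero_iff)
    have "?I h /\<^sub>R h \<in> range (R 1)" if h: "h > 0" for h
    proof -
      have "((\<lambda>s. T s (R 1 w - w)) has_integral T h (R 1 w) - T 0 (R 1 w)) {0..h}"
        using h by (intro fundamental_theorem_of_calculus
            has_vector_derivative_within_subset[OF T_R_1_has_vector_derivative]) auto
      moreover have "((\<lambda>s. T s (R 1 w - w)) has_integral R 1 (?I h) - ?I h) {0..h}"
      proof -
        have i: "((\<lambda>s. T s w) has_integral ?I h) {0..h}"
          by (intro integrable_integral integrable_continuous_real cont)
        have "((\<lambda>s. R 1 (T s w) - T s w) has_integral R 1 (?I h) - ?I h) {0..h}"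
          using has_integral_linear[OF i linear_R[of 1]] i
          by (intro has_integral_diff) (auto simp: o_def)
        then show ?thesis by (rule has_integral_eq[rotated]) (auto simp: T_diff_right T_R)
      qed
      ultimately have "T h (R 1 w) - R 1 w = R 1 (?I h) - ?I h"
        by (simp only: T_0) (rule has_integral_unique)
      then have "?I h = R 1 (?I h - (T h w - w))"
        using h by (simp add: R_diff_right T_R)
      then have "?I h /\<^sub>R h = R 1 ((?I h - (T h w - w)) /\<^sub>R h)"
        using R_scaleR[of 1 "inverse h"] by simp
      then show ?thesis by blast
    qed
    then have "\<forall>\<^sub>F h in at 0 within {0<..<1}. ?I h /\<^sub>R h \<in> closure (range (R 1))"
      using closure_subset[of "range (R 1)"] by (auto simp: eventually_at_filter intro!: always_eventually)
    moreover have "at 0 within {0<..<1} \<noteq> (bot :: real filter)"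
      by (simp add: trivial_limit_within islimpt_greaterThanLessThan1)
    ultimately show ?thesis using Lim_in_closed_set[OF closed_closure _ _ lim] by blast
  qed
  then show ?thesis by blast
qed

end

subsection \<open>Fractional powers as binomial series\<close>

lemma gamma_kernel_times_power:
  assumes "t \<ge> (0::real)" "\<gamma> > 0"
  shows "t powr (\<gamma> - 1) * t ^ k = t powr (\<gamma> + real k - 1)"
proof (cases "t = 0")
  case True
  then show ?thesis by simp
next
  case False
  then show ?thesis using assms
    by (simp add: powr_realpow[symmetric] powr_add[symmetric] algebra_simps)
qed

text \<open>The coefficient of r ^ k in (1 - c r) powr \<delta>.\<close>

definition binomial_coeff :: "real \<Rightarrow> real \<Rightarrow> nat \<Rightarrow> real"
  where "binomial_coeff \<delta> c k = (\<delta> gchoose k) * (- c) ^ k"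

lemma binomial_coeff_zero: "binomial_coeff 0 c k = (if k = 0 then 1 else 0)"
  by (simp add: binomial_coeff_def gbinomial_0_left)

lemma binomial_coeff_convolution:
  "(\<Sum>j\<le>n. binomial_coeff a c j * binomial_coeff b c (n - j)) = binomial_coeff (a + b) c n"
proof -
  have "(\<Sum>j\<le>n. binomial_coeff a c j * binomial_coeff b c (n - j))
    = (\<Sum>j\<le>n. (a gchoose j) * (b gchoose (n - j)) * (- c) ^ n)"
  proof (rule sum.cong)
    fix j assume "j \<in> {..n}"
    then have "(- c) ^ n = (- c) ^ j * (- c) ^ (n - j)" by (simp flip: power_add)
    then show "binomial_coeff a c j * binomial_coeff b c (n - j) = (a gchoose j) * (b gchoose (n - j)) * (- c) ^ n"
      by (simp add: binomial_coeff_def mult_ac)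
  qed simp
  also have "\<dots> = binomial_coeff (a + b) c n"
    using gbinomial_Vandermonde[of a b n] unfolding sum_distrib_right[symmetric] atLeast0AtMost[symmetric]
    by (simp add: binomial_coeff_def)
  finally show ?thesis .
qed

text \<open>The coefficients are O(k powr (- 1 - \<delta>)). This covers the boundary value c = 1 of
  the binomial series, which is where the limit \<mu> -> 0 ends.\<close>

lemma summable_abs_gbinomial:
  assumes "\<delta> > (0::real)"
  shows "summable (\<lambda>k. \<bar>\<delta> gchoose k\<bar>)"
proof (rule summable_comparison_test_bigo)
  show "summable (\<lambda>n. norm (real n powr (- 1 - \<delta>)))"
    using assms by (simp add: summable_real_powr_iff)
  have "(\<lambda>n. (\<delta> gchoose n) / ((-1)^n / exp ((\<delta> + 1) * ln (real n)))) \<in> O(\<lambda>_. 1)"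
    using gbinomial_asymptotic[of \<delta>] by (intro bigoI_tendsto[where c = "inverse (Gamma (- \<delta>))"]) auto
  then obtain C where C: "\<forall>\<^sub>F n in sequentially. norm ((\<delta> gchoose n) / ((-1)^n / exp ((\<delta> + 1) * ln (real n)))) \<le> C * norm (1::real)"
    by (rule landau_o.bigE)
  show "(\<lambda>k. \<bar>\<delta> gchoose k\<bar>) \<in> O(\<lambda>n. real n powr (- 1 - \<delta>))"
  proof (rule landau_o.bigI[where c = "max C 1"])
    show "\<forall>\<^sub>F n in sequentially. norm \<bar>\<delta> gchoose n\<bar> \<le> max C 1 * norm (real n powr (- 1 - \<delta>))"
      using C eventually_gt_at_top[of 0]
    proof eventually_elim
      case (elim n)
      have p: "real n powr (- 1 - \<delta>) = inverse (exp ((\<delta> + 1) * ln (real n)))"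
        using elim(2) by (simp add: powr_def exp_minus[symmetric] algebra_simps)
      have "\<bar>\<delta> gchoose n\<bar> * exp ((\<delta> + 1) * ln (real n)) \<le> max C 1"
        using elim(1) by (simp add: abs_mult power_abs)
      then show ?case unfolding p by (simp add: field_simps)
    qed
  qed simp
qed

lemma abs_binomial_coeff_le: "0 \<le> c \<Longrightarrow> c \<le> 1 \<Longrightarrow> \<bar>binomial_coeff \<delta> c k\<bar> \<le> \<bar>\<delta> gchoose k\<bar>"
  using mult_left_mono[of "c ^ k" 1 "\<bar>\<delta> gchoose k\<bar>"]
  by (simp add: binomial_coeff_def abs_mult power_abs power_le_one)

lemma summable_abs_binomial_coeff:
  assumes "\<delta> \<ge> 0" "0 \<le> c" "c \<le> 1"
  shows "summable (\<lambda>k. \<bar>binomial_coeff \<delta> c k\<bar>)"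
proof (cases "\<delta> = 0")
  case True
  then show ?thesis by (intro summable_finite[of "{0}"]) (auto simp: binomial_coeff_zero)
next
  case False
  then show ?thesis using assms abs_binomial_coeff_le
    by (intro summable_comparison_test[OF _ summable_abs_gbinomial[of \<delta>]]) auto
qed

text \<open>The right-hand side is what termwise integration produces when
  \<open>exp (c * t)\<close> is expanded under the Gamma integral.\<close>

lemma binomial_coeff_minus:
  assumes "\<gamma> > 0"
  shows "Gamma \<gamma> * binomial_coeff (- \<gamma>) c k = c ^ k / fact k * Gamma (\<gamma> + real k)"
proof -
  have "pochhammer \<gamma> k = Gamma (\<gamma> + real k) / Gamma \<gamma>"
    using assms by (intro pochhammer_Gamma) auto
  moreover have "(- 1) ^ k * (- c) ^ k = c ^ k" by (simp flip: power_mult_distrib)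
  ultimately show ?thesis
    using Gamma_real_pos[OF assms]
    by (simp add: binomial_coeff_def gbinomial_pochhammer field_simps)
qed

text \<open>These coefficients are nonnegative, so convergence of the binomial series inside the
  unit disc is already absolute convergence.\<close>

lemma summable_abs_binomial_coeff_minus:
  assumes "\<gamma> > 0" "0 \<le> c" "c < 1"
  shows "summable (\<lambda>k. \<bar>binomial_coeff (- \<gamma>) c k\<bar>)"
proof -
  have "summable (\<lambda>k. binomial_coeff (- \<gamma>) c k)"
    using gen_binomial_real[of "- c" "- \<gamma>"] assms by (auto simp: binomial_coeff_def sums_iff)
  moreover have "binomial_coeff (- \<gamma>) c k \<ge> 0" for k
  proof -
    have "Gamma \<gamma> * binomial_coeff (- \<gamma>) c k \<ge> 0"
      unfolding binomial_coeff_minus[OF assms(1)]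
      using assms Gamma_real_pos[of "\<gamma> + real k"] by (intro mult_nonneg_nonneg) auto
    then show ?thesis using Gamma_real_pos[OF assms(1)] by (simp add: zero_le_mult_iff)
  qed
  ultimately show ?thesis by simp
qed

section \<open>Absolutely convergent power series in \<open>R 1\<close>\<close>

context bounded_semigroup
begin

text \<open>As \<open>Gamma 0\<close> is 0, the map \<open>R 0\<close> is zero and not the identity;
  hence the iterates \<open>R 1 ^^ k\<close> are used wherever k = 0 can occur.\<close>

lemma R_1_funpow: "k > 0 \<Longrightarrow> (R 1 ^^ k) x = R (real k) x"
proof (induction k)
  case (Suc k)
  then show ?case by (cases "k = 0") (auto simp: R_R add.commute)
qed simp

lemma linear_R_1_funpow: "bounded_linear (R 1 ^^ k)"
proof (cases "k = 0")
  case False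
  then have "R 1 ^^ k = R (real k)" using R_1_funpow by auto
  then show ?thesis using False linear_R by simp
qed (simp add: id_def bounded_linear_ident)

lemma norm_R_1_funpow: "norm ((R 1 ^^ k) x) \<le> M * norm x"
proof (cases "k = 0")
  case True
  then show ?thesis using mult_right_mono[OF M_ge_1, of "norm x"] by simp
qed (simp add: R_1_funpow norm_R)

lemma R_R_1_funpow: "\<gamma> > 0 \<Longrightarrow> R \<gamma> ((R 1 ^^ k) x) = R (\<gamma> + real k) x"
  by (cases "k = 0") (auto simp: R_1_funpow R_R)

text \<open>A functional calculus: absolutely summable sequences form a Banach algebra under
  convolution, and power boundedness of \<open>R 1\<close> lets this algebra act on the
  space.\<close>

definition R_series :: "(nat \<Rightarrow> real) \<Rightarrow> 'a \<Rightarrow> 'a"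
  where "R_series a x = (\<Sum>k. a k *\<^sub>R (R 1 ^^ k) x)"

lemma norm_R_series_term: "norm (a k *\<^sub>R (R 1 ^^ k) x) \<le> \<bar>a k\<bar> * (M * norm x)"
  by (simp add: mult_left_mono norm_R_1_funpow)

lemma summable_norm_R_series:
  assumes "summable (\<lambda>k. \<bar>a k\<bar>)"
  shows "summable (\<lambda>k. norm (a k *\<^sub>R (R 1 ^^ k) x))"
  by (rule summable_comparison_test[OF _ summable_mult2[OF assms, of "M * norm x"]])
    (use norm_R_series_term in auto)

lemma R_series_sums:
  "summable (\<lambda>k. \<bar>a k\<bar>) \<Longrightarrow> (\<lambda>k. a k *\<^sub>R (R 1 ^^ k) x) sums R_series a x"
  unfolding R_series_def by (intro summable_sums summable_norm_cancel[OF summable_norm_R_series])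

lemma norm_R_series:
  assumes "summable (\<lambda>k. \<bar>a k\<bar>)"
  shows "norm (R_series a x) \<le> (\<Sum>k. \<bar>a k\<bar>) * (M * norm x)"
proof -
  have "norm (R_series a x) \<le> (\<Sum>k. norm (a k *\<^sub>R (R 1 ^^ k) x))"
    unfolding R_series_def by (rule summable_norm[OF summable_norm_R_series[OF assms]])
  also have "\<dots> \<le> (\<Sum>k. \<bar>a k\<bar> * (M * norm x))"
    using norm_R_series_term by (intro suminf_le summable_norm_R_series summable_mult2 assms) auto
  also have "\<dots> = (\<Sum>k. \<bar>a k\<bar>) * (M * norm x)" by (rule suminf_mult2[OF assms, symmetric])
  finally show ?thesis .
qed

lemma linear_R_series:
  assumes "summable (\<lambda>k. \<bar>a k\<bar>)"
  shows "bounded_linear (R_series a)"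
proof (rule bounded_linear_intro[where K = "(\<Sum>k. \<bar>a k\<bar>) * M"])
  note lin = linear_R_1_funpow[THEN bounded_linear.linear]
  show "R_series a (x + y) = R_series a x + R_series a y" for x y
  proof (rule sums_unique2[OF R_series_sums[OF assms]])
    show "(\<lambda>k. a k *\<^sub>R (R 1 ^^ k) (x + y)) sums (R_series a x + R_series a y)"
      using sums_add[OF R_series_sums[OF assms, of x] R_series_sums[OF assms, of y]]
      by (simp add: linear_add[OF lin] scaleR_add_right)
  qed
  show "R_series a (r *\<^sub>R x) = r *\<^sub>R R_series a x" for r x
  proof (rule sums_unique2[OF R_series_sums[OF assms]])
    show "(\<lambda>k. a k *\<^sub>R (R 1 ^^ k) (r *\<^sub>R x)) sums (r *\<^sub>R R_series a x)"
      using bounded_linear.sums[OF bounded_linear_scaleR_right R_series_sums[OF assms, of x], of r]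
      by (simp add: linear_scale[OF lin] mult.commute)
  qed
  show "norm (R_series a x) \<le> norm x * ((\<Sum>k. \<bar>a k\<bar>) * M)" for x
    using norm_R_series[OF assms, of x] by (simp add: mult_ac)
qed

lemma R_series_diff:
  assumes "summable (\<lambda>k. \<bar>a k\<bar>)" "summable (\<lambda>k. \<bar>b k\<bar>)"
  shows "R_series a x - R_series b x = R_series (\<lambda>k. a k - b k) x"
  using sums_diff[OF R_series_sums[OF assms(1), of x] R_series_sums[OF assms(2), of x]]
  by (simp add: R_series_def sums_iff scaleR_diff_left)

lemma R_R_series:
  assumes "summable (\<lambda>k. \<bar>a k\<bar>)" "\<gamma> > 0"
  shows "(\<lambda>k. a k *\<^sub>R R (\<gamma> + real k) x) sums R \<gamma> (R_series a x)"
  using bounded_linear.sums[OF linear_R[OF assms(2)] R_series_sums[OF assms(1), of x]]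
  by (simp add: R_scaleR R_R_1_funpow assms(2))

lemma R_series_commute_R:
  assumes "summable (\<lambda>k. \<bar>a k\<bar>)" "\<gamma> > 0"
  shows "R_series a (R \<gamma> x) = R \<gamma> (R_series a x)"
proof -
  have "(R 1 ^^ k) (R \<gamma> x) = R (\<gamma> + real k) x" for k
    using assms(2) by (cases "k = 0") (auto simp: R_1_funpow R_R add.commute)
  then show ?thesis
    using sums_unique2[OF R_series_sums[OF assms(1), of "R \<gamma> x"], of "R \<gamma> (R_series a x)"]
      R_R_series[OF assms, of x] by simp
qed

lemma R_series_commute_funpow:
  assumes "summable (\<lambda>k. \<bar>a k\<bar>)"
  shows "R_series a ((R 1 ^^ j) x) = (R 1 ^^ j) (R_series a x)"
  using R_series_commute_R[OF assms] by (cases "j = 0") (auto simp: R_1_funpow)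

text \<open>The double family is dominated by the product of the two absolute series, so it may be
  summed by rows, giving the composition, or by antidiagonals, giving the convolution.\<close>

lemma R_series_compose:
  assumes a: "summable (\<lambda>k. \<bar>a k\<bar>)" and b: "summable (\<lambda>k. \<bar>b k\<bar>)"
  shows "R_series a (R_series b x) = R_series (\<lambda>n. \<Sum>j\<le>n. a j * b (n - j)) x"
proof -
  define f where "f = (\<lambda>(j, k). (a j * b k) *\<^sub>R (R 1 ^^ (j + k)) x)"
  have "(\<lambda>p. norm (f p)) summable_on (UNIV \<times> UNIV)"
  proof (rule Infinite_Sum.abs_summable_on_comparison_test')
    have "((\<lambda>k. \<bar>b k\<bar>) has_sum (\<Sum>k. \<bar>b k\<bar>)) UNIV"
      using b by (intro norm_summable_imp_has_sum) (auto intro: summable_sums)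
    then have "((\<lambda>k. (case (j, k) of (j, k) \<Rightarrow> \<bar>a j\<bar> * \<bar>b k\<bar> * (M * norm x))) has_sum \<bar>a j\<bar> * (\<Sum>k. \<bar>b k\<bar>) * (M * norm x)) UNIV" for j
      unfolding prod.case by (intro has_sum_cmult_left has_sum_cmult_right)
    then show "(\<lambda>(j, k). \<bar>a j\<bar> * \<bar>b k\<bar> * (M * norm x)) summable_on (UNIV \<times> UNIV)"
      by (rule summable_on_SigmaI)
        (use a M_pos in \<open>auto intro!: summable_on_cmult_left[OF summable_on_cmult_left[OF norm_summable_imp_summable_on]]\<close>)
    show "norm (f p) \<le> (case p of (j, k) \<Rightarrow> \<bar>a j\<bar> * \<bar>b k\<bar> * (M * norm x))" for p
      using norm_R_series_term[of "\<lambda>_. a (fst p) * b (snd p)" "fst p + snd p" x]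
      by (simp add: f_def case_prod_unfold abs_mult)
  qed
  then have "f summable_on (UNIV \<times> UNIV)" by (rule abs_summable_summable)
  then obtain s where s: "(f has_sum s) (UNIV \<times> UNIV)" by (auto simp: summable_on_def)
  have row: "((\<lambda>k. f (j, k)) has_sum a j *\<^sub>R (R 1 ^^ j) (R_series b x)) UNIV" for j
  proof -
    have "((\<lambda>k. b k *\<^sub>R (R 1 ^^ k) x) has_sum R_series b x) UNIV"
      by (rule norm_summable_imp_has_sum[OF summable_norm_R_series[OF b] R_series_sums[OF b]])
    from has_sum_bounded_linear[OF bounded_linear_scaleR_right
        has_sum_bounded_linear[OF linear_R_1_funpow this, of j], of "a j"]
    show ?thesis
      by (simp add: f_def o_def linear_scale[OF bounded_linear.linear[OF linear_R_1_funpow]] funpow_add)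
  qed
  from has_sum_SigmaD[OF s row] have "(\<lambda>j. a j *\<^sub>R (R 1 ^^ j) (R_series b x)) sums s"
    by (rule has_sum_imp_sums)
  then have 1: "R_series a (R_series b x) = s"
    using R_series_sums[OF a] sums_unique2 by blast
  \<comment> \<open>The pair (j, k) is renamed to (n, j) with n = j + k, so that each n collects
    finitely many terms.\<close>
  have "((\<lambda>(n, j). f (j, n - j)) has_sum s) (SIGMA n:UNIV. {..n})"
    using s by (subst has_sum_reindex_bij_witness[where T = "UNIV \<times> UNIV" and h = f and s' = s
        and j = "\<lambda>(n, j). (j, n - j)" and i = "\<lambda>(j, k). (j + k, j)"]) auto
  moreover have "((\<lambda>j. case (n, j) of (n, j) \<Rightarrow> f (j, n - j)) has_sum
      (\<Sum>j\<le>n. a j * b (n - j)) *\<^sub>R (R 1 ^^ n) x) {..n}" for n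
    by (rule has_sum_finiteI) (auto simp: f_def scaleR_sum_left)
  ultimately have "(\<lambda>n. (\<Sum>j\<le>n. a j * b (n - j)) *\<^sub>R (R 1 ^^ n) x) sums s"
    by (intro has_sum_imp_sums) (rule has_sum_SigmaD)
  then show ?thesis unfolding 1 by (simp add: R_series_def sums_iff)
qed

lemma R_series_zero: "R_series (binomial_coeff 0 c) x = x"
proof -
  have "(\<lambda>k. binomial_coeff 0 c k *\<^sub>R (R 1 ^^ k) x) sums (\<Sum>k\<in>{0}. binomial_coeff 0 c k *\<^sub>R (R 1 ^^ k) x)"
    by (rule sums_finite) (auto simp: binomial_coeff_zero)
  then show ?thesis by (simp add: R_series_def sums_iff binomial_coeff_zero)
qed

abbreviation frac_mult :: "real \<Rightarrow> real \<Rightarrow> 'a \<Rightarrow> 'a"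
  where "frac_mult c \<delta> \<equiv> R_series (binomial_coeff \<delta> c)"

lemma frac_mult_frac_mult:
  assumes "summable (\<lambda>k. \<bar>binomial_coeff a c k\<bar>)" "summable (\<lambda>k. \<bar>binomial_coeff b c k\<bar>)"
  shows "frac_mult c a (frac_mult c b x) = frac_mult c (a + b) x"
  unfolding R_series_compose[OF assms] binomial_coeff_convolution ..

lemma frac_mult_one: "frac_mult 1 1 x = x - R 1 x"
proof -
  have "(\<lambda>k. binomial_coeff 1 1 k *\<^sub>R (R 1 ^^ k) x) sums (\<Sum>k\<in>{0,1}. binomial_coeff 1 1 k *\<^sub>R (R 1 ^^ k) x)"
  proof (rule sums_finite)
    fix k :: nat assume "k \<notin> {0, 1}"
    then have "Suc 0 choose k = 0" by (intro binomial_eq_0) auto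
    then have "(1::real) gchoose k = 0"
      using binomial_gbinomial[of 1 k, where ?'a = real] by (metis One_nat_def of_nat_0 of_nat_1)
    then show "binomial_coeff 1 1 k *\<^sub>R (R 1 ^^ k) x = 0" by (simp add: binomial_coeff_def)
  qed simp
  then show ?thesis by (simp add: R_series_def sums_iff binomial_coeff_def)
qed

text \<open>With \<open>r = (1 + z)\<^sup>-\<^sup>1\<close>, this is \<open>(\<mu> + z) powr (- \<gamma>) = r powr \<gamma> * (1 - (1 - \<mu>) * r) powr (- \<gamma>)\<close>.\<close>

lemma neg_power_eq_R:
  assumes \<gamma>: "\<gamma> > 0" and \<mu>: "0 < \<mu>" "\<mu> \<le> 1"
  shows "neg_power T \<mu> \<gamma> x = R \<gamma> (frac_mult (1 - \<mu>) (- \<gamma>) x)"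
proof -
  define c where "c = 1 - \<mu>"
  have c: "0 \<le> c" "c < 1" using \<mu> by (auto simp: c_def)
  \<comment> \<open>Since exp (- \<mu> t) = exp (- t) exp (c t), the kernel is approximated by
    replacing exp (c t) by its partial sum \<open>?e N\<close>; the k-th term turns the kernel for
    \<gamma> into the one for \<gamma> + k. \<open>?h N\<close> is the scalar error.\<close>
  let ?e = "\<lambda>N t. \<Sum>k<N. (c * t) ^ k / fact k"
  let ?h = "\<lambda>N t. t powr (\<gamma> - 1) * exp (- t) * (exp (c * t) - ?e N t)"
  let ?g = "\<lambda>t. t powr (\<gamma> - 1) * exp (- \<mu> * t)"
  note G = Gamma_real_pos[OF \<gamma>]
  have e_le: "?e N t \<le> exp (c * t)" "?e N t \<ge> 0" if "t \<ge> 0" for N t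
    using that c sum_le_suminf[of "\<lambda>k. (c * t) ^ k / fact k" "{..<N}"] summable_exp[of "c * t"]
    by (auto simp: exp_def divide_inverse_commute intro!: sum_nonneg)
  have e_sums: "(\<lambda>N. ?e N t) \<longlonglongrightarrow> exp (c * t)" for t
    using exp_converges[of "c * t"] by (simp add: sums_def divide_inverse_commute)
  have g_eq: "?g t = t powr (\<gamma> - 1) * exp (- t) * exp (c * t)" for t
    by (simp add: c_def exp_add[symmetric] algebra_simps)
  have term_eq: "t powr (\<gamma> - 1) * exp (- t) * ((c * t) ^ k / fact k)
      = c ^ k / fact k * (t powr (\<gamma> + real k - 1) * exp (- t))" if "t \<ge> 0" for t k
    using gamma_kernel_times_power[OF that \<gamma>, of k] by (simp add: power_mult_distrib field_simps)
  have h_int: "?h N integrable_on {0..}" for N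
  proof -
    have "(\<lambda>t. ?g t - (\<Sum>k<N. c ^ k / fact k * (t powr (\<gamma> + real k - 1) * exp (- t)))) integrable_on {0..}"
      using \<gamma> \<mu> gamma_kernel_has_integral
      by (intro integrable_diff integrable_sum integrable_on_mult_right gamma_kernel_integrable)
        (auto intro!: has_integral_integrable[OF gamma_kernel_has_integral])
    then show ?thesis
    proof (rule integrable_eq)
      fix t :: real assume "t \<in> {0..}"
      then have "(\<Sum>k<N. c ^ k / fact k * (t powr (\<gamma> + real k - 1) * exp (- t)))
          = t powr (\<gamma> - 1) * exp (- t) * ?e N t"
        unfolding sum_distrib_left by (intro sum.cong) (simp_all only: term_eq atLeast_iff)
      then show "?g t - (\<Sum>k<N. c ^ k / fact k * (t powr (\<gamma> + real k - 1) * exp (- t))) = ?h N t"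
        unfolding g_eq by (simp only: right_diff_distrib)
    qed
  qed
  \<comment> \<open>The partial sums lie between 0 and exp (c t), as c \<ge> 0 by \<mu> \<le> 1. So
    the full kernel \<open>?g\<close> dominates every error.\<close>
  have "(\<lambda>N. integral {0..} (?h N)) \<longlonglongrightarrow> integral {0..} (\<lambda>t::real. 0::real)"
  proof (rule dominated_convergence(2)[where f = ?h and h = ?g])
    show "?h N integrable_on {0..}" for N by (rule h_int)
    show "?g integrable_on {0..}" by (rule gamma_kernel_integrable[OF \<mu>(1) \<gamma>])
    show "norm (?h N t) \<le> ?g t" if "t \<in> {0..}" for N t
      unfolding g_eq using e_le[of t N] that by (simp add: abs_mult mult_left_mono)
    show "(\<lambda>N. ?h N t) \<longlonglongrightarrow> 0" for t
      using tendsto_mult_left[OF tendsto_diff[OF tendsto_const e_sums[of t]], of "t powr (\<gamma> - 1) * exp (- t)" "exp (c * t)"]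
      by simp
  qed
  then have h_lim: "(\<lambda>N. integral {0..} (?h N)) \<longlonglongrightarrow> 0" by simp
  define y where "y N = (\<Sum>k<N. (binomial_coeff (- \<gamma>) c k) *\<^sub>R R (\<gamma> + real k) x)" for N
  have y_int: "((\<lambda>t. (t powr (\<gamma> - 1) * exp (- t) * ?e N t) *\<^sub>R T t x) has_integral Gamma \<gamma> *\<^sub>R y N) {0..}" for N
  proof -
    have "((\<lambda>t. \<Sum>k<N. (c ^ k / fact k) *\<^sub>R (t powr (\<gamma> + real k - 1) * exp (- t)) *\<^sub>R T t x)
        has_integral (\<Sum>k<N. (c ^ k / fact k) *\<^sub>R Gamma (\<gamma> + real k) *\<^sub>R R (\<gamma> + real k) x)) {0..}"
      using \<gamma> by (intro has_integral_sum has_integral_cmul R_has_integral) auto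
    moreover have "(\<Sum>k<N. (c ^ k / fact k) *\<^sub>R Gamma (\<gamma> + real k) *\<^sub>R R (\<gamma> + real k) x) = Gamma \<gamma> *\<^sub>R y N"
      by (simp add: y_def scaleR_sum_right binomial_coeff_minus[OF \<gamma>])
    ultimately have "((\<lambda>t. \<Sum>k<N. (c ^ k / fact k) *\<^sub>R (t powr (\<gamma> + real k - 1) * exp (- t)) *\<^sub>R T t x)
        has_integral Gamma \<gamma> *\<^sub>R y N) {0..}" by (simp only:)
    then show ?thesis
    proof (rule has_integral_eq[rotated])
      fix t :: real assume "t \<in> {0..}"
      then show "(\<Sum>k<N. (c ^ k / fact k) *\<^sub>R (t powr (\<gamma> + real k - 1) * exp (- t)) *\<^sub>R T t x)
          = (t powr (\<gamma> - 1) * exp (- t) * ?e N t) *\<^sub>R T t x"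
        unfolding sum_distrib_left scaleR_sum_left
        by (intro sum.cong) (simp_all only: term_eq atLeast_iff scaleR_scaleR)
    qed
  qed
  have "norm (Gamma \<gamma> *\<^sub>R (neg_power T \<mu> \<gamma> x - y N)) \<le> integral {0..} (?h N) * (M * norm x)" for N
  proof -
    have "((\<lambda>t. ?g t *\<^sub>R T t x) has_integral Gamma \<gamma> *\<^sub>R neg_power T \<mu> \<gamma> x) {0..}"
      using integrable_integral[OF kernel_integrable[OF \<mu>(1) \<gamma>, of x]] G
      by (simp add: neg_power_def)
    from has_integral_diff[OF this y_int[of N]]
    have 1: "((\<lambda>t. ?h N t *\<^sub>R T t x) has_integral Gamma \<gamma> *\<^sub>R (neg_power T \<mu> \<gamma> x - y N)) {0..}"
      unfolding g_eq by (simp add: scaleR_diff_left[symmetric] right_diff_distrib scaleR_diff_right)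
    have "norm (integral {0..} (\<lambda>t. ?h N t *\<^sub>R T t x)) \<le> integral {0..} (\<lambda>t. ?h N t * (M * norm x))"
      using has_integral_integrable[OF 1] integrable_on_mult_left[OF h_int[of N], of "M * norm x"]
    proof (rule integral_norm_bound_integral)
      fix t :: real assume "t \<in> {0..}"
      then have "norm (T t x) \<le> M * norm x" "?h N t \<ge> 0" using e_le norm_T by auto
      then show "norm (?h N t *\<^sub>R T t x) \<le> ?h N t * (M * norm x)"
        by (simp only: norm_scaleR abs_of_nonneg mult_left_mono)
    qed
    then show ?thesis by (simp only: integral_unique[OF 1] integral_mult_left)
  qed
  moreover have "(\<lambda>N. integral {0..} (?h N) * (M * norm x)) \<longlonglongrightarrow> 0"
    using tendsto_mult_right[OF h_lim, of "M * norm x"] by simp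
  ultimately have "(\<lambda>N. Gamma \<gamma> *\<^sub>R (neg_power T \<mu> \<gamma> x - y N)) \<longlonglongrightarrow> 0"
    by (rule Lim_null_comparison[OF always_eventually[OF allI]])
  from tendsto_scaleR[OF tendsto_const[of "inverse (Gamma \<gamma>)"] this]
  have "(\<lambda>N. neg_power T \<mu> \<gamma> x - y N) \<longlonglongrightarrow> 0" using G by simp
  moreover have "y \<longlonglongrightarrow> R \<gamma> (frac_mult c (- \<gamma>) x)"
    using R_R_series[OF summable_abs_binomial_coeff_minus[OF \<gamma> c] \<gamma>, of x]
    unfolding y_def sums_def .
  ultimately have "(\<lambda>N. neg_power T \<mu> \<gamma> x - y N + y N) \<longlonglongrightarrow> 0 + R \<gamma> (frac_mult c (- \<gamma>) x)"
    by (rule tendsto_add)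
  then show ?thesis unfolding c_def by (simp add: LIMSEQ_const_iff)
qed

section \<open>The limit \<mu> -> 0 and the graph norm\<close>

context
  fixes \<gamma> :: real
  assumes \<gamma>: "\<gamma> > 0"
begin

text \<open>The exponents add to 0, and c < 1 makes the series with exponent - \<gamma> absolutely
  convergent.\<close>

lemma frac_mult_inverse:
  assumes "0 \<le> c" "c < 1"
  shows "frac_mult c \<gamma> (frac_mult c (- \<gamma>) x) = x" "frac_mult c (- \<gamma>) (frac_mult c \<gamma> x) = x"
  using assms \<gamma> by (simp_all add: frac_mult_frac_mult summable_abs_binomial_coeff
      summable_abs_binomial_coeff_minus R_series_zero)

lemma range_neg_power:
  assumes "0 < \<mu>" "\<mu> \<le> 1"
  shows "range (neg_power T \<mu> \<gamma>) = range (R \<gamma>)"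
proof -
  have "R \<gamma> w = neg_power T \<mu> \<gamma> (frac_mult (1 - \<mu>) \<gamma> w)" for w
    using assms by (simp add: neg_power_eq_R[OF \<gamma> assms] frac_mult_inverse)
  then show ?thesis using neg_power_eq_R[OF \<gamma> assms] by auto
qed

lemma inv_neg_power_R:
  assumes \<mu>: "0 < \<mu>" "\<mu> \<le> 1"
  shows "inv (neg_power T \<mu> \<gamma>) (R \<gamma> w) = frac_mult (1 - \<mu>) \<gamma> w"
proof (rule inv_f_eq)
  show "inj (neg_power T \<mu> \<gamma>)"
  proof (rule injI)
    fix x y assume "neg_power T \<mu> \<gamma> x = neg_power T \<mu> \<gamma> y"
    then have "frac_mult (1 - \<mu>) (- \<gamma>) x = frac_mult (1 - \<mu>) (- \<gamma>) y"
      using inj_R[OF \<gamma>] by (auto simp: neg_power_eq_R[OF \<gamma> \<mu>] dest: injD)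
    then show "x = y" using frac_mult_inverse(1)[of "1 - \<mu>"] \<mu> by (metis diff_ge_0_iff_ge diff_less_eq less_add_same_cancel1 less_add_same_cancel2)
  qed
  show "neg_power T \<mu> \<gamma> (frac_mult (1 - \<mu>) \<gamma> w) = R \<gamma> w"
    using \<mu> by (simp add: neg_power_eq_R[OF \<gamma> \<mu>] frac_mult_inverse)
qed

text \<open>The k-th coefficients differ by the factor 1 - (1 - \<mu>) ^ k, which lies in [0, 1], so
  \<open>\<bar>\<gamma> gchoose k\<bar>\<close> is a summable majorant for Tannery's
  theorem.\<close>

lemma frac_mult_tendsto: "((\<lambda>\<mu>. frac_mult (1 - \<mu>) \<gamma> w) \<longlongrightarrow> frac_mult 1 \<gamma> w) (at_right 0)"
proof -
  have ev: "\<forall>\<^sub>F \<mu>::real in at_right 0. 0 < \<mu> \<and> \<mu> \<le> 1"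
    unfolding eventually_at_right_field by (rule exI[of _ 1]) auto
  define d where "d k \<mu> = \<bar>binomial_coeff \<gamma> (1 - \<mu>) k - binomial_coeff \<gamma> 1 k\<bar>" for k and \<mu> :: real
  have d_le: "norm (d k \<mu>) \<le> \<bar>\<gamma> gchoose k\<bar>" if "0 < \<mu> \<and> \<mu> \<le> 1" for k \<mu>
  proof -
    have "(1 - \<mu>) ^ k \<le> 1" "0 \<le> (1 - \<mu>) ^ k" using that by (auto intro!: power_le_one)
    moreover have "d k \<mu> = \<bar>\<gamma> gchoose k\<bar> * \<bar>(1 - \<mu>) ^ k - 1\<bar>"
    proof -
      have "d k \<mu> = \<bar>(\<gamma> gchoose k) * ((- 1) ^ k * ((1 - \<mu>) ^ k - 1))\<bar>"
        unfolding d_def binomial_coeff_def power_minus[of "1 - \<mu>" k] by (simp add: right_diff_distrib)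
      then show ?thesis by (simp add: abs_mult power_abs)
    qed
    ultimately show ?thesis by (simp add: mult_left_le)
  qed
  have "eventually (\<lambda>n. summable (\<lambda>k. norm (d k n))) (at_right 0) \<and> summable (\<lambda>n::nat. norm (0::real)) \<and>
      ((\<lambda>n. suminf (\<lambda>k. d k n)) \<longlongrightarrow> suminf (\<lambda>k. 0)) (at_right 0)"
  proof (rule tannerys_theorem[OF _ _ summable_abs_gbinomial[OF \<gamma>]])
    show "((\<lambda>n. d k n) \<longlongrightarrow> 0) (at_right 0)" for k
    proof -
      have "((\<lambda>n. d k n) \<longlongrightarrow> d k 0) (at_right 0)"
        unfolding d_def binomial_coeff_def by (intro tendsto_intros)
      then show ?thesis by (simp add: d_def)
    qed
    show "\<forall>\<^sub>F (k, n) in at_top \<times>\<^sub>F at_right 0. norm (d k n) \<le> \<bar>\<gamma> gchoose k\<bar>"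
      by (rule eventually_mono[OF eventually_prodI[OF always_eventually ev]]) (use d_le in auto)
  qed simp
  then have lim: "((\<lambda>\<mu>. (\<Sum>k. d k \<mu>) * (M * norm w)) \<longlongrightarrow> 0) (at_right 0)"
    using tendsto_mult_right[of "\<lambda>\<mu>. (\<Sum>k. d k \<mu>)" 0 "at_right 0" "M * norm w"] by simp
  have "\<forall>\<^sub>F \<mu> in at_right 0. norm (frac_mult (1 - \<mu>) \<gamma> w - frac_mult 1 \<gamma> w) \<le> (\<Sum>k. d k \<mu>) * (M * norm w)"
    using ev
  proof eventually_elim
    case (elim \<mu>)
    have s: "summable (\<lambda>k. \<bar>binomial_coeff \<gamma> (1 - \<mu>) k\<bar>)" "summable (\<lambda>k. \<bar>binomial_coeff \<gamma> 1 k\<bar>)"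
      using elim \<gamma> by (auto intro!: summable_abs_binomial_coeff)
    have "summable (\<lambda>k. d k \<mu>)"
      using d_le[OF elim] by (intro summable_comparison_test[OF _ summable_abs_gbinomial[OF \<gamma>]]) auto
    then show ?case
      unfolding R_series_diff[OF s] d_def by (rule norm_R_series)
  qed
  then show ?thesis by (rule LIM_zero_cancel[OF Lim_null_comparison[OF _ lim]])
qed

text \<open>For 0 < \<mu> \<le> 1 all the ranges coincide with \<open>range (R \<gamma>)\<close>,
  and at \<open>R \<gamma> w\<close> the inverses are
  \<open>frac_mult (1 - \<mu>) \<gamma> w\<close>, which converge for every w.\<close>

lemma frac_power_R: "frac_power T \<gamma> (R \<gamma> w) = frac_mult 1 \<gamma> w"
  and frac_power_dom_eq: "frac_power_dom T \<gamma> = range (R \<gamma>)"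
proof -
  have ev: "\<forall>\<^sub>F \<mu>::real in at_right 0. 0 < \<mu> \<and> \<mu> \<le> 1"
    unfolding eventually_at_right_field by (rule exI[of _ 1]) auto
  have lim: "((\<lambda>\<mu>. inv (neg_power T \<mu> \<gamma>) (R \<gamma> w)) \<longlongrightarrow> frac_mult 1 \<gamma> w) (at_right 0)" for w
    by (rule Lim_transform_eventually[OF frac_mult_tendsto])
      (use ev in eventually_elim, simp add: inv_neg_power_R)
  then show "frac_power T \<gamma> (R \<gamma> w) = frac_mult 1 \<gamma> w"
    unfolding frac_power_def by (intro tendsto_Lim) auto
  show "frac_power_dom T \<gamma> = range (R \<gamma>)"
  proof (intro equalityI subsetI)
    fix x assume "x \<in> frac_power_dom T \<gamma>"
    then have "\<forall>\<^sub>F \<mu> in at_right 0. x \<in> range (neg_power T \<mu> \<gamma>)" by (simp add: frac_power_dom_def)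
    from eventually_happens'[OF trivial_limit_at_right_real eventually_conj[OF this ev]]
    obtain \<mu> where "x \<in> range (neg_power T \<mu> \<gamma>)" "0 < \<mu>" "\<mu> \<le> 1" by auto
    then show "x \<in> range (R \<gamma>)" using range_neg_power[of \<mu>] by simp
  next
    fix x assume "x \<in> range (R \<gamma>)"
    then obtain w where x: "x = R \<gamma> w" by blast
    have "\<forall>\<^sub>F \<mu> in at_right 0. x \<in> range (neg_power T \<mu> \<gamma>)"
      using ev
    proof eventually_elim
      case (elim \<mu>)
      then show ?case unfolding x using range_neg_power[of \<mu>] by simp
    qed
    then show "x \<in> frac_power_dom T \<gamma>"
      unfolding frac_power_dom_def mem_Collect_eq using lim[of w, folded x] by blast
  qed
qed

lemma graph_norm_R_le: "\<exists>C\<ge>0. \<forall>w. graph_norm T \<gamma> (R \<gamma> w) \<le> C * norm w"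
proof -
  have s: "summable (\<lambda>k. \<bar>binomial_coeff \<gamma> 1 k\<bar>)" using \<gamma> by (simp add: summable_abs_binomial_coeff)
  have "graph_norm T \<gamma> (R \<gamma> w) \<le> (M + (\<Sum>k. \<bar>binomial_coeff \<gamma> 1 k\<bar>) * M) * norm w" for w
    unfolding graph_norm_def frac_power_R
    using norm_R[OF \<gamma>, of w] norm_R_series[OF s, of w] by (simp add: algebra_simps)
  then show ?thesis using M_pos s
    by (intro exI[of _ "M + (\<Sum>k. \<bar>binomial_coeff \<gamma> 1 k\<bar>) * M"])
      (auto intro!: add_nonneg_nonneg mult_nonneg_nonneg suminf_nonneg)
qed

text \<open>
  With \<open>m > \<gamma>\<close> and \<open>q = 1 - r\<close>, expanding \<open>1 = (r + q) ^ (2 * m)\<close> leaves only terms that are multiples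
  of \<open>r ^ m\<close> or of \<open>q ^ m\<close>.
\<close>

lemma norm_le_graph_norm_R: "\<exists>C\<ge>0. \<forall>w. norm w \<le> C * graph_norm T \<gamma> (R \<gamma> w)"
proof -
  obtain m :: nat where m: "real m > \<gamma>" using reals_Archimedean2 by blast
  let ?Q = "\<lambda>i. frac_mult 1 (real i)"
  let ?N = "\<lambda>w. norm ((R 1 ^^ m) w) + norm (?Q m w)"
  have s: "summable (\<lambda>k. \<bar>binomial_coeff \<delta> 1 k\<bar>)" if "\<delta> \<ge> 0" for \<delta>
    using that by (simp add: summable_abs_binomial_coeff)
  have QQ: "frac_mult 1 a (frac_mult 1 b w) = frac_mult 1 (a + b) w" if "a \<ge> 0" "b \<ge> 0" for a b w
    using that by (simp add: frac_mult_frac_mult s)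
  have Q_bound: "\<exists>K\<ge>0. \<forall>w. norm (frac_mult 1 \<delta> w) \<le> K * norm w" if "\<delta> \<ge> 0" for \<delta>
    using norm_R_series[OF s[OF that]] M_pos suminf_nonneg[OF s[OF that]]
    by (intro exI[of _ "(\<Sum>k. \<bar>binomial_coeff \<delta> 1 k\<bar>) * M"]) (auto simp: mult_ac)
  \<comment> \<open>Induction on the missing degree n = 2 m - i - j, through q ^ i r ^ j = q ^ (i +
    1) r ^ j + q ^ i r ^ (j + 1). At n = 0 one of i, j is at least m.\<close>
  have main: "\<exists>K\<ge>0. \<forall>w. norm (?Q i ((R 1 ^^ j) w)) \<le> K * ?N w" if "i + j + n = 2 * m" for i j n
    using that
  proof (induction n arbitrary: i j)
    case 0
    show ?case
    proof (cases "i \<ge> m")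
      case True
      obtain K where K: "K \<ge> 0" "\<And>w. norm (frac_mult 1 (real (i - m)) w) \<le> K * norm w"
        using Q_bound[of "real (i - m)"] by auto
      have "norm (?Q i ((R 1 ^^ j) w)) \<le> M * K * ?N w" for w
      proof -
        have "?Q i ((R 1 ^^ j) w) = (R 1 ^^ j) (?Q (i - m) (?Q m w))"
          using True by (simp add: R_series_commute_funpow s QQ)
        then have "norm (?Q i ((R 1 ^^ j) w)) \<le> M * norm (?Q (i - m) (?Q m w))"
          using norm_R_1_funpow by simp
        also have "\<dots> \<le> M * (K * norm (?Q m w))" using M_pos K by (intro mult_left_mono) auto
        also have "\<dots> \<le> M * (K * ?N w)" using M_pos K by (intro mult_left_mono) auto
        finally show ?thesis by (simp add: mult_ac)
      qed
      then show ?thesis using K M_pos by (intro exI[of _ "M * K"]) auto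
    next
      case False
      then have j: "j = (j - m) + m" using 0 by simp
      obtain K where K: "K \<ge> 0" "\<And>w. norm (?Q i w) \<le> K * norm w"
        using Q_bound[of "real i"] by auto
      have "norm (?Q i ((R 1 ^^ j) w)) \<le> K * M * ?N w" for w
      proof -
        have "norm (?Q i ((R 1 ^^ j) w)) \<le> K * norm ((R 1 ^^ (j - m)) ((R 1 ^^ m) w))"
          using K(2) by (subst j) (simp add: funpow_add)
        also have "\<dots> \<le> K * (M * norm ((R 1 ^^ m) w))"
          using K norm_R_1_funpow by (intro mult_left_mono) auto
        also have "\<dots> \<le> K * (M * ?N w)" using M_pos K by (intro mult_left_mono) auto
        finally show ?thesis by (simp add: mult_ac)
      qed
      then show ?thesis using K M_pos by (intro exI[of _ "K * M"]) auto
    qed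
  next
    case (Suc n)
    obtain K1 where K1: "K1 \<ge> 0" "\<And>w. norm (?Q i ((R 1 ^^ Suc j) w)) \<le> K1 * ?N w"
      using Suc.IH[of i "Suc j"] Suc.prems by auto
    obtain K2 where K2: "K2 \<ge> 0" "\<And>w. norm (?Q (Suc i) ((R 1 ^^ j) w)) \<le> K2 * ?N w"
      using Suc.IH[of "Suc i" j] Suc.prems by auto
    have "norm (?Q i ((R 1 ^^ j) w)) \<le> (K1 + K2) * ?N w" for w
    proof -
      let ?v = "(R 1 ^^ j) w"
      have "?Q (Suc i) ?v = frac_mult 1 1 (?Q i ?v)" by (simp add: QQ)
      also have "\<dots> = ?Q i ?v - ?Q i (R 1 ?v)"
        using R_series_commute_funpow[OF s[of "real i"], of 1 ?v] by (simp add: frac_mult_one)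
      finally have "?Q i ?v = ?Q (Suc i) ?v + ?Q i ((R 1 ^^ Suc j) w)" by simp
      then have "norm (?Q i ?v) \<le> norm (?Q (Suc i) ?v) + norm (?Q i ((R 1 ^^ Suc j) w))"
        by (metis norm_triangle_ineq)
      then show ?thesis using K1(2)[of w] K2(2)[of w] unfolding distrib_right by linarith
    qed
    then show ?case using K1 K2 by (intro exI[of _ "K1 + K2"]) auto
  qed
  obtain K where K: "K \<ge> 0" "\<And>w. norm w \<le> K * ?N w"
    using main[of 0 0 "2 * m"] by (auto simp: R_series_zero)
  \<comment> \<open>As m > \<gamma>, r ^ m is a bounded multiple of \<open>R \<gamma>\<close> and q
    ^ m is one of \<open>frac_mult 1 \<gamma>\<close>; these are the two parts of the graph norm at
    \<open>R \<gamma> w\<close>.\<close>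
  obtain L where L: "L \<ge> 0" "\<And>w. norm (frac_mult 1 (real m - \<gamma>) w) \<le> L * norm w"
    using Q_bound[of "real m - \<gamma>"] m by auto
  have "norm w \<le> K * (M + L) * graph_norm T \<gamma> (R \<gamma> w)" for w
  proof -
    have "m > 0" using m \<gamma> by (cases m) auto
    then have "(R 1 ^^ m) w = R (real m - \<gamma>) (R \<gamma> w)" using m \<gamma> by (simp add: R_1_funpow R_R)
    then have 1: "norm ((R 1 ^^ m) w) \<le> M * norm (R \<gamma> w)" using norm_R m by simp
    have "?Q m w = frac_mult 1 (real m - \<gamma>) (frac_mult 1 \<gamma> w)" using m \<gamma> by (simp add: QQ)
    then have 2: "norm (?Q m w) \<le> L * norm (frac_mult 1 \<gamma> w)" using L by simp
    have nonneg: "0 \<le> M * norm (frac_mult 1 \<gamma> w)" "0 \<le> L * norm (R \<gamma> w)"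
      using M_pos L(1) by auto
    have "?N w \<le> (M + L) * graph_norm T \<gamma> (R \<gamma> w)"
      using 1 2 nonneg
      unfolding graph_norm_def frac_power_R by (simp add: algebra_simps)
    then have "K * ?N w \<le> K * ((M + L) * graph_norm T \<gamma> (R \<gamma> w))" using K(1) by (rule mult_left_mono)
    then show ?thesis using K(2)[of w] by (simp add: mult_ac)
  qed
  then show ?thesis using K L M_pos by (intro exI[of _ "K * (M + L)"]) auto
qed

end

subsection \<open>The moment inequality\<close>

text \<open>Integration by parts, as \<open>- exp (- s) *\<^sub>R T s (R 1 w)\<close> is a primitive of \<open>exp (- s) *\<^sub>R T s w\<close>.\<close>

lemma norm_kernel_integral_away_from_0:
  assumes \<sigma>: "0 < \<sigma>" "\<sigma> < 1" and d: "0 < d" "d \<le> N"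
  shows "norm (integral {d..N} (\<lambda>s. (s powr (\<sigma> - 1) * exp (- s)) *\<^sub>R T s w))
    \<le> 2 * d powr (\<sigma> - 1) * (M * norm (R 1 w))"
proof -
  define F where "F s = exp (- s) *\<^sub>R T s (R 1 w)" for s
  let ?K = "M * norm (R 1 w)"
  have F': "(F has_vector_derivative - (exp (- s) *\<^sub>R T s w)) (at s within {0..})" if "s \<ge> 0" for s
  proof -
    have "(F has_vector_derivative exp (- s) *\<^sub>R T s (R 1 w - w) + (- exp (- s)) *\<^sub>R T s (R 1 w)) (at s within {0..})"
      unfolding F_def using T_R_1_has_vector_derivative[OF that]
      by (intro has_vector_derivative_scaleR) (auto intro!: derivative_eq_intros)
    then show ?thesis using that by (simp add: T_diff_right scaleR_diff_right)
  qed
  have F_cont: "continuous_on {0..} F"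
    unfolding F_def by (intro continuous_intros continuous_T)
  have F_norm: "norm (F s) \<le> ?K" if "s \<ge> 0" for s
  proof -
    have "norm (F s) \<le> 1 * norm (T s (R 1 w))"
      unfolding F_def norm_scaleR using that by (intro mult_right_mono) auto
    then show ?thesis using norm_T[OF that, of "R 1 w"] by simp
  qed
  have "((\<lambda>s. s powr (\<sigma> - 1) *\<^sub>R (- (exp (- s) *\<^sub>R T s w)) + ((\<sigma> - 1) * s powr (\<sigma> - 2)) *\<^sub>R F s) has_integral
      N powr (\<sigma> - 1) *\<^sub>R F N - d powr (\<sigma> - 1) *\<^sub>R F d) {d..N}"
  proof (rule fundamental_theorem_of_calculus[OF d(2)])
    fix s assume s: "s \<in> {d..N}"
    have "((\<lambda>s. s powr (\<sigma> - 1)) has_real_derivative (\<sigma> - 1) * s powr (\<sigma> - 2)) (at s within {d..N})"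
      using has_real_derivative_powr[of s "\<sigma> - 1"] s d by (auto intro: has_field_derivative_at_within)
    then show "((\<lambda>s. s powr (\<sigma> - 1) *\<^sub>R F s) has_vector_derivative
        s powr (\<sigma> - 1) *\<^sub>R (- (exp (- s) *\<^sub>R T s w)) + ((\<sigma> - 1) * s powr (\<sigma> - 2)) *\<^sub>R F s) (at s within {d..N})"
      using s d by (intro has_vector_derivative_scaleR
          has_vector_derivative_within_subset[OF F']) auto
  qed
  moreover have FI: "((\<lambda>s. ((\<sigma> - 1) * s powr (\<sigma> - 2)) *\<^sub>R F s) has_integral
      integral {d..N} (\<lambda>s. ((\<sigma> - 1) * s powr (\<sigma> - 2)) *\<^sub>R F s)) {d..N}" (is "(?f has_integral ?J) _")
    using d by (intro integrable_integral integrable_continuous_real continuous_intros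
        continuous_on_subset[OF F_cont]) auto
  ultimately have "((\<lambda>s. - (s powr (\<sigma> - 1) *\<^sub>R (- (exp (- s) *\<^sub>R T s w)) + ?f s) + ?f s) has_integral
      - (N powr (\<sigma> - 1) *\<^sub>R F N - d powr (\<sigma> - 1) *\<^sub>R F d) + ?J) {d..N}"
    by (intro has_integral_add has_integral_neg)
  then have eq: "integral {d..N} (\<lambda>s. (s powr (\<sigma> - 1) * exp (- s)) *\<^sub>R T s w)
      = d powr (\<sigma> - 1) *\<^sub>R F d - N powr (\<sigma> - 1) *\<^sub>R F N + ?J"
    by (intro integral_unique) simp
  have "((\<lambda>s. (1 - \<sigma>) * s powr (\<sigma> - 2)) has_integral - (N powr (\<sigma> - 1)) - - (d powr (\<sigma> - 1))) {d..N}"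
  proof (rule fundamental_theorem_of_calculus[OF d(2)])
    fix s assume "s \<in> {d..N}"
    then have "((\<lambda>s. - (s powr (\<sigma> - 1))) has_real_derivative (1 - \<sigma>) * s powr (\<sigma> - 2)) (at s within {d..N})"
      using DERIV_minus[OF has_real_derivative_powr[of s "\<sigma> - 1"]] d
      by (auto simp: algebra_simps intro: has_field_derivative_at_within)
    then show "((\<lambda>s. - (s powr (\<sigma> - 1))) has_vector_derivative (1 - \<sigma>) * s powr (\<sigma> - 2)) (at s within {d..N})"
      by (simp add: has_real_derivative_iff_has_vector_derivative)
  qed
  from has_integral_mult_left[OF this, of ?K]
  have gI: "((\<lambda>s. (1 - \<sigma>) * s powr (\<sigma> - 2) * ?K) has_integral (d powr (\<sigma> - 1) - N powr (\<sigma> - 1)) * ?K) {d..N}"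
    by simp
  have "norm ?J \<le> integral {d..N} (\<lambda>s. (1 - \<sigma>) * s powr (\<sigma> - 2) * ?K)"
    using has_integral_integrable[OF FI] has_integral_integrable[OF gI]
  proof (rule integral_norm_bound_integral)
    fix s assume "s \<in> {d..N}"
    then have "norm (F s) \<le> ?K" using d F_norm by simp
    then have "(1 - \<sigma>) * s powr (\<sigma> - 2) * norm (F s) \<le> (1 - \<sigma>) * s powr (\<sigma> - 2) * ?K"
      using \<sigma> by (intro mult_left_mono) auto
    then show "norm (?f s) \<le> (1 - \<sigma>) * s powr (\<sigma> - 2) * ?K" using \<sigma> by (simp add: abs_mult)
  qed
  then have J: "norm ?J \<le> (d powr (\<sigma> - 1) - N powr (\<sigma> - 1)) * ?K" unfolding integral_unique[OF gI] .
  \<comment> \<open>The terms with N cancel against the integral of the derivative of the decreasing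
    function s powr (\<sigma> - 1), which leaves a bound uniform in N.\<close>
  have "norm (d powr (\<sigma> - 1) *\<^sub>R F d - N powr (\<sigma> - 1) *\<^sub>R F N + ?J)
      \<le> norm (d powr (\<sigma> - 1) *\<^sub>R F d) + norm (N powr (\<sigma> - 1) *\<^sub>R F N) + norm ?J"
    by (meson norm_triangle_ineq norm_triangle_ineq4 order_trans add_right_mono)
  also have "\<dots> \<le> d powr (\<sigma> - 1) * ?K + N powr (\<sigma> - 1) * ?K + (d powr (\<sigma> - 1) - N powr (\<sigma> - 1)) * ?K"
    using F_norm[of d] F_norm[of N] d by (intro add_mono J) (auto intro!: mult_left_mono)
  also have "\<dots> = 2 * d powr (\<sigma> - 1) * ?K" by (simp add: algebra_simps)
  finally show ?thesis unfolding eq .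
qed

text \<open>Near 0 the kernel is integrable and \<open>norm w\<close> is used; beyond d the kernel
  is of bounded variation and the smaller \<open>norm (R 1 w)\<close> can be used. The cut d remains
  free for later choice.\<close>

lemma norm_R_split:
  assumes \<sigma>: "0 < \<sigma>" "\<sigma> < 1" and d: "0 < d"
  shows "Gamma \<sigma> * norm (R \<sigma> w) \<le> d powr \<sigma> / \<sigma> * (M * norm w) + 2 * d powr (\<sigma> - 1) * (M * norm (R 1 w))"
proof -
  let ?f = "\<lambda>s. (s powr (\<sigma> - 1) * exp (- s)) *\<^sub>R T s w"
  let ?C = "d powr \<sigma> / \<sigma> * (M * norm w) + 2 * d powr (\<sigma> - 1) * (M * norm (R 1 w))"
  have int: "?f integrable_on {0..N}" for N
    by (rule integrable_on_subinterval[OF has_integral_integrable[OF R_has_integral[OF \<sigma>(1)]]]) auto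
  have near: "norm (integral {0..d} ?f) \<le> d powr \<sigma> / \<sigma> * (M * norm w)"
  proof -
    have g: "((\<lambda>s. s powr (\<sigma> - 1) * (M * norm w)) has_integral d powr \<sigma> / \<sigma> * (M * norm w)) {0..d}"
      using has_integral_mult_left[OF has_integral_powr_from_0[of "\<sigma> - 1" d]] \<sigma> d by simp
    have "norm (integral {0..d} ?f) \<le> integral {0..d} (\<lambda>s. s powr (\<sigma> - 1) * (M * norm w))"
      using int has_integral_integrable[OF g]
    proof (rule integral_norm_bound_integral)
      fix s assume s: "s \<in> {0..d}"
      have "exp (- s) * norm (T s w) \<le> 1 * (M * norm w)"
        using s norm_T[of s w] by (intro mult_mono) auto
      then show "norm (?f s) \<le> s powr (\<sigma> - 1) * (M * norm w)"
        by (simp add: mult_left_mono mult.assoc)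
    qed
    then show ?thesis unfolding integral_unique[OF g] .
  qed
  have "norm (Gamma \<sigma> *\<^sub>R R \<sigma> w) \<le> ?C"
  proof (rule tendsto_upperbound[OF tendsto_norm[OF integral_tendsto_at_top[OF R_has_integral[OF \<sigma>(1), of w]]]])
    show "\<forall>\<^sub>F N in at_top. norm (integral {0..N} ?f) \<le> ?C"
      using eventually_ge_at_top[of d]
    proof eventually_elim
      case (elim N)
      have eq: "integral {0..N} ?f = integral {0..d} ?f + integral {d..N} ?f"
        using d elim int by (intro Henstock_Kurzweil_Integration.integral_combine[symmetric]) auto
      show ?case
        unfolding eq using near norm_kernel_integral_away_from_0[OF \<sigma> d elim, of w]
          norm_triangle_ineq[of "integral {0..d} ?f" "integral {d..N} ?f"] by linarith
    qed
  qed simp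
  then show ?thesis using Gamma_real_pos[OF \<sigma>(1)] by simp
qed

text \<open>Logarithms make this an additive inequality, so that instances at different vectors can
  be combined linearly.\<close>

lemma ln_norm_R_interpolation:
  assumes \<sigma>: "0 < \<sigma>" "\<sigma> < 1"
  shows "\<exists>C. \<forall>w. w \<noteq> 0 \<longrightarrow> ln (norm (R \<sigma> w)) \<le> \<sigma> * ln (norm (R 1 w)) + (1 - \<sigma>) * ln (norm w) + C"
proof -
  define K where "K = (1 / \<sigma> + 2) * M / Gamma \<sigma>"
  note G = Gamma_real_pos[OF \<sigma>(1)]
  have K: "K > 0" using \<sigma> M_pos G by (auto simp: K_def intro!: divide_pos_pos mult_pos_pos add_pos_pos)
  have "ln (norm (R \<sigma> w)) \<le> \<sigma> * ln (norm (R 1 w)) + (1 - \<sigma>) * ln (norm w) + ln K" if w: "w \<noteq> 0" for w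
  proof -
    define a where "a = norm (R 1 w)"
    define b where "b = norm w"
    have ab: "a > 0" "b > 0" using w by (auto simp: a_def b_def R_eq_0_iff)
    have 1: "(a / b) powr \<sigma> * b = a powr \<sigma> * b powr (1 - \<sigma>)"
      using ab by (simp add: powr_divide powr_diff)
    have 2: "(a / b) powr (\<sigma> - 1) * a = a powr \<sigma> * b powr (1 - \<sigma>)"
      using ab by (simp add: powr_divide powr_diff field_simps)
    \<comment> \<open>The cut d = a / b balances the two terms of the splitting.\<close>
    have "Gamma \<sigma> * norm (R \<sigma> w) \<le> (a / b) powr \<sigma> / \<sigma> * (M * b) + 2 * (a / b) powr (\<sigma> - 1) * (M * a)"
      unfolding a_def b_def using ab by (intro norm_R_split[OF \<sigma>]) (auto simp: a_def b_def)
    also have "\<dots> = (M / \<sigma>) * ((a / b) powr \<sigma> * b) + (2 * M) * ((a / b) powr (\<sigma> - 1) * a)"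
      by (simp add: field_simps)
    also have "\<dots> = Gamma \<sigma> * (K * (a powr \<sigma> * b powr (1 - \<sigma>)))"
    proof -
      have "Gamma \<sigma> * K = M / \<sigma> + 2 * M" using G by (simp add: K_def distrib_right)
      then show ?thesis unfolding 1 2 mult.assoc[symmetric] by (simp only: distrib_right)
    qed
    finally have "norm (R \<sigma> w) \<le> K * (a powr \<sigma> * b powr (1 - \<sigma>))" using G by simp
    moreover have "norm (R \<sigma> w) > 0" using w \<sigma> by (simp add: R_eq_0_iff)
    ultimately have "ln (norm (R \<sigma> w)) \<le> ln (K * (a powr \<sigma> * b powr (1 - \<sigma>)))"
      by (intro ln_mono) auto
    also have "\<dots> = ln K + (\<sigma> * ln a + (1 - \<sigma>) * ln b)"
      using ab K by (simp add: ln_mult ln_powr)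
    finally show ?thesis by (simp add: a_def b_def)
  qed
  then show ?thesis by blast
qed

text \<open>
  The moment inequality for exponents 0, 1 and \<open>\<gamma>\<close>. The interpolation between \<open>R 1\<close> and the identity
  bounds \<open>a \<mapsto> ln (norm (R a w))\<close> up to constants by linear interpolation on intervals of length 1;
  overlapping such intervals gives the convexity on longer ones.
\<close>

lemma ln_norm_moment:
  assumes "1 \<le> \<gamma>" "\<gamma> \<le> real n"
  shows "\<exists>C. \<forall>w. w \<noteq> 0 \<longrightarrow> \<gamma> * ln (norm (R 1 w)) \<le> (\<gamma> - 1) * ln (norm w) + ln (norm (R \<gamma> w)) + C"
  using assms
proof (induction n arbitrary: \<gamma>)
  case (Suc n)
  let ?f = "\<lambda>a w. ln (norm (R a w))"
  let ?l = "\<lambda>w. ln (norm w)"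
  \<comment> \<open>The midpoint inequality at 1/2 is applied to w, \<open>R (1/2) w\<close> and
    \<open>R 1 w\<close>. Eliminating the values at 1/2 and 3/2 leaves the one at 1, with constant 8
    C.\<close>
  obtain C2 where C2: "\<And>w. w \<noteq> 0 \<Longrightarrow> 2 * ?f 1 w \<le> ?l w + ?f 2 w + C2"
  proof -
    obtain C where C: "\<And>w. w \<noteq> 0 \<Longrightarrow> ?f (1/2) w \<le> 1/2 * ?f 1 w + 1/2 * ?l w + C"
      using ln_norm_R_interpolation[of "1/2"] by auto
    have "2 * ?f 1 w \<le> ?l w + ?f 2 w + 8 * C" if w: "w \<noteq> 0" for w
      using C[OF w] C[of "R (1/2) w"] C[of "R 1 w"] w
      by (simp add: R_R R_eq_0_iff)
    then show ?thesis by (rule that)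
  qed
  consider "\<gamma> = 1" | "1 < \<gamma>" "\<gamma> < 2" | "\<gamma> = 2" | "\<gamma> > 2" using Suc.prems by linarith
  then show ?case
  proof cases
    case 2
    \<comment> \<open>The point 1 lies in the unit interval from s to \<gamma> = s + 1, and s lies
      in [0, 1]; eliminating the value at s leaves 0, 1 and \<gamma>.\<close>
    define s where "s = \<gamma> - 1"
    have s: "0 < s" "s < 1" using 2 by (auto simp: s_def)
    obtain C where C: "\<And>w. w \<noteq> 0 \<Longrightarrow> ?f s w \<le> s * ?f 1 w + (1 - s) * ?l w + C"
      using ln_norm_R_interpolation[of s] s by auto
    obtain D where D: "\<And>w. w \<noteq> 0 \<Longrightarrow> ?f (1 - s) w \<le> (1 - s) * ?f 1 w + s * ?l w + D"
      using ln_norm_R_interpolation[of "1 - s"] s by auto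
    have "\<gamma> * ?f 1 w \<le> (\<gamma> - 1) * ?l w + ?f \<gamma> w + (s * C + D) / (1 - s)" if w: "w \<noteq> 0" for w
    proof -
      have "?f 1 w \<le> (1 - s) * ?f \<gamma> w + s * ?f s w + D"
        using D[of "R s w"] w s by (simp add: R_R R_eq_0_iff s_def)
      also have "\<dots> \<le> (1 - s) * ?f \<gamma> w + s * (s * ?f 1 w + (1 - s) * ?l w + C) + D"
        using C[OF w] s by (intro add_mono mult_left_mono) auto
      finally have "(1 - s) * ((1 + s) * ?f 1 w) \<le> (1 - s) * (s * ?l w + ?f \<gamma> w) + (s * C + D)"
        by (simp add: algebra_simps)
      also have "\<dots> = (1 - s) * (s * ?l w + ?f \<gamma> w + (s * C + D) / (1 - s))"
      proof -
        have "(1 - s) * (x + y / (1 - s)) = (1 - s) * x + y" for x y using s by (simp add: field_simps)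
        then show ?thesis by metis
      qed
      finally show ?thesis using s by (simp add: s_def)
    qed
    then show ?thesis by blast
  next
    \<comment> \<open>The induction hypothesis at \<open>R 1 w\<close> compares the exponents 1, 2
      and \<gamma>; \<open>C2\<close> then eliminates the value at 2.\<close>
    case 4
    then obtain C where C: "\<And>w. w \<noteq> 0 \<Longrightarrow> (\<gamma> - 1) * ?f 1 w \<le> (\<gamma> - 2) * ?l w + ?f (\<gamma> - 1) w + C"
      using Suc.IH[of "\<gamma> - 1"] Suc.prems by auto
    have "\<gamma> * ?f 1 w \<le> (\<gamma> - 1) * ?l w + ?f \<gamma> w + (C + (\<gamma> - 1) * C2)" if w: "w \<noteq> 0" for w
    proof -
      have "(\<gamma> - 1) * (2 * ?f 1 w) \<le> (\<gamma> - 1) * (?l w + ?f 2 w + C2)"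
        using C2[OF w] 4 by (intro mult_left_mono) auto
      moreover have "(\<gamma> - 1) * ?f 2 w \<le> (\<gamma> - 2) * ?f 1 w + ?f \<gamma> w + C"
        using C[of "R 1 w"] w 4 by (simp add: R_R R_eq_0_iff)
      ultimately show ?thesis by (simp add: algebra_simps)
    qed
    then show ?thesis by blast
  qed (use C2 in auto)
qed simp

lemma norm_moment:
  assumes "\<gamma> \<ge> 1"
  shows "\<exists>C>0. \<forall>w. norm (R 1 w) powr \<gamma> \<le> C * norm w powr (\<gamma> - 1) * norm (R \<gamma> w)"
proof -
  obtain n :: nat where "real n \<ge> \<gamma>" using real_arch_simple by blast
  then obtain C where C: "\<And>w. w \<noteq> 0 \<Longrightarrow>
      \<gamma> * ln (norm (R 1 w)) \<le> (\<gamma> - 1) * ln (norm w) + ln (norm (R \<gamma> w)) + C"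
    using ln_norm_moment[OF assms] by blast
  have "norm (R 1 w) powr \<gamma> \<le> exp C * norm w powr (\<gamma> - 1) * norm (R \<gamma> w)" for w
  proof (cases "w = 0")
    case False
    then have "norm (R 1 w) > 0" "norm w > 0" "norm (R \<gamma> w) > 0"
      using assms by (auto simp: R_eq_0_iff)
    then have "norm (R 1 w) powr \<gamma> = exp (\<gamma> * ln (norm (R 1 w)))"
      "exp C * norm w powr (\<gamma> - 1) * norm (R \<gamma> w) = exp ((\<gamma> - 1) * ln (norm w) + ln (norm (R \<gamma> w)) + C)"
      by (simp_all add: powr_def exp_add)
    then show ?thesis using C[OF False] by simp
  qed (simp add: R_zero)
  then show ?thesis by (intro exI[of _ "exp C"]) auto
qed

end

subsection \<open>Decay from the Lyapunov condition\<close>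

lemma cmod_le_antidual_norm:
  assumes \<phi>: "\<phi> \<in> antidual D N" and y: "y \<in> D" and N: "\<And>x. N x \<ge> 0"
    and D_scaleR: "\<And>r. r *\<^sub>R y \<in> D" and N_scaleR: "\<And>r. N (r *\<^sub>R y) = \<bar>r\<bar> * N y"
  shows "cmod (\<phi> y) \<le> antidual_norm D N \<phi> * N y"
proof -
  have hom: "\<And>c x. x \<in> D \<Longrightarrow> \<phi> (c *\<^sub>C x) = cnj c * \<phi> x"
    using \<phi> unfolding antidual_def by blast
  obtain C where C: "\<And>x. x \<in> D \<Longrightarrow> cmod (\<phi> x) \<le> C * N x"
    using \<phi> unfolding antidual_def by blast
  show ?thesis
  proof (cases "N y = 0")
    case True
    then show ?thesis using C[OF y] by simp
  next
    case False
    then have pos: "N y > 0" using N[of y] by simp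
    let ?y = "inverse (N y) *\<^sub>R y"
    \<comment> \<open>The supremum is an upper bound only because boundedness of the functional
      makes the set of values bounded.\<close>
    have "bdd_above ((\<lambda>y. cmod (\<phi> y)) ` {y \<in> D. N y \<le> 1})"
    proof (rule bdd_aboveI2)
      fix x assume x: "x \<in> {y \<in> D. N y \<le> 1}"
      then have "C * N x \<le> max C 0 * 1" using N[of x] by (intro mult_mono) auto
      then show "cmod (\<phi> x) \<le> max C 0" using C[of x] x by simp
    qed
    moreover have "?y \<in> {y \<in> D. N y \<le> 1}" using D_scaleR N_scaleR[of "inverse (N y)"] pos by simp
    ultimately have "cmod (\<phi> ?y) \<le> antidual_norm D N \<phi>"
      unfolding antidual_norm_def by (intro cSUP_upper)
    moreover have "\<phi> ?y = of_real (inverse (N y)) * \<phi> y"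
      using hom[OF y, of "of_real (inverse (N y))"] by (simp only: scaleC_of_real complex_cnj_complex_of_real)
    ultimately have "inverse (N y) * cmod (\<phi> y) \<le> antidual_norm D N \<phi>"
      using pos by (simp add: norm_mult norm_inverse)
    then show ?thesis using pos by (simp add: field_simps)
  qed
qed

context bounded_semigroup
begin

text \<open>An operator-norm rate, uniform in w. It is restricted to t > 0 because
  \<open>0 powr (- p)\<close> is 0.\<close>

definition decays :: "real \<Rightarrow> real \<Rightarrow> bool"
  where "decays a p \<longleftrightarrow> (\<exists>K\<ge>0. \<forall>t>0. \<forall>w. norm (T t (R a w)) \<le> K * t powr (- p) * norm w)"

lemma T_R_R_half:
  assumes "a > 0" "b > 0" "t \<ge> 0"
  shows "T t (R (a + b) w) = T (t / 2) (R a (T (t / 2) (R b w)))"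
  using assms T_add[of "t / 2" "t / 2"] by (simp add: R_R[symmetric] T_R)

text \<open>Each factor gets half of the time; the halving accounts for the constant
  \<open>(1 / 2) powr (- (p + q))\<close>.\<close>

lemma decays_add:
  assumes a: "a > 0" "decays a p" and b: "b > 0" "decays b q"
  shows "decays (a + b) (p + q)"
proof -
  obtain K where K: "K \<ge> 0" "\<And>t w. t > 0 \<Longrightarrow> norm (T t (R a w)) \<le> K * t powr (- p) * norm w"
    using a by (auto simp: decays_def)
  obtain L where L: "L \<ge> 0" "\<And>t w. t > 0 \<Longrightarrow> norm (T t (R b w)) \<le> L * t powr (- q) * norm w"
    using b by (auto simp: decays_def)
  have "norm (T t (R (a + b) w)) \<le> (K * L * (1 / 2) powr (- (p + q))) * t powr (- (p + q)) * norm w"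
    if t: "t > 0" for t w
  proof -
    have "norm (T t (R (a + b) w)) \<le> K * (t / 2) powr (- p) * norm (T (t / 2) (R b w))"
      using K(2)[of "t / 2"] t a b by (simp add: T_R_R_half)
    also have "\<dots> \<le> K * (t / 2) powr (- p) * (L * (t / 2) powr (- q) * norm w)"
      using L(2)[of "t / 2" w] t K(1) by (intro mult_left_mono) auto
    also have "\<dots> = K * L * ((1 / 2) * t) powr (- (p + q)) * norm w"
      using t by (simp add: powr_add powr_diff powr_minus field_simps)
    also have "((1 / 2) * t) powr (- (p + q)) = (1 / 2) powr (- (p + q)) * t powr (- (p + q))"
      using t by (intro powr_mult)
    finally show ?thesis by (simp add: mult_ac)
  qed
  then show ?thesis unfolding decays_def
    using K(1) L(1) by (intro exI[of _ "K * L * (1 / 2) powr (- (p + q))"]) auto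
qed

lemma decays_mult:
  assumes "a > 0" "decays a p"
  shows "n > 0 \<Longrightarrow> decays (real n * a) (real n * p)"
proof (induction n)
  case (Suc n)
  show ?case
  proof (cases "n = 0")
    case False
    then have "decays (real n * a + a) (real n * p + p)"
      using Suc assms by (intro decays_add) auto
    then show ?thesis by (simp add: algebra_simps)
  qed (use assms in simp)
qed simp

text \<open>Up to the factor M the norm does not increase along an orbit, so the value at time t is
  controlled by all earlier ones, hence by their mean square.\<close>

lemma norm_T_le_integral:
  assumes "0 \<le> a" "a \<le> t"
  shows "(t - a) * (norm (T t x))\<^sup>2 \<le> M\<^sup>2 * integral {a..t} (\<lambda>s. (norm (T s x))\<^sup>2)"
proof -
  have int: "(\<lambda>s. M\<^sup>2 * (norm (T s x))\<^sup>2) integrable_on {a..t}"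
    by (intro integrable_continuous_real continuous_intros continuous_on_subset[OF continuous_T])
      (use assms in auto)
  have "integral {a..t} (\<lambda>s. (norm (T t x))\<^sup>2) \<le> integral {a..t} (\<lambda>s. M\<^sup>2 * (norm (T s x))\<^sup>2)"
  proof (rule integral_le[OF _ int])
    fix s assume s: "s \<in> {a..t}"
    then have "T t x = T (t - s) (T s x)" using assms T_add[of "t - s" s x] by simp
    then have "norm (T t x) \<le> M * norm (T s x)" using s norm_T[of "t - s" "T s x"] by simp
    then have "(norm (T t x))\<^sup>2 \<le> (M * norm (T s x))\<^sup>2" by (intro power_mono) auto
    then show "(norm (T t x))\<^sup>2 \<le> M\<^sup>2 * (norm (T s x))\<^sup>2" by (simp add: power_mult_distrib)
  qed (simp add: integrable_const_ivl)
  then show ?thesis using assms by simp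
qed

section \<open>Consequences of a given solution \<open>P\<close>\<close>

context
  fixes \<beta> :: real and P :: "'a \<Rightarrow> 'a \<Rightarrow> complex"
  assumes \<beta>: "\<beta> > 0"
    and bounded_P: "bounded_clinear_to_antidual (frac_power_dom T \<beta>) (graph_norm T \<beta>) P"
    and nonneg_P: "\<And>x. x \<in> frac_power_dom T \<beta> \<Longrightarrow> P x x \<in> \<real>\<^sub>\<ge>\<^sub>0"
    and lyapunov_P: "\<And>x y. x \<in> frac_power_dom T (\<beta> + 1) \<Longrightarrow> y \<in> frac_power_dom T (\<beta> + 1) \<Longrightarrow>
      P (generator T x) y + P x (generator T y) = - cinner x y"
begin

text \<open>In the coordinate w the domain with its graph norm is dominated by the whole space with
  its own norm. Real bilinearity is enough for the product rule.\<close>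

lemma bounded_bilinear_P: "bounded_bilinear (\<lambda>w w'. P (R \<beta> w) (R \<beta> w'))"
proof -
  let ?D = "frac_power_dom T \<beta>" and ?N = "graph_norm T \<beta>"
  have D: "R \<beta> w \<in> ?D" for w by (simp add: frac_power_dom_eq[OF \<beta>])
  have anti: "P (R \<beta> w) \<in> antidual ?D ?N" for w
    using bounded_P D unfolding bounded_clinear_to_antidual_def by blast
  have addl: "P (R \<beta> (w + w')) (R \<beta> v) = P (R \<beta> w) (R \<beta> v) + P (R \<beta> w') (R \<beta> v)" for w w' v
    using bounded_P D unfolding bounded_clinear_to_antidual_def R_add_right[OF \<beta>] by blast
  have addr: "P (R \<beta> v) (R \<beta> (w + w')) = P (R \<beta> v) (R \<beta> w) + P (R \<beta> v) (R \<beta> w')" for w w' v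
    using anti D unfolding antidual_def R_add_right[OF \<beta>] by blast
  have scalel: "P (R \<beta> (r *\<^sub>R w)) (R \<beta> v) = r *\<^sub>R P (R \<beta> w) (R \<beta> v)" for r w v
  proof -
    have "P (of_real r *\<^sub>C R \<beta> w) (R \<beta> v) = of_real r * P (R \<beta> w) (R \<beta> v)"
      using bounded_P D unfolding bounded_clinear_to_antidual_def by blast
    then show ?thesis by (simp add: scaleC_of_real R_scaleR[OF \<beta>] scaleR_conv_of_real)
  qed
  have scaler: "P (R \<beta> v) (R \<beta> (r *\<^sub>R w)) = r *\<^sub>R P (R \<beta> v) (R \<beta> w)" for r w v
  proof -
    have "P (R \<beta> v) (of_real r *\<^sub>C R \<beta> w) = cnj (of_real r) * P (R \<beta> v) (R \<beta> w)"
      using anti D unfolding antidual_def by blast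
    then show ?thesis by (simp add: scaleC_of_real R_scaleR[OF \<beta>] scaleR_conv_of_real)
  qed
  obtain C where C: "\<And>x. x \<in> ?D \<Longrightarrow> antidual_norm ?D ?N (P x) \<le> C * ?N x"
    using bounded_P unfolding bounded_clinear_to_antidual_def by blast
  obtain L where L: "L \<ge> 0" "\<And>w. ?N (R \<beta> w) \<le> L * norm w"
    using graph_norm_R_le[OF \<beta>] by blast
  have N_nonneg: "?N x \<ge> 0" for x by (simp add: graph_norm_def)
  have lin: "bounded_linear (frac_mult 1 \<beta>)"
    using \<beta> by (intro linear_R_series) (simp add: summable_abs_binomial_coeff)
  have N_scaleR: "?N (r *\<^sub>R R \<beta> w) = \<bar>r\<bar> * ?N (R \<beta> w)" for r w
  proof -
    have "frac_power T \<beta> (r *\<^sub>R R \<beta> w) = r *\<^sub>R frac_power T \<beta> (R \<beta> w)"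
      by (simp only: R_scaleR[OF \<beta>, symmetric] frac_power_R[OF \<beta>]
          linear_scale[OF bounded_linear.linear[OF lin]])
    then show ?thesis by (simp add: graph_norm_def distrib_left)
  qed
  have "cmod (P (R \<beta> w) (R \<beta> v)) \<le> norm w * norm v * (max C 0 * L * L)" for w v
  proof -
    have "cmod (P (R \<beta> w) (R \<beta> v)) \<le> antidual_norm ?D ?N (P (R \<beta> w)) * ?N (R \<beta> v)"
      using D R_scaleR[OF \<beta>, symmetric]
      by (intro cmod_le_antidual_norm anti N_nonneg N_scaleR) auto
    also have "\<dots> \<le> (max C 0 * ?N (R \<beta> w)) * ?N (R \<beta> v)"
      using C[OF D[of w]] N_nonneg mult_right_mono[of C "max C 0" "?N (R \<beta> w)"]
      by (intro mult_right_mono) (auto intro: order_trans)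
    also have "\<dots> \<le> (max C 0 * (L * norm w)) * (L * norm v)"
      using L N_nonneg by (intro mult_mono mult_left_mono) auto
    finally show ?thesis by (simp add: mult_ac)
  qed
  then show ?thesis
    by unfold_locales (use addl addr scalel scaler in blast)+
qed

text \<open>For v = \<open>R 1 w\<close> the orbit of v is differentiable and
  \<open>R \<beta> v\<close> lies in the domain where the Lyapunov equation holds. Nonnegativity of
  \<open>P\<close> discards the end term, and the initial term is bounded by \<open>norm v\<close>
  alone.\<close>

lemma energy_bound:
  "\<exists>C\<ge>0. \<forall>v\<in>range (R 1). \<forall>t\<ge>0. integral {0..t} (\<lambda>s. (norm (T s (R \<beta> v)))\<^sup>2) \<le> C * (norm v)\<^sup>2"
proof -
  let ?b = "\<lambda>w w'. P (R \<beta> w) (R \<beta> w')"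
  interpret b: bounded_bilinear ?b by (rule bounded_bilinear_P)
  obtain C where C: "C \<ge> 0" "\<And>w w'. norm (?b w w') \<le> norm w * norm w' * C"
    using b.nonneg_bounded by blast
  have "integral {0..t} (\<lambda>s. (norm (T s (R \<beta> (R 1 w))))\<^sup>2) \<le> C * (norm (R 1 w))\<^sup>2" if t: "t \<ge> 0" for t w
  proof -
    define v where "v s = T s (R 1 w)" for s
    have "((\<lambda>s. - cinner (T s (R \<beta> (R 1 w))) (T s (R \<beta> (R 1 w)))) has_integral ?b (v t) (v t) - ?b (v 0) (v 0)) {0..t}"
    proof (rule fundamental_theorem_of_calculus[OF t])
      fix s assume s: "s \<in> {0..t}"
      let ?v' = "T s (R 1 w - w)"
      have "(v has_vector_derivative ?v') (at s within {0..t})"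
        unfolding v_def using s
        by (intro has_vector_derivative_within_subset[OF T_R_1_has_vector_derivative]) auto
      then have "((\<lambda>s. ?b (v s) (v s)) has_vector_derivative (?b (v s) ?v' + ?b ?v' (v s))) (at s within {0..t})"
        by (rule b.has_vector_derivative) fact
      moreover have "?b (v s) ?v' + ?b ?v' (v s) = - cinner (T s (R \<beta> (R 1 w))) (T s (R \<beta> (R 1 w)))"
      proof -
        have v: "v s = R 1 (T s w)" and v': "?v' = R 1 (T s w) - T s w"
          using s by (auto simp: v_def T_R T_diff_right)
        have "generator T (R \<beta> (v s)) = R \<beta> ?v'"
          unfolding v v' R_commute[OF \<beta> zero_less_one] generator_R
          by (simp add: R_diff_right[OF \<beta>] R_commute[OF \<beta> zero_less_one])
        moreover have "R \<beta> (v s) \<in> frac_power_dom T (\<beta> + 1)"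
          unfolding v using \<beta> by (simp add: R_R frac_power_dom_eq)
        ultimately have "?b ?v' (v s) + ?b (v s) ?v' = - cinner (R \<beta> (v s)) (R \<beta> (v s))"
          using lyapunov_P by metis
        then show ?thesis using s \<beta> by (simp add: v_def T_R add.commute)
      qed
      ultimately show "((\<lambda>s. ?b (v s) (v s)) has_vector_derivative
          - cinner (T s (R \<beta> (R 1 w))) (T s (R \<beta> (R 1 w)))) (at s within {0..t})" by simp
    qed
    from has_integral_neg[OF has_integral_linear[OF this bounded_linear_Re]]
    have I: "((\<lambda>s. (norm (T s (R \<beta> (R 1 w))))\<^sup>2) has_integral Re (?b (v 0) (v 0)) - Re (?b (v t) (v t))) {0..t}"
      by (simp add: o_def cinner_self del: of_real_power)
    have "Re (?b (v t) (v t)) \<ge> 0"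
      using nonneg_P[of "R \<beta> (v t)"] by (simp add: frac_power_dom_eq[OF \<beta>] complex_nonneg_Reals_iff)
    moreover have "Re (?b (v 0) (v 0)) \<le> C * (norm (R 1 w))\<^sup>2"
      using C(2)[of "v 0" "v 0"] abs_Re_le_cmod[of "?b (v 0) (v 0)"]
      by (simp add: v_def power2_eq_square mult_ac)
    ultimately show ?thesis unfolding integral_unique[OF I] by simp
  qed
  then show ?thesis using C(1) by blast
qed

text \<open>The energy bound yields the rate on \<open>range (R 1)\<close>. Since it involves only
  \<open>norm v\<close>, it defines a closed set and extends to the closure.\<close>

lemma decays_if_lyapunov: "decays \<beta> (1 / 2)"
proof -
  obtain C where C: "C \<ge> 0" "\<And>v t. v \<in> range (R 1) \<Longrightarrow> t \<ge> 0 \<Longrightarrow>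
      integral {0..t} (\<lambda>s. (norm (T s (R \<beta> v)))\<^sup>2) \<le> C * (norm v)\<^sup>2"
    using energy_bound by blast
  have "norm (T t (R \<beta> v)) \<le> M * sqrt C * t powr (- (1 / 2)) * norm v" if t: "t > 0" for t v
  proof -
    let ?S = "{v. norm (T t (R \<beta> v)) \<le> M * sqrt C * t powr (- (1 / 2)) * norm v}"
    have "continuous_on UNIV (\<lambda>v. T t (R \<beta> v))"
      using t \<beta> by (intro linear_continuous_on bounded_linear_compose[OF linear_T linear_R]) auto
    then have "closed ?S" by (intro closed_Collect_le continuous_intros)
    moreover have "range (R 1) \<subseteq> ?S"
    proof
      fix v assume v: "v \<in> range (R 1)"
      have "t * (norm (T t (R \<beta> v)))\<^sup>2 \<le> M\<^sup>2 * (C * (norm v)\<^sup>2)"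
        using norm_T_le_integral[of 0 t "R \<beta> v"] t mult_left_mono[OF C(2)[OF v], of t "M\<^sup>2"] by simp
      then have "(norm (T t (R \<beta> v)))\<^sup>2 \<le> (M * sqrt C * t powr (- (1 / 2)) * norm v)\<^sup>2"
        using t C(1) by (simp add: power_mult_distrib powr_minus powr_half_sqrt power_inverse field_simps)
      then show "v \<in> ?S" using power2_le_imp_le M_pos C(1) by simp
    qed
    ultimately have "closure (range (R 1)) \<subseteq> ?S" by (rule closure_minimal[rotated])
    then show ?thesis using dense_range_R_1 by auto
  qed
  then show ?thesis unfolding decays_def using M_pos C(1) by (intro exI[of _ "M * sqrt C"]) auto
qed

text \<open>For u in the dense range the energy converges, so its share over [t / 2, t] tends to 0.
  The uniform rate transfers the conclusion to every v.\<close>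

lemma T_R_tendsto_if_lyapunov: "((\<lambda>t. t powr (1 / 2) * norm (T t (R \<beta> v))) \<longlongrightarrow> 0) at_top"
proof (rule tendstoI)
  fix e :: real assume e: "e > 0"
  obtain K where K: "K \<ge> 0" "\<And>t w. t > 0 \<Longrightarrow> norm (T t (R \<beta> w)) \<le> K * t powr (- (1 / 2)) * norm w"
    using decays_if_lyapunov by (auto simp: decays_def)
  have "v \<in> closure (range (R 1))" by (simp add: dense_range_R_1)
  \<comment> \<open>K + 1 replaces K, which may be 0.\<close>
  then obtain u where u: "u \<in> range (R 1)" "dist u v < e / (2 * (K + 1))"
    using e K(1) unfolding closure_approachable by (metis divide_pos_pos add_nonneg_pos mult_pos_pos zero_less_numeral zero_less_one)
  let ?I = "\<lambda>t. integral {0..t} (\<lambda>s. (norm (T s (R \<beta> u)))\<^sup>2)"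
  obtain C where C: "\<And>t. t \<ge> 0 \<Longrightarrow> ?I t \<le> C" using energy_bound u by blast
  define L where "L = (SUP t\<in>{0..}. ?I t)"
  have bdd: "bdd_above (?I ` {0..})" using C by (intro bdd_aboveI2) auto
  have int: "(\<lambda>s. (norm (T s (R \<beta> u)))\<^sup>2) integrable_on {0..t}" for t
    by (intro integrable_continuous_real continuous_intros continuous_on_subset[OF continuous_T]) auto
  define d where "d = e\<^sup>2 / (16 * M\<^sup>2)"
  have d: "d > 0" using e M_pos by (simp add: d_def)
  then obtain t0 where t0: "t0 \<ge> 0" "?I t0 > L - d"
    using less_cSUP_iff[OF _ bdd, of "L - d"] unfolding L_def by auto
  show "\<forall>\<^sub>F t in at_top. dist (t powr (1 / 2) * norm (T t (R \<beta> v))) 0 < e"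
    using eventually_ge_at_top[of "2 * t0 + 1"]
  proof eventually_elim
    case (elim t)
    have t: "t > 0" "t / 2 \<ge> t0" using elim t0 by auto
    have "?I (t / 2) + integral {t / 2..t} (\<lambda>s. (norm (T s (R \<beta> u)))\<^sup>2) = ?I t"
      using t int by (intro Henstock_Kurzweil_Integration.integral_combine) auto
    moreover have "?I t \<le> L" unfolding L_def using t by (intro cSUP_upper bdd) auto
    moreover have "?I t0 \<le> ?I (t / 2)" using t int by (intro integral_subset_le) auto
    ultimately have "integral {t / 2..t} (\<lambda>s. (norm (T s (R \<beta> u)))\<^sup>2) \<le> d" using t0 by simp
    then have "M\<^sup>2 * integral {t / 2..t} (\<lambda>s. (norm (T s (R \<beta> u)))\<^sup>2) \<le> e\<^sup>2 / 16"
      using mult_left_mono[of _ d "M\<^sup>2"] M_pos by (simp add: d_def)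
    then have "t / 2 * (norm (T t (R \<beta> u)))\<^sup>2 \<le> e\<^sup>2 / 16"
      using norm_T_le_integral[of "t / 2" t "R \<beta> u"] t by simp
    then have "t * (norm (T t (R \<beta> u)))\<^sup>2 \<le> e\<^sup>2 / 8" by simp
    also have "\<dots> < e\<^sup>2 / 4" using e by simp
    finally have "t * (norm (T t (R \<beta> u)))\<^sup>2 < e\<^sup>2 / 4" .
    then have "(t powr (1 / 2) * norm (T t (R \<beta> u)))\<^sup>2 < (e / 2)\<^sup>2"
      using t by (simp add: power_mult_distrib powr_half_sqrt power_divide)
    then have 1: "t powr (1 / 2) * norm (T t (R \<beta> u)) < e / 2"
      by (rule power_less_imp_less_base) (use e in simp)
    have "T t (R \<beta> v) = T t (R \<beta> u) + T t (R \<beta> (v - u))"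
      using t \<beta> by (simp add: R_diff_right T_diff_right)
    then have "t powr (1 / 2) * norm (T t (R \<beta> v)) \<le> t powr (1 / 2) * norm (T t (R \<beta> u))
        + t powr (1 / 2) * norm (T t (R \<beta> (v - u)))"
      using mult_left_mono[OF norm_triangle_ineq[of "T t (R \<beta> u)" "T t (R \<beta> (v - u))"], of "t powr (1 / 2)"]
      by (simp only: distrib_left powr_ge_zero)
    also have "t powr (1 / 2) * norm (T t (R \<beta> (v - u))) \<le> t powr (1 / 2) * (K * t powr (- (1 / 2)) * norm (v - u))"
      using K(2)[OF t(1)] by (intro mult_left_mono) auto
    also have "\<dots> = K * norm (v - u)" using t by (simp add: powr_minus field_simps)
    also have "\<dots> \<le> (K + 1) * norm (v - u)" by (simp add: mult_right_mono)
    also have "\<dots> < e / 2" using u(2) K(1) by (simp add: dist_norm norm_minus_commute field_simps)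
    finally show ?case using 1 by (simp add: dist_norm)
  qed
qed

lemma decay_if_lyapunov:
  assumes x: "x \<in> generator_dom T"
  shows "(\<lambda>t. norm (T t x)) \<in> o[at_top](\<lambda>t. t powr (- inverse (2 * \<beta>)))"
proof -
  obtain w where w: "x = R 1 w" using x by (auto simp: generator_dom_eq)
  obtain n :: nat where n: "real n > 1 / \<beta>" using reals_Archimedean2 by blast
  have "n > 0" using n \<beta> by (cases n) (auto simp: field_simps)
  \<comment> \<open>The first n factors give an O-rate of order n / 2, the last one a factor o(t
    powr (- 1 / 2)). The choice of n makes \<gamma> \<ge> 1, as the moment inequality demands; it
    will be applied to \<open>T t w\<close>.\<close>
  define \<gamma> where "\<gamma> = real n * \<beta> + \<beta>"
  define q where "q = inverse (2 * \<beta>)"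
  have \<gamma>: "\<gamma> \<ge> 1" using n \<beta> by (simp add: \<gamma>_def field_simps)
  have q\<gamma>: "q * \<gamma> = real n * (1 / 2) + 1 / 2" using \<beta> by (simp add: q_def \<gamma>_def field_simps)
  obtain K where K: "K \<ge> 0" "\<And>t w. t > 0 \<Longrightarrow>
      norm (T t (R (real n * \<beta>) w)) \<le> K * t powr (- (real n * (1 / 2))) * norm w"
    using decays_mult[OF \<beta> decays_if_lyapunov \<open>n > 0\<close>] by (auto simp: decays_def)
  have n\<beta>: "real n * \<beta> > 0" using \<beta> \<open>n > 0\<close> by simp
  obtain C where C: "C > 0" "\<And>w. norm (R 1 w) powr \<gamma> \<le> C * norm w powr (\<gamma> - 1) * norm (R \<gamma> w)"
    using norm_moment[OF \<gamma>] by blast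
  define c where "c = C * (M * norm w) powr (\<gamma> - 1) * (K * (1 / 2) powr (- (q * \<gamma>)))"
  have bound: "(t powr q * norm (T t x)) powr \<gamma> \<le> c * ((t / 2) powr (1 / 2) * norm (T (t / 2) (R \<beta> w)))"
    if t: "t > 0" for t
  proof -
    have "norm (T t (R \<gamma> w)) \<le> K * (t / 2) powr (- (real n * (1 / 2))) * norm (T (t / 2) (R \<beta> w))"
      unfolding \<gamma>_def using K(2)[of "t / 2"] t n\<beta> \<beta> by (simp add: T_R_R_half)
    moreover have "t powr (q * \<gamma>) = (1 / 2) powr (- (q * \<gamma>)) * (t / 2) powr (q * \<gamma>)"
      using t by (simp add: powr_divide powr_minus field_simps)
    moreover have "(t / 2) powr (q * \<gamma>) * (t / 2) powr (- (real n * (1 / 2))) = (t / 2) powr (1 / 2)"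
      by (simp add: powr_add[symmetric] q\<gamma>)
    ultimately have 1: "t powr (q * \<gamma>) * norm (T t (R \<gamma> w))
        \<le> K * (1 / 2) powr (- (q * \<gamma>)) * ((t / 2) powr (1 / 2) * norm (T (t / 2) (R \<beta> w)))"
      using mult_left_mono[of "norm (T t (R \<gamma> w))" _ "t powr (q * \<gamma>)"]
      by (smt (verit, ccfv_SIG) mult.assoc mult.commute powr_ge_zero)
    have "norm (T t x) powr \<gamma> \<le> C * norm (T t w) powr (\<gamma> - 1) * norm (T t (R \<gamma> w))"
      using C(2)[of "T t w"] t \<gamma> by (simp add: w T_R)
    also have "\<dots> \<le> C * (M * norm w) powr (\<gamma> - 1) * norm (T t (R \<gamma> w))"
      using C(1) norm_T[of t w] t \<gamma> by (intro mult_right_mono mult_left_mono powr_mono2) auto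
    finally have "t powr (q * \<gamma>) * norm (T t x) powr \<gamma>
        \<le> t powr (q * \<gamma>) * (C * (M * norm w) powr (\<gamma> - 1) * norm (T t (R \<gamma> w)))"
      by (rule mult_left_mono) simp
    also have "\<dots> = C * (M * norm w) powr (\<gamma> - 1) * (t powr (q * \<gamma>) * norm (T t (R \<gamma> w)))"
      by (simp only: mult_ac)
    also have "\<dots> \<le> C * (M * norm w) powr (\<gamma> - 1) *
        (K * (1 / 2) powr (- (q * \<gamma>)) * ((t / 2) powr (1 / 2) * norm (T (t / 2) (R \<beta> w))))"
      using C(1) by (intro mult_left_mono 1) auto
    finally show ?thesis by (simp add: c_def powr_mult powr_powr mult_ac)
  qed
  have "filterlim (\<lambda>t::real. t / 2) at_top at_top" by real_asymp
  from filterlim_compose[OF T_R_tendsto_if_lyapunov[of w] this]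
  have "((\<lambda>t. c * ((t / 2) powr (1 / 2) * norm (T (t / 2) (R \<beta> w)))) \<longlongrightarrow> c * 0) at_top"
    by (rule tendsto_mult_left)
  then have g: "((\<lambda>t. c * ((t / 2) powr (1 / 2) * norm (T (t / 2) (R \<beta> w)))) \<longlongrightarrow> 0) at_top"
    by simp
  have "\<forall>\<^sub>F t in at_top. norm ((t powr q * norm (T t x)) powr \<gamma>)
      \<le> c * ((t / 2) powr (1 / 2) * norm (T (t / 2) (R \<beta> w)))"
    using eventually_gt_at_top[of 0] by eventually_elim (simp add: bound)
  from Lim_null_comparison[OF this g] have lim: "((\<lambda>t. (t powr q * norm (T t x)) powr \<gamma>) \<longlongrightarrow> 0) at_top" .
  have "((\<lambda>t. ((t powr q * norm (T t x)) powr \<gamma>) powr (1 / \<gamma>)) \<longlongrightarrow> 0) at_top"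
    using \<gamma> by (intro tendsto_zero_powrI[OF lim tendsto_const]) auto
  then have "((\<lambda>t. t powr q * norm (T t x)) \<longlongrightarrow> 0) at_top"
    using \<gamma> by (simp add: powr_powr)
  then have "((\<lambda>t. norm (T t x) / t powr (- q)) \<longlongrightarrow> 0) at_top"
    by (simp add: powr_minus divide_inverse mult.commute)
  then show ?thesis unfolding q_def[symmetric]
    using eventually_gt_at_top[of 0] by (intro smalloI_tendsto) (auto elim!: eventually_mono)
qed

end

end

subsection \<open>The Lyapunov condition from decay\<close>

text \<open>Banach-Steinhaus by Baire: the closed sets \<open>S n\<close> cover the space, so one of
  them contains a ball.\<close>

lemma uniform_boundedness:
  fixes f :: "'i \<Rightarrow> 'b::banach \<Rightarrow> 'c::real_normed_vector"
  assumes lin: "\<And>i. bounded_linear (f i)"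
    and bdd: "\<And>x. \<exists>C. \<forall>i. norm (f i x) \<le> C"
  shows "\<exists>C. \<forall>i x. norm (f i x) \<le> C * norm x"
proof -
  define S where "S n = {x. \<forall>i. norm (f i x) \<le> real n}" for n :: nat
  have closed: "closed (S n)" for n
  proof -
    have "S n = (\<Inter>i. {x. norm (f i x) \<le> real n})" by (auto simp: S_def)
    moreover have "closed {x. norm (f i x) \<le> real n}" for i
      by (intro closed_Collect_le continuous_intros linear_continuous_on lin)
    ultimately show ?thesis by auto
  qed
  have "\<exists>n. interior (S n) \<noteq> {}"
  proof (rule ccontr)
    assume "\<nexists>n. interior (S n) \<noteq> {}"
    then have "\<And>G. G \<in> range (\<lambda>n. - S n) \<Longrightarrow> open G \<and> closure G = UNIV"
      using closed by (auto simp: closure_complement)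
    then have "closure (\<Inter>(range (\<lambda>n. - S n))) = UNIV"
      using Baire_category[of euclidean "range (\<lambda>n. - S n)"]
      by (simp add: completely_metrizable_space_euclidean)
    moreover have "\<Inter>(range (\<lambda>n. - S n)) = {}"
    proof -
      have "\<exists>n. x \<in> S n" for x
      proof -
        obtain C where C: "\<And>i. norm (f i x) \<le> C" using bdd by blast
        obtain n where "C \<le> real n" using real_arch_simple by blast
        then have "x \<in> S n" using C order_trans by (auto simp: S_def)
        then show ?thesis by blast
      qed
      then show ?thesis by auto
    qed
    ultimately show False by simp
  qed
  then obtain n x0 where "x0 \<in> interior (S n)" by auto
  then obtain e where e: "e > 0" "cball x0 e \<subseteq> S n" using mem_interior_cball by blast
  have "norm (f i x) \<le> 2 * real n / e * norm x" for i x
  proof (cases "x = 0")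
    case True
    then show ?thesis using lin[THEN bounded_linear.linear, THEN linear_0] by simp
  next
    case False
    note li = lin[THEN bounded_linear.linear, of i]
    \<comment> \<open>x is rescaled to the radius of the ball, so that f y is a difference of two
      values bounded by n.\<close>
    define y where "y = (e / norm x) *\<^sub>R x"
    have "norm y = e" using False e by (simp add: y_def)
    then have "x0 + y \<in> S n" "x0 \<in> S n" using e by (auto simp: dist_norm subset_iff)
    then have "norm (f i (x0 + y)) \<le> real n" "norm (f i x0) \<le> real n" by (auto simp: S_def)
    then have "norm (f i (x0 + y) - f i x0) \<le> 2 * real n"
      using norm_triangle_ineq4[of "f i (x0 + y)" "f i x0"] by linarith
    then have "norm (f i y) \<le> 2 * real n" by (simp add: linear_add[OF li])
    then have "e / norm x * norm (f i x) \<le> 2 * real n"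
      using e by (simp add: y_def linear_scale[OF li])
    then show ?thesis using e False by (simp add: field_simps)
  qed
  then show ?thesis by blast
qed

lemma inverse_square_kernel_integrable: "(\<lambda>t::real. (1 + t) powr (- 2)) integrable_on {0..}"
proof -
  have d: "((\<lambda>t. - inverse (1 + t)) has_vector_derivative (1 + t) powr (- 2)) (at t within S)"
    if "t \<ge> 0" for t :: real and S
    using that unfolding has_real_derivative_iff_has_vector_derivative[symmetric]
    by (auto intro!: derivative_eq_intros simp: powr_minus powr_numeral field_simps power2_eq_square)
  have I: "((\<lambda>t::real. (1 + t) powr (- 2)) has_integral - inverse (1 + y) - - inverse (1 + 0)) {0..y}"
    if "y \<ge> 0" for y
    by (rule fundamental_theorem_of_calculus[OF that]) (auto intro: d)
  have "((\<lambda>t::real. (1 + t) powr (- 2)) has_integral 1) {0..}"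
  proof (rule has_integral_to_inf)
    show "(\<lambda>t::real. (1 + t) powr (- 2)) integrable_on {0..y}" for y
      using I[of y] by (cases "y \<ge> 0") auto
    have "((\<lambda>y::real. - inverse (1 + y) - - inverse (1 + 0)) \<longlongrightarrow> 1) at_top" by real_asymp
    then show "((\<lambda>y::real. integral {0..y} (\<lambda>t. (1 + t) powr (- 2))) \<longlongrightarrow> 1) at_top"
      by (rule Lim_transform_eventually)
        (use eventually_ge_at_top[of 0] in eventually_elim, simp add: integral_unique[OF I])
  qed auto
  then show ?thesis by blast
qed

section \<open>Decay rates and the integral defining \<open>P\<close>\<close>

context bounded_semigroup
begin

lemma decays_1:
  assumes \<alpha>: "\<alpha> > 0"
    and o: "\<And>x. x \<in> generator_dom T \<Longrightarrow> (\<lambda>t. norm (T t x)) \<in> o[at_top](\<lambda>t. t powr (- \<alpha>))"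
  shows "decays 1 \<alpha>"
proof -
  \<comment> \<open>The family is indexed by all reals, so negative t are sent to 0. For large t the
    little o bounds the family by 1, for smaller t boundedness of the semigroup does.\<close>
  define f where "f t = (\<lambda>w. (max t 0 powr \<alpha>) *\<^sub>R T (max t 0) (R 1 w))" for t
  have lin: "bounded_linear (f t)" for t unfolding f_def
    by (intro bounded_linear_compose[OF bounded_linear_scaleR_right]
        bounded_linear_compose[OF linear_T linear_R]) auto
  have "\<exists>C. \<forall>t. norm (f t w) \<le> C" for w
  proof -
    have "(\<lambda>t. norm (T t (R 1 w))) \<in> o[at_top](\<lambda>t. t powr (- \<alpha>))"
      by (rule o) (simp add: generator_dom_eq)
    then have "\<forall>\<^sub>F t in at_top. norm (norm (T t (R 1 w))) \<le> 1 * norm (t powr (- \<alpha>))"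
      by (rule landau_o.smallD) simp
    then obtain N where N: "\<And>t. t \<ge> N \<Longrightarrow> norm (T t (R 1 w)) \<le> t powr (- \<alpha>)"
      by (auto simp: eventually_at_top_linorder)
    have "norm (f t w) \<le> max 1 (max N 0 powr \<alpha> * (M * norm (R 1 w)))" for t
    proof (cases "t \<ge> N \<and> t > 0")
      case True
      then have "norm (f t w) \<le> t powr \<alpha> * t powr (- \<alpha>)"
        using N[of t] by (simp add: f_def max_def mult_left_mono)
      also have "\<dots> = 1" using True by (simp add: powr_minus)
      finally show ?thesis by simp
    next
      case False
      then have "max t 0 powr \<alpha> \<le> max N 0 powr \<alpha>" using \<alpha> by (intro powr_mono2) auto
      then have "norm (f t w) \<le> max N 0 powr \<alpha> * (M * norm (R 1 w))"
        using norm_T[of "max t 0" "R 1 w"] by (simp add: f_def mult_mono)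
      then show ?thesis by simp
    qed
    then show ?thesis by blast
  qed
  from uniform_boundedness[OF lin this]
  obtain C where C: "\<And>t w. norm (f t w) \<le> C * norm w" by blast
  have "norm (T t (R 1 w)) \<le> max C 0 * t powr (- \<alpha>) * norm w" if t: "t > 0" for t w
  proof -
    have "t powr \<alpha> * norm (T t (R 1 w)) \<le> max C 0 * norm w"
    proof -
      have "max t 0 = t" using t by simp
      then have "t powr \<alpha> * norm (T t (R 1 w)) \<le> C * norm w" using C[of t w] by (simp add: f_def)
      also have "\<dots> \<le> max C 0 * norm w" by (rule mult_right_mono) auto
      finally show ?thesis .
    qed
    then show ?thesis using t by (simp add: powr_minus field_simps)
  qed
  then show ?thesis unfolding decays_def by (intro exI[of _ "max C 0"]) auto
qed

text \<open>The splitting is cut at d = t powr (- \<alpha>), the decay rate of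
  \<open>T t (R 1 w)\<close>; both terms then have order d powr \<sigma>.\<close>

lemma decays_fractional:
  assumes \<sigma>: "0 < \<sigma>" "\<sigma> < 1" and dec: "decays 1 \<alpha>"
  shows "decays \<sigma> (\<sigma> * \<alpha>)"
proof -
  obtain K where K: "K \<ge> 0" "\<And>t w. t > 0 \<Longrightarrow> norm (T t (R 1 w)) \<le> K * t powr (- \<alpha>) * norm w"
    using dec by (auto simp: decays_def)
  note G = Gamma_real_pos[OF \<sigma>(1)]
  define L where "L = (M * M / \<sigma> + 2 * M * K) / Gamma \<sigma>"
  have "norm (T t (R \<sigma> w)) \<le> L * t powr (- (\<sigma> * \<alpha>)) * norm w" if t: "t > 0" for t w
  proof -
    define d where "d = t powr (- \<alpha>)"
    have d: "d > 0" using t by (simp add: d_def)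
    have "Gamma \<sigma> * norm (T t (R \<sigma> w)) \<le> d powr \<sigma> / \<sigma> * (M * norm (T t w))
        + 2 * d powr (\<sigma> - 1) * (M * norm (R 1 (T t w)))"
      using norm_R_split[OF \<sigma> d, of "T t w"] t \<sigma> by (simp add: T_R)
    also have "\<dots> \<le> d powr \<sigma> / \<sigma> * (M * (M * norm w)) + 2 * d powr (\<sigma> - 1) * (M * (K * d * norm w))"
      using norm_T[of t w] K(2)[OF t, of w] t \<sigma> M_pos
      by (intro add_mono mult_left_mono) (auto simp: T_R d_def)
    also have "d powr (\<sigma> - 1) = d powr \<sigma> / d" using d by (simp add: powr_diff)
    also have "d powr \<sigma> / \<sigma> * (M * (M * norm w)) + 2 * (d powr \<sigma> / d) * (M * (K * d * norm w))
        = Gamma \<sigma> * (L * d powr \<sigma> * norm w)"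
    proof -
      have "Gamma \<sigma> * L = M * M / \<sigma> + 2 * M * K" using G by (simp add: L_def)
      then have "Gamma \<sigma> * (L * d powr \<sigma> * norm w) = (M * M / \<sigma> + 2 * M * K) * (d powr \<sigma> * norm w)"
        by (metis mult.assoc)
      then show ?thesis using d by (simp add: algebra_simps)
    qed
    finally have "norm (T t (R \<sigma> w)) \<le> L * d powr \<sigma> * norm w" using G by simp
    then show ?thesis by (simp add: d_def powr_powr mult.commute)
  qed
  then show ?thesis unfolding decays_def using K(1) M_pos G \<sigma>
    by (intro exI[of _ L]) (auto simp: L_def)
qed

lemma decays_R_left:
  assumes "a > 0" "b > 0" "decays a p"
  shows "decays (b + a) p"
proof -
  obtain K where K: "K \<ge> 0" "\<And>t w. t > 0 \<Longrightarrow> norm (T t (R a w)) \<le> K * t powr (- p) * norm w"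
    using assms by (auto simp: decays_def)
  have "norm (T t (R (b + a) w)) \<le> M * K * t powr (- p) * norm w" if t: "t > 0" for t w
  proof -
    have "norm (T t (R (b + a) w)) \<le> M * norm (T t (R a w))"
      using norm_R[of b "T t (R a w)"] assms t by (simp add: R_R[symmetric] T_R)
    also have "\<dots> \<le> M * (K * t powr (- p) * norm w)" using K(2)[OF t] M_pos by (intro mult_left_mono) auto
    finally show ?thesis by (simp add: mult_ac)
  qed
  then show ?thesis unfolding decays_def using K(1) M_pos by (intro exI[of _ "M * K"]) auto
qed

text \<open>For \<beta> < 1 interpolation gives the rate \<alpha> \<beta> > 2. Otherwise let n be
  the integer part: \<beta> < n + 1 \<le> 2 n gives n \<alpha> > 1, and the bounded factor with the
  fractional exponent is discarded.\<close>

lemma decays_ge_1: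
  assumes dec: "decays 1 \<alpha>" and \<alpha>: "\<alpha> > 0" and \<beta>: "\<beta> > 2 * inverse \<alpha>"
  shows "\<exists>p\<ge>1. decays \<beta> p"
proof -
  have \<beta>0: "\<beta> > 0" using \<alpha> \<beta> by (smt (verit) inverse_positive_iff_positive)
  have \<alpha>\<beta>: "\<alpha> * \<beta> > 2" using \<alpha> \<beta> by (simp add: field_simps)
  show ?thesis
  proof (cases "\<beta> < 1")
    case True
    then show ?thesis using decays_fractional[OF \<beta>0 True dec] \<alpha>\<beta> by (intro exI[of _ "\<beta> * \<alpha>"]) (simp add: mult.commute)
  next
    case False
    define n where "n = nat \<lfloor>\<beta>\<rfloor>"
    have n: "n \<ge> 1" "real n \<le> \<beta>" "\<beta> < real n + 1" using False by (auto simp: n_def) linarith+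
    have d: "decays (real n) (real n * \<alpha>)" using decays_mult[OF zero_less_one dec, of n] n by simp
    have "\<beta> \<le> 2 * real n" using n by linarith
    then have "2 < \<alpha> * (2 * real n)" using \<alpha>\<beta> mult_left_mono[of \<beta> "2 * real n" \<alpha>] \<alpha> by linarith
    then have "real n * \<alpha> \<ge> 1" by (simp add: mult.commute)
    moreover have "decays \<beta> (real n * \<alpha>)"
    proof (cases "\<beta> = real n")
      case False
      then show ?thesis using decays_R_left[of "real n" "\<beta> - real n", OF _ _ d] n by simp
    qed (use d in simp)
    ultimately show ?thesis by blast
  qed
qed

lemma norm_T_R_le_inverse:
  assumes \<beta>: "\<beta> > 0" and p: "p \<ge> 1" "decays \<beta> p"
  shows "\<exists>K\<ge>0. \<forall>t\<ge>0. \<forall>w. norm (T t (R \<beta> w)) \<le> K * (1 + t) powr (- 1) * norm w"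
proof -
  obtain K where K: "K \<ge> 0" "\<And>t w. t > 0 \<Longrightarrow> norm (T t (R \<beta> w)) \<le> K * t powr (- p) * norm w"
    using p by (auto simp: decays_def)
  \<comment> \<open>The factor 2 serves both ranges: 1 / t \<le> 2 / (1 + t) for t \<ge> 1, and 1
    \<le> 2 / (1 + t) for t < 1, where only boundedness is used.\<close>
  define L where "L = 2 * (K + M * M)"
  have KL: "K \<le> L / 2" "M * M \<le> L / 2" using K(1) by (auto simp: L_def)
  have "norm (T t (R \<beta> w)) \<le> L * (1 + t) powr (- 1) * norm w" if t: "t \<ge> 0" for t w
  proof (cases "t \<ge> 1")
    case True
    have "t powr (- p) \<le> t powr (- 1)" using True p by (intro powr_mono) auto
    also have "\<dots> \<le> 2 * (1 + t) powr (- 1)" using True by (simp add: powr_minus field_simps)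
    finally have "K * t powr (- p) \<le> L / 2 * (2 * (1 + t) powr (- 1))"
      using KL K(1) by (intro mult_mono) auto
    then have "K * t powr (- p) * norm w \<le> L / 2 * (2 * (1 + t) powr (- 1)) * norm w"
      by (intro mult_right_mono) auto
    then show ?thesis using K(2)[of t w] True by simp
  next
    case False
    have "norm (T t (R \<beta> w)) \<le> M * (M * norm w)"
      using norm_T[OF t, of "R \<beta> w"] norm_R[OF \<beta>, of w] M_pos mult_left_mono[of _ "M * norm w" M]
      by (meson less_imp_le order_trans)
    also have "\<dots> \<le> L / 2 * norm w" using mult_right_mono[OF KL(2), of "norm w"] by simp
    also have "\<dots> \<le> (L * (1 + t) powr (- 1)) * norm w"
    proof (rule mult_right_mono)
      have "1 / 2 \<le> (1 + t) powr (- 1)" using False t by (simp add: powr_minus field_simps)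
      then show "L / 2 \<le> L * (1 + t) powr (- 1)"
        using mult_left_mono[of "1/2" "(1 + t) powr (- 1)" L] K(1) by (simp add: L_def)
    qed simp
    finally show ?thesis .
  qed
  then show ?thesis using K(1) by (intro exI[of _ L]) (auto simp: L_def)
qed

text \<open>A rate of order 1 / t makes the integrand O((1 + t) powr (- 2)), uniformly in the
  coordinates. The equation for \<open>P\<close> then comes from integrating the derivative of
  \<open>cinner (T t x) (T t y)\<close>.\<close>

lemma lyapunov_if_decays:
  assumes \<beta>: "\<beta> > 0" and p: "p \<ge> 1" "decays \<beta> p"
  shows "lyapunov_condition T \<beta>"
proof -
  let ?D = "frac_power_dom T \<beta>" and ?N = "graph_norm T \<beta>"
  let ?i = "\<lambda>x y t. cinner (T t x) (T t y)"
  define P where "P x y = integral {0..} (?i x y)" for x y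
  obtain K where K: "K \<ge> 0" "\<And>t w. t \<ge> 0 \<Longrightarrow> norm (T t (R \<beta> w)) \<le> K * (1 + t) powr (- 1) * norm w"
    using norm_T_R_le_inverse[OF assms] by blast
  have D: "?D = range (R \<beta>)" by (rule frac_power_dom_eq[OF \<beta>])
  have cont: "continuous_on {0..} (?i x y)" for x y
    by (intro bounded_bilinear.continuous_on[OF bounded_bilinear_cinner] continuous_T)
  have bound: "norm (?i (R \<beta> w) (R \<beta> v) t) \<le> K\<^sup>2 * norm w * norm v * (1 + t) powr (- 2)" if t: "t \<ge> 0" for t w v
  proof -
    have "norm (?i (R \<beta> w) (R \<beta> v) t) \<le> norm (T t (R \<beta> w)) * norm (T t (R \<beta> v))"
      by (rule cmod_cinner_le)
    also have "\<dots> \<le> (K * (1 + t) powr (- 1) * norm w) * (K * (1 + t) powr (- 1) * norm v)"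
      using K t by (intro mult_mono) auto
    also have "\<dots> = K\<^sup>2 * norm w * norm v * ((1 + t) powr (- 1) * (1 + t) powr (- 1))"
      by (simp add: power2_eq_square mult_ac)
    also have "(1 + t) powr (- 1) * (1 + t) powr (- 1) = (1 + t) powr (- 2)"
      using powr_add[of "1 + t" "- 1" "- 1"] by simp
    finally show ?thesis .
  qed
  have int': "?i (R \<beta> w) (R \<beta> v) integrable_on {0..}" for w v
    by (rule integrable_continuous_dominated[OF continuous_on_subset[OF cont]
          integrable_on_mult_right[OF inverse_square_kernel_integrable, of "K\<^sup>2 * norm w * norm v"]])
      (use bound in auto)
  have int: "?i x y integrable_on {0..}" if "x \<in> ?D" "y \<in> ?D" for x y
    using that int' unfolding D by auto
  define J where "J = integral {0..} (\<lambda>t::real. (1 + t) powr (- 2))"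
  have J: "J \<ge> 0" unfolding J_def by (intro integral_nonneg inverse_square_kernel_integrable) auto
  have P_bound: "cmod (P (R \<beta> w) (R \<beta> v)) \<le> K\<^sup>2 * norm w * norm v * J" for w v
  proof -
    have "cmod (P (R \<beta> w) (R \<beta> v)) \<le> integral {0..} (\<lambda>t. K\<^sup>2 * norm w * norm v * (1 + t) powr (- 2))"
      unfolding P_def
      by (rule integral_norm_bound_integral[OF int' integrable_on_mult_right[OF inverse_square_kernel_integrable]])
        (use bound in auto)
    then show ?thesis by (simp add: J_def)
  qed
  obtain L where L: "L \<ge> 0" "\<And>w. norm w \<le> L * ?N (R \<beta> w)"
    using norm_le_graph_norm_R[OF \<beta>] by blast
  have N_nonneg: "?N x \<ge> 0" for x by (simp add: graph_norm_def)
  define C where "C = K\<^sup>2 * L * L * J"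
  have C: "C \<ge> 0" using L(1) J by (simp add: C_def)
  have P_le: "cmod (P x y) \<le> C * ?N x * ?N y" if xy: "x \<in> ?D" "y \<in> ?D" for x y
  proof -
    obtain w v where x: "x = R \<beta> w" and y: "y = R \<beta> v" using xy unfolding D by blast
    have "cmod (P x y) \<le> K\<^sup>2 * norm w * norm v * J" unfolding x y by (rule P_bound)
    also have "\<dots> \<le> K\<^sup>2 * (L * ?N x) * (L * ?N y) * J"
      unfolding x y using L J N_nonneg by (intro mult_right_mono mult_mono) auto
    finally show ?thesis by (simp add: C_def mult_ac)
  qed
  have sum: "P (x + x') y = P x y + P x' y" "P y (x + x') = P y x + P y x'"
    if "x \<in> ?D" "x' \<in> ?D" "y \<in> ?D" for x x' y
  proof -
    have "((\<lambda>t. ?i x y t + ?i x' y t) has_integral P x y + P x' y) {0..}"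
      unfolding P_def using that int by (intro has_integral_add integrable_integral) auto
    then have "(?i (x + x') y has_integral P x y + P x' y) {0..}"
      by (rule has_integral_eq[rotated]) (simp add: T_add_right cinner_add_left)
    then show "P (x + x') y = P x y + P x' y" unfolding P_def[of "x + x'"] by (rule integral_unique)
    have "((\<lambda>t. ?i y x t + ?i y x' t) has_integral P y x + P y x') {0..}"
      unfolding P_def using that int by (intro has_integral_add integrable_integral) auto
    then have "(?i y (x + x') has_integral P y x + P y x') {0..}"
      by (rule has_integral_eq[rotated]) (simp add: T_add_right cinner_add_right)
    then show "P y (x + x') = P y x + P y x'" unfolding P_def[of _ "x + x'"] by (rule integral_unique)
  qed
  have scale: "P (c *\<^sub>C x) y = c * P x y" "P y (c *\<^sub>C x) = cnj c * P y x"
    if "x \<in> ?D" "y \<in> ?D" for c x y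
  proof -
    have "((\<lambda>t. c * ?i x y t) has_integral c * P x y) {0..}"
      unfolding P_def using that int by (intro has_integral_mult_right integrable_integral) auto
    then have "(?i (c *\<^sub>C x) y has_integral c * P x y) {0..}"
      by (rule has_integral_eq[rotated]) (simp add: T_scaleC cinner_scaleC_left)
    then show "P (c *\<^sub>C x) y = c * P x y" unfolding P_def[of "c *\<^sub>C x"] by (rule integral_unique)
    have "((\<lambda>t. cnj c * ?i y x t) has_integral cnj c * P y x) {0..}"
      unfolding P_def using that int by (intro has_integral_mult_right integrable_integral) auto
    then have "(?i y (c *\<^sub>C x) has_integral cnj c * P y x) {0..}"
      by (rule has_integral_eq[rotated]) (simp add: T_scaleC cinner_scaleC_right)
    then show "P y (c *\<^sub>C x) = cnj c * P y x" unfolding P_def[of _ "c *\<^sub>C x"] by (rule integral_unique)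
  qed
  have "bounded_clinear_to_antidual ?D ?N P"
    unfolding bounded_clinear_to_antidual_def
  proof (intro conjI ballI allI)
    fix x assume x: "x \<in> ?D"
    show "P x \<in> antidual ?D ?N"
      unfolding antidual_def using x P_le[OF x] sum(2) scale(2) by blast
  next
    show "\<exists>C. \<forall>x\<in>?D. antidual_norm ?D ?N (P x) \<le> C * ?N x"
    proof (intro exI[of _ C] ballI)
      fix x assume x: "x \<in> ?D"
      show "antidual_norm ?D ?N (P x) \<le> C * ?N x"
        unfolding antidual_norm_def
      proof (rule cSUP_least)
        \<comment> \<open>The least-upper-bound rule needs a nonempty set; zero, written as
          \<open>R \<beta> 0\<close>, lies in the unit ball.\<close>
        have "R \<beta> 0 \<in> ?D" unfolding D by blast
        moreover have "?N (R \<beta> 0) \<le> 1"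
        proof -
          have "frac_power T \<beta> (R \<beta> 0) = 0"
            unfolding frac_power_R[OF \<beta>]
            by (simp add: R_series_def linear_0[OF bounded_linear.linear[OF linear_R_1_funpow]])
          then show ?thesis using \<beta> by (simp add: graph_norm_def R_zero)
        qed
        ultimately show "{y \<in> ?D. ?N y \<le> 1} \<noteq> {}" by blast
      next
        fix y assume y: "y \<in> {y \<in> ?D. ?N y \<le> 1}"
        then have "C * ?N x * ?N y \<le> C * ?N x * 1"
          using C N_nonneg by (intro mult_left_mono) auto
        then show "cmod (P x y) \<le> C * ?N x" using P_le[OF x, of y] y by simp
      qed
    qed
  qed (use sum(1) scale(1) in blast)+
  moreover have "P x x \<in> \<real>\<^sub>\<ge>\<^sub>0" if x: "x \<in> ?D" for x
  proof -
    have "Re (P x x) \<ge> 0" "Im (P x x) = 0"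
    proof -
      note I = integrable_integral[OF int[OF x x]]
      have "((\<lambda>t. (norm (T t x))\<^sup>2) has_integral Re (P x x)) {0..}"
        using has_integral_linear[OF I bounded_linear_Re]
        by (simp add: o_def cinner_self P_def del: of_real_power)
      then show "Re (P x x) \<ge> 0" by (rule has_integral_nonneg) simp
      have "((\<lambda>t::real. 0) has_integral Im (P x x)) {0..}"
        using has_integral_linear[OF I bounded_linear_Im]
        by (simp add: o_def cinner_self P_def del: of_real_power)
      then show "Im (P x x) = 0" by simp
    qed
    then show ?thesis by (simp add: complex_nonneg_Reals_iff)
  qed
  moreover have "P (generator T x) y + P x (generator T y) = - cinner x y"
    if xy: "x \<in> frac_power_dom T (\<beta> + 1)" "y \<in> frac_power_dom T (\<beta> + 1)" for x y
  proof -
    have "range (R (\<beta> + 1)) = range (\<lambda>w. R 1 (R \<beta> w))" using \<beta> by (simp add: R_R add.commute)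
    then obtain w v where x: "x = R 1 (R \<beta> w)" and y: "y = R 1 (R \<beta> v)"
      using xy \<beta> by (auto simp: frac_power_dom_eq)
    \<comment> \<open>Both x and \<open>generator T x\<close> are images under
      \<open>R \<beta>\<close>, so the decay bound applies to each integral below.\<close>
    have gx: "generator T x = R \<beta> (R 1 w - w)" and gy: "generator T y = R \<beta> (R 1 v - v)"
      using \<beta> by (simp_all add: x y generator_R R_diff_right R_commute[of \<beta> 1])
    have xR: "x = R \<beta> (R 1 w)" and yR: "y = R \<beta> (R 1 v)" using \<beta> by (simp_all add: x y R_commute[of \<beta> 1])
    have "((\<lambda>t. ?i (generator T x) y t + ?i x (generator T y) t) has_integral
        P (generator T x) y + P x (generator T y)) {0..}"
      unfolding P_def gx gy unfolding xR yR by (intro has_integral_add integrable_integral int')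
    then have lim: "((\<lambda>N. integral {0..N} (\<lambda>t. ?i (generator T x) y t + ?i x (generator T y) t)) \<longlongrightarrow>
        P (generator T x) y + P x (generator T y)) at_top"
      by (rule integral_tendsto_at_top)
    have "\<forall>\<^sub>F N in at_top. ?i x y N - cinner x y = integral {0..N} (\<lambda>t. ?i (generator T x) y t + ?i x (generator T y) t)"
      using eventually_ge_at_top[of 0]
    proof eventually_elim
      case (elim N)
      have "((\<lambda>t. ?i (generator T x) y t + ?i x (generator T y) t) has_integral ?i x y N - ?i x y 0) {0..N}"
      proof (rule fundamental_theorem_of_calculus[OF elim])
        fix t assume t: "t \<in> {0..N}"
        have dx: "((\<lambda>s. T s x) has_vector_derivative T t (generator T x)) (at t within {0..N})"
          "((\<lambda>s. T s y) has_vector_derivative T t (generator T y)) (at t within {0..N})"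
          unfolding x y generator_R using t
          by (auto intro!: has_vector_derivative_within_subset[OF T_R_1_has_vector_derivative])
        then show "(?i x y has_vector_derivative ?i (generator T x) y t + ?i x (generator T y) t) (at t within {0..N})"
          using bounded_bilinear.has_vector_derivative[OF bounded_bilinear_cinner dx]
          by (simp add: add.commute)
      qed
      then show ?case by (simp add: integral_unique)
    qed
    from Lim_transform_eventually[OF _ this]
    have lim': "((\<lambda>N. integral {0..N} (\<lambda>t. ?i (generator T x) y t + ?i x (generator T y) t)) \<longlongrightarrow> l) at_top"
      if "((\<lambda>N. ?i x y N - cinner x y) \<longlongrightarrow> l) at_top" for l using that by blast
    \<comment> \<open>The boundary term at infinity vanishes, so only the one at 0, with value
      \<open>- cinner x y\<close>, remains.\<close>
    have "(?i x y \<longlongrightarrow> 0) at_top"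
    proof (rule Lim_null_comparison)
      show "\<forall>\<^sub>F t in at_top. norm (?i x y t) \<le> K\<^sup>2 * norm (R 1 w) * norm (R 1 v) * (1 + t) powr (- 2)"
        using eventually_ge_at_top[of 0] unfolding xR yR by eventually_elim (rule bound)
      have "((\<lambda>t::real. (1 + t) powr (- 2)) \<longlongrightarrow> 0) at_top" by real_asymp
      from tendsto_mult_left[OF this, of "K\<^sup>2 * norm (R 1 w) * norm (R 1 v)"]
      show "((\<lambda>t. K\<^sup>2 * norm (R 1 w) * norm (R 1 v) * (1 + t) powr (- 2)) \<longlongrightarrow> 0) at_top" by simp
    qed
    from lim'[OF tendsto_diff[OF this tendsto_const]]
    show ?thesis using tendsto_unique[OF _ lim] by simp
  qed
  ultimately show ?thesis unfolding lyapunov_condition_def by blast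
qed

end

theorem corollary3p3:
  fixes T :: "real \<Rightarrow> 'a::chilbert_space \<Rightarrow> 'a"
  assumes "bounded_C0_semigroup T"
  shows "(\<forall>\<beta>>0. lyapunov_condition T \<beta> \<longrightarrow>
            (\<forall>x\<in>generator_dom T.
              (\<lambda>t. norm (T t x)) \<in> o[at_top](\<lambda>t. t powr (- inverse (2 * \<beta>))))) \<and>
         (\<forall>\<alpha>>0. (\<forall>x\<in>generator_dom T.
              (\<lambda>t. norm (T t x)) \<in> o[at_top](\<lambda>t. t powr (- \<alpha>))) \<longrightarrow>
            (\<forall>\<beta>>2 * inverse \<alpha>. lyapunov_condition T \<beta>))"
proof -
  obtain M where "bounded_semigroup T M"
    using bounded_semigroup_if_bounded_C0_semigroup[OF assms] by blast
  then interpret bounded_semigroup T M .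
  show ?thesis
  proof (intro conjI allI impI ballI)
    fix \<beta> x
    assume "\<beta> > 0" "lyapunov_condition T \<beta>" and x: "x \<in> generator_dom T"
    then obtain P where
      "bounded_clinear_to_antidual (frac_power_dom T \<beta>) (graph_norm T \<beta>) P"
      "\<forall>x\<in>frac_power_dom T \<beta>. P x x \<in> \<real>\<^sub>\<ge>\<^sub>0"
      "\<forall>x\<in>frac_power_dom T (\<beta> + 1). \<forall>y\<in>frac_power_dom T (\<beta> + 1).
        P (generator T x) y + P x (generator T y) = - cinner x y"
      unfolding lyapunov_condition_def by blast
    then show "(\<lambda>t. norm (T t x)) \<in> o[at_top](\<lambda>t. t powr (- inverse (2 * \<beta>)))"
      using \<open>\<beta> > 0\<close> x by (intro decay_if_lyapunov[where P = P]) auto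
  next
    fix \<alpha> \<beta> :: real
    assume \<alpha>: "\<alpha> > 0" and \<beta>: "\<beta> > 2 * inverse \<alpha>"
      and "\<forall>x\<in>generator_dom T. (\<lambda>t. norm (T t x)) \<in> o[at_top](\<lambda>t. t powr (- \<alpha>))"
    then have "decays 1 \<alpha>" using decays_1 by blast
    then obtain p where "p \<ge> 1" "decays \<beta> p" using decays_ge_1[OF _ \<alpha> \<beta>] by blast
    moreover have "\<beta> > 0" using \<alpha> \<beta> by (smt (verit) inverse_positive_iff_positive)
    ultimately show "lyapunov_condition T \<beta>" by (intro lyapunov_if_decays)
  qed
qed

end
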